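(* Let $k$ be a field, $P$ a finite connected poset, and $T\in\mathrm{Int}(P)$. Let $U_1,\dots,U_m$ be an ordering of the inclusion-maximal elements of $\mathcal U(T)\setminus\{T\}$. For $J\subseteq[m]=\{1,\dots,m\}$ put $U_J=\bigcap_{j\in J}U_j$, with $U_\varnothing=T$, and for $q\ge0$ set $$\mathsf Q_q(T)=\bigoplus_{\substack{J\subseteq[m]\\|J|=q}}\ \bigoplus_{C\in\pi_0(U_J)}\mathsf P(C),$$ so that $\mathsf Q_0(T)=\mathsf P(T)$. For $q\geq1$ let $d_q\colon\mathsf Q_q(T)\to\mathsf Q_{q-1}(T)$ be the homomorphism whose restriction to the summand $\mathsf P(C)$ indexed by $(J,C)$, $J=\{j_0<\dots<j_{q-1}\}$, is $$\sum_{r=0}^{q-1}(-1)^r\,\iota_{J_r}\circ (j_{C,C^{J_r}})_*,\qquad J_r=J\setminus\{j_r\},$$ where $C^{J_r}$ is the unique connected component of $U_{J_r}$ containing $C$, $(j_{C,C^{J_r}})_*\colon\mathsf P(C)\to\mathsf P(C^{J_r})$ is induced by the inclusion $j_{C,C^{J_r}}\colon\mathbb I_C\to\mathbb I_{C^{J_r}}$, and $\iota_{J_r}$ is the inclusion of the summand of $\mathsf Q_{q-1}(T)$ indexed by $(J_r,C^{J_r})$. Let $\pi_T\colon\mathsf P(T)\to\Delta(T)$ be the canonical epimorphism. Then $$\cdots\to\mathsf Q_2(T)\xrightarrow{d_2}\mathsf Q_1(T)\xrightarrow{d_1}\mathsf Q_0(T)\xrightarrow{\pi_T}\Delta(T)\to0$$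 is exact; consequently it is a projective resolution of $\Delta(T)$.
   Context: A subset $S\subseteq P$ is connected if any $x,y\in S$ are joined by a sequence $x=x_0,\dots,x_r=y$ in $S$ with $x_{i-1},x_i$ comparable for all $i$; convex if $x,y\in S$ and $x\le z\le y$ imply $z\in S$; an interval if it is nonempty, connected and convex. $\mathrm{Int}(P)$ is the set of intervals of $P$; $\pi_0(X)$ is the set of connected components of $X\subseteq P$, with $\pi_0(\varnothing)=\varnothing$. Representations of $P$ are functors from $P$ to finite-dimensional $k$-vector spaces, with morphism spaces $\mathrm{Hom}_P$. For $S\in\mathrm{Int}(P)$, $\mathbb I_S$ is the representation with $\mathbb I_S(x)=k$ for $x\in S$ and $0$ otherwise, and $\mathbb I_S(x\le y)=\mathrm{id}$ if $x,y\in S$ and $0$ otherwise. Put $G_P=\bigoplus_{S\in\mathrm{Int}(P)}\mathbb I_S$ and $\Lambda_P=\mathrm{End}_P(G_P)^{\mathrm{op}}$; $e_S\in\Lambda_P$ is the idempotent of the summand $\mathbb I_S$, so $e_R\Lambda_Pe_S=\mathrm{Hom}_P(\mathbb I_R,\mathbb I_S)$. All modules are finitely generated left modules. $\mathsf P(S)=\Lambda_Pe_S=\bigoplus_R\mathrm{Hom}_P(\mathbb I_R,\mathbb I_S)$ and $\mathsf L(S)=\mathsf P(S)/\operatorname{rad}\mathsf P(S)$. A morphism $f\colon\mathbb I_R\to\mathbb I_S$ induces $f_*\colon\mathsf P(R)\to\mathsf P(S)$, $g\mapsto f\circ g$. For $S\in\mathrm{Int}(P)$, a subset $C\subseteq S$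 is a relative upset in $S$ if $c\in C$, $x\in S$, $c\le x$ imply $x\in C$. $\mathcal U(S)$ is the set of intervals contained in $S$ that are relative upsets in $S$. For $U\in\mathcal U(S)$, $j_{U,S}\colon\mathbb I_U\to\mathbb I_S$ is the map that is the identity at points of $U$ and zero elsewhere. In the situation of the claim, $C\in\pi_0(U_J)$ is an element of $\mathcal U(C^{J'})$ for $J'\subseteq J$, where $C^{J'}$ is the component of $U_{J'}$ containing $C$, so the maps used are defined. $\Lambda_P$ carries the quasi-hereditary order on $\mathrm{Int}(P)$ given by $R\preceq S$ iff $R=S$ or $|R|>|S|$. The standard module $\Delta(S)$ is the largest quotient of $\mathsf P(S)$ all of whose composition factors are of the form $\mathsf L(R)$ with $R\preceq S$. *)

theory Defs
  imports "HOL-Algebra.Module" "HOL-Algebra.AbelCoset"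
begin

section \<open>Left modules over rings that need not be commutative\<close>

text \<open>
  The locale \<^locale>\<open>module\<close> requires a commutative base ring, so left modules over an arbitrary
  ring are set up here on top of the same record type; the fields \<open>mult\<close> and \<open>one\<close> of that
  record carry no meaning for a module.  The locale \<^locale>\<open>submodule\<close> does not assume
  commutativity and is used as it is.
\<close>

locale left_module = R?: ring R + M?: abelian_group M
  for R :: "('a, 'r) ring_scheme" (structure) and M :: "('a, 'b, 'c) module_scheme" (structure) +
  assumes smult_closed [simp, intro]:
      "\<lbrakk>a \<in> carrier R; x \<in> carrier M\<rbrakk> \<Longrightarrow> a \<odot>\<^bsub>M\<^esub> x \<in> carrier M"
    and smult_l_distr:
      "\<lbrakk>a \<in> carrier R; b \<in> carrier R; x \<in> carrier M\<rbrakk>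
        \<Longrightarrow> (a \<oplus> b) \<odot>\<^bsub>M\<^esub> x = a \<odot>\<^bsub>M\<^esub> x \<oplus>\<^bsub>M\<^esub> b \<odot>\<^bsub>M\<^esub> x"
    and smult_r_distr:
      "\<lbrakk>a \<in> carrier R; x \<in> carrier M; y \<in> carrier M\<rbrakk>
        \<Longrightarrow> a \<odot>\<^bsub>M\<^esub> (x \<oplus>\<^bsub>M\<^esub> y) = a \<odot>\<^bsub>M\<^esub> x \<oplus>\<^bsub>M\<^esub> a \<odot>\<^bsub>M\<^esub> y"
    and smult_assoc1:
      "\<lbrakk>a \<in> carrier R; b \<in> carrier R; x \<in> carrier M\<rbrakk>
        \<Longrightarrow> (a \<otimes> b) \<odot>\<^bsub>M\<^esub> x = a \<odot>\<^bsub>M\<^esub> (b \<odot>\<^bsub>M\<^esub> x)"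
    and smult_one [simp]: "x \<in> carrier M \<Longrightarrow> \<one> \<odot>\<^bsub>M\<^esub> x = x"

definition lm_hom ::
  "('a, 'r) ring_scheme \<Rightarrow> ('a, 'b) module \<Rightarrow> ('a, 'c) module \<Rightarrow> ('b \<Rightarrow> 'c) set" where
  "lm_hom R M N = {f \<in> carrier M \<rightarrow> carrier N.
     (\<forall>x\<in>carrier M. \<forall>y\<in>carrier M. f (x \<oplus>\<^bsub>M\<^esub> y) = f x \<oplus>\<^bsub>N\<^esub> f y) \<and>
     (\<forall>a\<in>carrier R. \<forall>x\<in>carrier M. f (a \<odot>\<^bsub>M\<^esub> x) = a \<odot>\<^bsub>N\<^esub> f x)}"

definition lm_iso ::
  "('a, 'r) ring_scheme \<Rightarrow> ('a, 'b) module \<Rightarrow> ('a, 'c) module \<Rightarrow> ('b \<Rightarrow> 'c) set" where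
  "lm_iso R M N = {f \<in> lm_hom R M N. bij_betw f (carrier M) (carrier N)}"

definition lm_isomorphic ::
  "('a, 'r) ring_scheme \<Rightarrow> ('a, 'b) module \<Rightarrow> ('a, 'c) module \<Rightarrow> bool" where
  "lm_isomorphic R M N \<longleftrightarrow> lm_iso R M N \<noteq> {}"

definition lm_fin_gen :: "('a, 'r) ring_scheme \<Rightarrow> ('a, 'b) module \<Rightarrow> bool" where
  "lm_fin_gen R M \<longleftrightarrow>
     (\<exists>A. finite A \<and> A \<subseteq> carrier M \<and> (\<forall>N. submodule N R M \<and> A \<subseteq> N \<longrightarrow> N = carrier M))"

definition regular_lm :: "('a, 'r) ring_scheme \<Rightarrow> ('a, 'a) module" where
  "regular_lm R = \<lparr>carrier = carrier R, mult = mult R, one = one R,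
     zero = zero R, add = add R, smult = mult R\<rparr>"

definition lm_restrict :: "('a, 'b) module \<Rightarrow> 'b set \<Rightarrow> ('a, 'b) module" where
  "lm_restrict M N = M\<lparr>carrier := N\<rparr>"

definition lm_quot :: "('a, 'b) module \<Rightarrow> 'b set \<Rightarrow> ('a, 'b set) module" where
  "lm_quot M N = \<lparr>carrier = a_rcosets\<^bsub>M\<^esub> N, mult = undefined, one = undefined,
     zero = N, add = set_add M,
     smult = (\<lambda>a X. \<Union>x\<in>X. N +>\<^bsub>M\<^esub> (a \<odot>\<^bsub>M\<^esub> x))\<rparr>"

definition lm_quot_proj :: "('a, 'b) module \<Rightarrow> 'b set \<Rightarrow> 'b \<Rightarrow> 'b set" where
  "lm_quot_proj M N x = N +>\<^bsub>M\<^esub> x"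

text \<open>
  Only finite index sets occur below; for an infinite one this would be the direct product.
\<close>

definition lm_dsum :: "'i set \<Rightarrow> ('i \<Rightarrow> ('a, 'b) module) \<Rightarrow> ('a, 'i \<Rightarrow> 'b) module" where
  "lm_dsum I M = \<lparr>carrier = (\<Pi>\<^sub>E i\<in>I. carrier (M i)), mult = undefined, one = undefined,
     zero = (\<lambda>i\<in>I. \<zero>\<^bsub>M i\<^esub>), add = (\<lambda>v w. \<lambda>i\<in>I. v i \<oplus>\<^bsub>M i\<^esub> w i),
     smult = (\<lambda>a v. \<lambda>i\<in>I. a \<odot>\<^bsub>M i\<^esub> v i)\<rparr>"

definition lm_incl :: "'i set \<Rightarrow> ('i \<Rightarrow> ('a, 'b) module) \<Rightarrow> 'i \<Rightarrow> 'b \<Rightarrow> 'i \<Rightarrow> 'b" where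
  "lm_incl I M j v = (\<lambda>i\<in>I. if i = j then v else \<zero>\<^bsub>M i\<^esub>)"

definition simple_lm :: "('a, 'r) ring_scheme \<Rightarrow> ('a, 'b) module \<Rightarrow> bool" where
  "simple_lm R M \<longleftrightarrow> left_module R M \<and> carrier M \<noteq> {\<zero>\<^bsub>M\<^esub>} \<and>
     (\<forall>N. submodule N R M \<longrightarrow> N = {\<zero>\<^bsub>M\<^esub>} \<or> N = carrier M)"

definition maximal_submodule :: "('a, 'r) ring_scheme \<Rightarrow> ('a, 'b) module \<Rightarrow> 'b set \<Rightarrow> bool" where
  "maximal_submodule R M N \<longleftrightarrow> submodule N R M \<and> N \<noteq> carrier M \<and>
     (\<forall>N'. submodule N' R M \<and> N \<subseteq> N' \<longrightarrow> N' = N \<or> N' = carrier M)"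

definition lm_rad :: "('a, 'r) ring_scheme \<Rightarrow> ('a, 'b) module \<Rightarrow> 'b set" where
  "lm_rad R M = carrier M \<inter> \<Inter>{N. maximal_submodule R M N}"

definition composition_series ::
  "('a, 'r) ring_scheme \<Rightarrow> ('a, 'b) module \<Rightarrow> 'b set list \<Rightarrow> bool" where
  "composition_series R M Ns \<longleftrightarrow> Ns \<noteq> [] \<and> hd Ns = {\<zero>\<^bsub>M\<^esub>} \<and> last Ns = carrier M \<and>
     (\<forall>N\<in>set Ns. submodule N R M) \<and>
     (\<forall>i. Suc i < length Ns \<longrightarrow> Ns ! i \<subseteq> Ns ! Suc i \<and>
        simple_lm R (lm_quot (lm_restrict M (Ns ! Suc i)) (Ns ! i)))"

definition composition_factors ::
  "('a, 'r) ring_scheme \<Rightarrow> ('a, 'b) module \<Rightarrow> ('a, 'b set) module set" where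
  "composition_factors R M = {lm_quot (lm_restrict M (Ns ! Suc i)) (Ns ! i) | Ns i.
     composition_series R M Ns \<and> Suc i < length Ns}"

text \<open>
  The lifting property against all epimorphisms \<open>X \<rightarrow> Y\<close>.  The carrier types of \<open>X\<close> and \<open>Y\<close> are
  parameters; a theorem in which they are free type variables covers all of them.
\<close>

definition projective_lm ::
  "'x itself \<Rightarrow> 'y itself \<Rightarrow> ('a, 'r) ring_scheme \<Rightarrow> ('a, 'b) module \<Rightarrow> bool" where
  "projective_lm _ _ R M \<longleftrightarrow> left_module R M \<and>
     (\<forall>(X :: ('a, 'x) module) (Y :: ('a, 'y) module) g f.
        left_module R X \<and> left_module R Y \<and> g \<in> lm_hom R X Y \<and> g ` carrier X = carrier Y \<and>
        f \<in> lm_hom R M Y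
        \<longrightarrow> (\<exists>h\<in>lm_hom R M X. \<forall>x\<in>carrier M. g (h x) = f x))"

text \<open>
  Exactness of \<open>\<dots> \<rightarrow> Q 2 \<rightarrow> Q 1 \<rightarrow> Q 0 \<rightarrow> M \<rightarrow> 0\<close>, where \<open>d q\<close> is the map \<open>Q q \<rightarrow> Q (q - 1)\<close> for
  \<open>q \<ge> 1\<close> (the value \<open>d 0\<close> plays no role) and \<open>p\<close> is the map \<open>Q 0 \<rightarrow> M\<close>.
\<close>

definition exact_augmented ::
  "('a, 'r) ring_scheme \<Rightarrow> (nat \<Rightarrow> ('a, 'b) module) \<Rightarrow> (nat \<Rightarrow> 'b \<Rightarrow> 'b) \<Rightarrow> ('b \<Rightarrow> 'c)
    \<Rightarrow> ('a, 'c) module \<Rightarrow> bool" where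
  "exact_augmented R Q d p M \<longleftrightarrow>
     (\<forall>q. left_module R (Q q)) \<and> left_module R M \<and>
     (\<forall>q. d (Suc q) \<in> lm_hom R (Q (Suc q)) (Q q)) \<and> p \<in> lm_hom R (Q 0) M \<and>
     p ` carrier (Q 0) = carrier M \<and>
     d 1 ` carrier (Q 1) = a_kernel (Q 0) M p \<and>
     (\<forall>q. d (Suc (Suc q)) ` carrier (Q (Suc (Suc q))) =
        a_kernel (Q (Suc q)) (Q q) (d (Suc q)))"

definition projective_resolution ::
  "'x itself \<Rightarrow> 'y itself \<Rightarrow> ('a, 'r) ring_scheme \<Rightarrow> (nat \<Rightarrow> ('a, 'b) module)
    \<Rightarrow> (nat \<Rightarrow> 'b \<Rightarrow> 'b) \<Rightarrow> ('b \<Rightarrow> 'c) \<Rightarrow> ('a, 'c) module \<Rightarrow> bool" where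
  "projective_resolution tx ty R Q d p M \<longleftrightarrow>
     exact_augmented R Q d p M \<and> lm_fin_gen R M \<and>
     (\<forall>q. lm_fin_gen R (Q q) \<and> projective_lm tx ty R (Q q))"


section \<open>Intervals of a poset\<close>

definition comparability :: "'p::order set \<Rightarrow> ('p \<times> 'p) set" where
  "comparability S = {(x, y). x \<in> S \<and> y \<in> S \<and> (x \<le> y \<or> y \<le> x)}"

definition poset_connected :: "'p::order set \<Rightarrow> bool" where
  "poset_connected S \<longleftrightarrow> (\<forall>x\<in>S. \<forall>y\<in>S. (x, y) \<in> (comparability S)\<^sup>*)"

definition poset_convex :: "'p::order set \<Rightarrow> bool" where
  "poset_convex S \<longleftrightarrow> (\<forall>x\<in>S. \<forall>y\<in>S. \<forall>z. x \<le> z \<and> z \<le> y \<longrightarrow> z \<in> S)"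

definition poset_intervals :: "'p::order set set" where
  "poset_intervals = {S. S \<noteq> {} \<and> poset_connected S \<and> poset_convex S}"

definition pi0 :: "'p::order set \<Rightarrow> 'p set set" where
  "pi0 X = X // {(x, y). x \<in> X \<and> y \<in> X \<and> (x, y) \<in> (comparability X)\<^sup>*}"

definition component_containing :: "'p::order set \<Rightarrow> 'p set \<Rightarrow> 'p set" where
  "component_containing X C = (THE D. D \<in> pi0 X \<and> C \<subseteq> D)"

definition relative_upset :: "'p::order set \<Rightarrow> 'p set \<Rightarrow> bool" where
  "relative_upset C S \<longleftrightarrow> C \<subseteq> S \<and> (\<forall>c\<in>C. \<forall>x\<in>S. c \<le> x \<longrightarrow> x \<in> C)"

definition upset_intervals :: "'p::order set \<Rightarrow> 'p set set" where
  "upset_intervals S = {U \<in> poset_intervals. relative_upset U S}"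

definition maximal_upset_intervals :: "'p::order set \<Rightarrow> 'p set set" where
  "maximal_upset_intervals T =
     {U \<in> upset_intervals T - {T}. \<forall>V\<in>upset_intervals T - {T}. U \<subseteq> V \<longrightarrow> V = U}"

definition interval_le :: "'p set \<Rightarrow> 'p set \<Rightarrow> bool" where
  "interval_le R S \<longleftrightarrow> R = S \<or> card R > card S"


section \<open>Representations of a poset\<close>

text \<open>
  A representation consists of vector spaces \<open>rep_space V x\<close> and maps \<open>rep_map V x y\<close>, of which
  only those with \<open>x \<le> y\<close> matter.
\<close>

record ('p, 'k, 'v) rep =
  rep_space :: "'p \<Rightarrow> ('k, 'v) module"
  rep_map :: "'p \<Rightarrow> 'p \<Rightarrow> 'v \<Rightarrow> 'v"

definition representation :: "('k, 'r) ring_scheme \<Rightarrow> ('p::order, 'k, 'v) rep \<Rightarrow> bool" where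
  "representation K V \<longleftrightarrow>
     (\<forall>x. left_module K (rep_space V x) \<and> lm_fin_gen K (rep_space V x)) \<and>
     (\<forall>x y. x \<le> y \<longrightarrow> rep_map V x y \<in> lm_hom K (rep_space V x) (rep_space V y)) \<and>
     (\<forall>x. \<forall>v\<in>carrier (rep_space V x). rep_map V x x v = v) \<and>
     (\<forall>x y z. x \<le> y \<and> y \<le> z \<longrightarrow>
        (\<forall>v\<in>carrier (rep_space V x). rep_map V y z (rep_map V x y v) = rep_map V x z v))"

text \<open>
  Components of morphisms are taken to be \<^const>\<open>undefined\<close> outside the carrier, so that equality of
  functions is equality of morphisms.
\<close>

definition rep_hom ::
  "('k, 'r) ring_scheme \<Rightarrow> ('p::order, 'k, 'v) rep \<Rightarrow> ('p, 'k, 'w) rep \<Rightarrow> ('p \<Rightarrow> 'v \<Rightarrow> 'w) set" where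
  "rep_hom K V W =
     {f. (\<forall>x. f x \<in> lm_hom K (rep_space V x) (rep_space W x) \<inter> extensional (carrier (rep_space V x))) \<and>
         (\<forall>x y. x \<le> y \<longrightarrow>
            (\<forall>v\<in>carrier (rep_space V x). f y (rep_map V x y v) = rep_map W x y (f x v)))}"

definition rep_comp ::
  "('p, 'k, 'u) rep \<Rightarrow> ('p \<Rightarrow> 'v \<Rightarrow> 'w) \<Rightarrow> ('p \<Rightarrow> 'u \<Rightarrow> 'v) \<Rightarrow> 'p \<Rightarrow> 'u \<Rightarrow> 'w" where
  "rep_comp V g f = (\<lambda>x. compose (carrier (rep_space V x)) (g x) (f x))"

definition rep_id :: "('p, 'k, 'v) rep \<Rightarrow> 'p \<Rightarrow> 'v \<Rightarrow> 'v" where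
  "rep_id V = (\<lambda>x. \<lambda>v\<in>carrier (rep_space V x). v)"

definition rep_End ::
  "('k, 'r) ring_scheme \<Rightarrow> ('p::order, 'k, 'v) rep \<Rightarrow> ('p \<Rightarrow> 'v \<Rightarrow> 'v) ring" where
  "rep_End K V = \<lparr>carrier = rep_hom K V V, mult = rep_comp V, one = rep_id V,
     zero = (\<lambda>x. \<lambda>v\<in>carrier (rep_space V x). \<zero>\<^bsub>rep_space V x\<^esub>),
     add = (\<lambda>f g x. \<lambda>v\<in>carrier (rep_space V x). f x v \<oplus>\<^bsub>rep_space V x\<^esub> g x v)\<rparr>"

definition rep_dsum :: "'i set \<Rightarrow> ('i \<Rightarrow> ('p, 'k, 'v) rep) \<Rightarrow> ('p, 'k, 'i \<Rightarrow> 'v) rep" where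
  "rep_dsum I V = \<lparr>rep_space = (\<lambda>x. lm_dsum I (\<lambda>i. rep_space (V i) x)),
     rep_map = (\<lambda>x y v. \<lambda>i\<in>I. rep_map (V i) x y (v i))\<rparr>"

definition rep_incl ::
  "'i set \<Rightarrow> ('i \<Rightarrow> ('p, 'k, 'v) rep) \<Rightarrow> 'i \<Rightarrow> 'p \<Rightarrow> 'v \<Rightarrow> 'i \<Rightarrow> 'v" where
  "rep_incl I V j =
     (\<lambda>x. \<lambda>v\<in>carrier (rep_space (V j) x). lm_incl I (\<lambda>i. rep_space (V i) x) j v)"

definition rep_proj ::
  "'i set \<Rightarrow> ('i \<Rightarrow> ('p, 'k, 'v) rep) \<Rightarrow> 'i \<Rightarrow> 'p \<Rightarrow> ('i \<Rightarrow> 'v) \<Rightarrow> 'v" where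
  "rep_proj I V j = (\<lambda>x. \<lambda>v\<in>carrier (rep_space (rep_dsum I V) x). v j)"

definition interval_rep :: "('k, 'r) ring_scheme \<Rightarrow> 'p set \<Rightarrow> ('p, 'k, 'k) rep" where
  "interval_rep K S =
     \<lparr>rep_space = (\<lambda>x. if x \<in> S then regular_lm K else lm_restrict (regular_lm K) {\<zero>\<^bsub>K\<^esub>}),
      rep_map = (\<lambda>x y v. if x \<in> S \<and> y \<in> S then v else \<zero>\<^bsub>K\<^esub>)\<rparr>"

definition interval_incl ::
  "('k, 'r) ring_scheme \<Rightarrow> 'p set \<Rightarrow> 'p set \<Rightarrow> 'p \<Rightarrow> 'k \<Rightarrow> 'k" where
  "interval_incl K U S =
     (\<lambda>x. \<lambda>v\<in>carrier (rep_space (interval_rep K U) x). if x \<in> U then v else \<zero>\<^bsub>K\<^esub>)"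

lemma left_module_regular_lm:
  assumes "ring K" shows "left_module K (regular_lm K)"
proof -
  interpret ring K by fact
  have "abelian_group (regular_lm K)"
    by (rule abelian_groupI)
       (auto simp: regular_lm_def a_ac intro: add.l_inv_ex)
  then show ?thesis
    by (intro left_module.intro left_module_axioms.intro)
       (use assms in \<open>auto simp: regular_lm_def l_distr r_distr m_assoc\<close>)
qed

lemma left_module_zero_lm:
  assumes "ring K" shows "left_module K (lm_restrict (regular_lm K) {\<zero>\<^bsub>K\<^esub>})"
proof -
  interpret ring K by fact
  have "abelian_group (lm_restrict (regular_lm K) {\<zero>\<^bsub>K\<^esub>})"
    by (rule abelian_groupI) (auto simp: lm_restrict_def regular_lm_def)
  then show ?thesis
    by (intro left_module.intro left_module_axioms.intro)
       (use assms in \<open>auto simp: lm_restrict_def regular_lm_def\<close>)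
qed

lemma representation_interval_rep:
  assumes "field K" and "S \<in> poset_intervals"
  shows "representation K (interval_rep K S)"
proof -
  interpret field K by fact
  have "lm_fin_gen K (regular_lm K)"
    unfolding lm_fin_gen_def
  proof (intro exI[of _ "{\<one>\<^bsub>K\<^esub>}"] conjI allI impI)
    fix N assume N: "submodule N K (regular_lm K) \<and> {\<one>\<^bsub>K\<^esub>} \<subseteq> N"
    then interpret submodule N K "regular_lm K" by simp
    have "a \<in> N" if "a \<in> carrier K" for a
      using smult_closed[OF that, of "\<one>\<^bsub>K\<^esub>"] N that by (simp add: regular_lm_def)
    moreover have "N \<subseteq> carrier (regular_lm K)" using subset by simp
    ultimately show "N = carrier (regular_lm K)" by (auto simp: regular_lm_def)
  qed (auto simp: regular_lm_def)
  moreover have "lm_fin_gen K (lm_restrict (regular_lm K) {\<zero>\<^bsub>K\<^esub>})"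
    unfolding lm_fin_gen_def
  proof (intro exI[of _ "{}"] conjI allI impI)
    fix N assume N: "submodule N K (lm_restrict (regular_lm K) {\<zero>\<^bsub>K\<^esub>}) \<and> {} \<subseteq> N"
    then interpret submodule N K "lm_restrict (regular_lm K) {\<zero>\<^bsub>K\<^esub>}" by simp
    show "N = carrier (lm_restrict (regular_lm K) {\<zero>\<^bsub>K\<^esub>})"
      using subset one_closed by (auto simp: lm_restrict_def regular_lm_def)
  qed auto
  ultimately have sp: "left_module K (rep_space (interval_rep K S) x) \<and>
      lm_fin_gen K (rep_space (interval_rep K S) x)" for x
    using left_module_regular_lm[OF ring_axioms] left_module_zero_lm[OF ring_axioms]
    by (simp add: interval_rep_def)
  have hom: "rep_map (interval_rep K S) x y
      \<in> lm_hom K (rep_space (interval_rep K S) x) (rep_space (interval_rep K S) y)" for x y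
    by (cases "x \<in> S"; cases "y \<in> S")
       (simp_all add: interval_rep_def lm_hom_def lm_restrict_def regular_lm_def)
  have comp: "rep_map (interval_rep K S) y z (rep_map (interval_rep K S) x y v) =
      rep_map (interval_rep K S) x z v"
    if "x \<le> y" "y \<le> z" "v \<in> carrier (rep_space (interval_rep K S) x)" for x y z v
  proof -
    have "y \<in> S" if "x \<in> S" "z \<in> S"
      using assms(2) that \<open>x \<le> y\<close> \<open>y \<le> z\<close> unfolding poset_intervals_def poset_convex_def by blast
    then show ?thesis by (cases "x \<in> S"; cases "z \<in> S") (auto simp: interval_rep_def)
  qed
  have "rep_map (interval_rep K S) x x v = v"
    if "v \<in> carrier (rep_space (interval_rep K S) x)" for x v
    using that by (cases "x \<in> S") (auto simp: interval_rep_def lm_restrict_def)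
  then show ?thesis
    unfolding representation_def using sp hom comp by (intro conjI allI impI ballI) simp_all
qed

lemma interval_incl_hom:
  assumes "field K" and "U \<in> upset_intervals S"
  shows "interval_incl K U S \<in> rep_hom K (interval_rep K U) (interval_rep K S)"
proof -
  interpret field K by fact
  have up: "U \<subseteq> S" "\<And>x y. \<lbrakk>x \<in> U; y \<in> S; x \<le> y\<rbrakk> \<Longrightarrow> y \<in> U"
    using assms(2) unfolding upset_intervals_def relative_upset_def by blast+
  have "interval_incl K U S x \<in> lm_hom K (rep_space (interval_rep K U) x)
      (rep_space (interval_rep K S) x) \<inter> extensional (carrier (rep_space (interval_rep K U) x))"
    for x
    using up(1) by (cases "x \<in> U"; cases "x \<in> S")
      (auto simp add: interval_incl_def interval_rep_def lm_hom_def lm_restrict_def regular_lm_def)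
  moreover have "interval_incl K U S y (rep_map (interval_rep K U) x y v) =
      rep_map (interval_rep K S) x y (interval_incl K U S x v)"
    if "x \<le> y" "v \<in> carrier (rep_space (interval_rep K U) x)" for x y v
    using that up(1) up(2)[of x y]
    by (cases "x \<in> U"; cases "y \<in> U"; cases "x \<in> S"; cases "y \<in> S")
       (auto simp add: interval_incl_def interval_rep_def lm_restrict_def regular_lm_def)
  ultimately show ?thesis unfolding rep_hom_def by blast
qed


section \<open>The endomorphism algebra of the interval representations\<close>

type_synonym ('p, 'k) alg_elem = "'p \<Rightarrow> ('p set \<Rightarrow> 'k) \<Rightarrow> ('p set \<Rightarrow> 'k)"

definition gen_rep :: "('k, 'r) ring_scheme \<Rightarrow> ('p::order, 'k, 'p set \<Rightarrow> 'k) rep" where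
  "gen_rep K = rep_dsum poset_intervals (interval_rep K)"

definition opposite_ring :: "'a ring \<Rightarrow> 'a ring" where
  "opposite_ring R = R\<lparr>mult := (\<lambda>a b. b \<otimes>\<^bsub>R\<^esub> a)\<rparr>"

definition interval_alg :: "('k, 'r) ring_scheme \<Rightarrow> ('p::order, 'k) alg_elem ring" where
  "interval_alg K = opposite_ring (rep_End K (gen_rep K))"

text \<open>
  A morphism \<open>f\<close> between the interval representations of \<open>R\<close> and \<open>S\<close>, regarded as an endomorphism of
  \<^const>\<open>gen_rep\<close>.
\<close>

definition alg_elem_of ::
  "('k, 'r) ring_scheme \<Rightarrow> 'p::order set \<Rightarrow> 'p set \<Rightarrow> ('p \<Rightarrow> 'k \<Rightarrow> 'k) \<Rightarrow> ('p, 'k) alg_elem" where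
  "alg_elem_of K R S f =
     rep_comp (gen_rep K) (rep_incl poset_intervals (interval_rep K) S)
       (rep_comp (gen_rep K) f (rep_proj poset_intervals (interval_rep K) R))"

definition alg_idem :: "('k, 'r) ring_scheme \<Rightarrow> 'p::order set \<Rightarrow> ('p, 'k) alg_elem" where
  "alg_idem K S = alg_elem_of K S S (rep_id (interval_rep K S))"

definition proj_mod ::
  "('k, 'r) ring_scheme \<Rightarrow> 'p::order set \<Rightarrow> (('p, 'k) alg_elem, ('p, 'k) alg_elem) module" where
  "proj_mod K S = lm_restrict (regular_lm (interval_alg K))
     {a \<otimes>\<^bsub>interval_alg K\<^esub> alg_idem K S | a. a \<in> carrier (interval_alg K)}"

text \<open>
  An element of \<^term>\<open>proj_mod K R\<close> is an endomorphism \<open>g\<close> of \<^const>\<open>gen_rep\<close> with image in the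
  summand of \<open>R\<close>; the induced map is post-composition with \<open>f\<close>.
\<close>

definition proj_push ::
  "('k, 'r) ring_scheme \<Rightarrow> 'p::order set \<Rightarrow> 'p set \<Rightarrow> ('p \<Rightarrow> 'k \<Rightarrow> 'k)
    \<Rightarrow> ('p, 'k) alg_elem \<Rightarrow> ('p, 'k) alg_elem" where
  "proj_push K R S f g = rep_comp (gen_rep K) (alg_elem_of K R S f) g"

definition simple_mod ::
  "('k, 'r) ring_scheme \<Rightarrow> 'p::order set \<Rightarrow> (('p, 'k) alg_elem, ('p, 'k) alg_elem set) module" where
  "simple_mod K S = lm_quot (proj_mod K S) (lm_rad (interval_alg K) (proj_mod K S))"

text \<open>
  The largest quotient of \<^term>\<open>proj_mod K S\<close> with a given property is the quotient by the least
  submodule \<open>N\<close> for which the quotient by \<open>N\<close> has the property.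
\<close>

definition standard_kernel :: "('k, 'r) ring_scheme \<Rightarrow> 'p::order set \<Rightarrow> ('p, 'k) alg_elem set" where
  "standard_kernel K S = (LEAST N. submodule N (interval_alg K) (proj_mod K S) \<and>
     (\<forall>X\<in>composition_factors (interval_alg K) (lm_quot (proj_mod K S) N).
        \<exists>R\<in>poset_intervals. interval_le R S \<and>
          lm_isomorphic (interval_alg K) X (simple_mod K R)))"

definition standard_mod ::
  "('k, 'r) ring_scheme \<Rightarrow> 'p::order set \<Rightarrow> (('p, 'k) alg_elem, ('p, 'k) alg_elem set) module" where
  "standard_mod K S = lm_quot (proj_mod K S) (standard_kernel K S)"

definition standard_proj ::
  "('k, 'r) ring_scheme \<Rightarrow> 'p::order set \<Rightarrow> ('p, 'k) alg_elem \<Rightarrow> ('p, 'k) alg_elem set" where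
  "standard_proj K S = lm_quot_proj (proj_mod K S) (standard_kernel K S)"


section \<open>The complex\<close>

definition upset_inter :: "'p set \<Rightarrow> (nat \<Rightarrow> 'p set) \<Rightarrow> nat set \<Rightarrow> 'p set" where
  "upset_inter T U J = (if J = {} then T else (\<Inter>j\<in>J. U j))"

definition res_index ::
  "'p::order set \<Rightarrow> (nat \<Rightarrow> 'p set) \<Rightarrow> nat \<Rightarrow> nat \<Rightarrow> (nat set \<times> 'p set) set" where
  "res_index T U m q = {(J, C). J \<subseteq> {1..m} \<and> card J = q \<and> C \<in> pi0 (upset_inter T U J)}"

definition res_mod ::
  "('k, 'r) ring_scheme \<Rightarrow> 'p::order set \<Rightarrow> (nat \<Rightarrow> 'p set) \<Rightarrow> nat \<Rightarrow> nat
    \<Rightarrow> (('p, 'k) alg_elem, nat set \<times> 'p set \<Rightarrow> ('p, 'k) alg_elem) module" where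
  "res_mod K T U m q = lm_dsum (res_index T U m q) (\<lambda>(J, C). proj_mod K C)"

definition res_incl ::
  "('k, 'r) ring_scheme \<Rightarrow> 'p::order set \<Rightarrow> (nat \<Rightarrow> 'p set) \<Rightarrow> nat \<Rightarrow> nat \<Rightarrow> nat set \<times> 'p set
    \<Rightarrow> ('p, 'k) alg_elem \<Rightarrow> nat set \<times> 'p set \<Rightarrow> ('p, 'k) alg_elem" where
  "res_incl K T U m q = lm_incl (res_index T U m q) (\<lambda>(J, C). proj_mod K C)"

text \<open>
  \<open>sorted_list_of_set J ! r\<close> is the element \<open>j\<^sub>r\<close> of \<open>J = {j\<^sub>0 < \<dots> < j\<^bsub>q-1\<^esub>}\<close>.
\<close>

definition face :: "nat set \<Rightarrow> nat \<Rightarrow> nat set" where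
  "face J r = J - {sorted_list_of_set J ! r}"

definition face_comp ::
  "'p::order set \<Rightarrow> (nat \<Rightarrow> 'p set) \<Rightarrow> nat set \<Rightarrow> 'p set \<Rightarrow> nat \<Rightarrow> 'p set" where
  "face_comp T U J C r = component_containing (upset_inter T U (face J r)) C"

text \<open>
  The restriction of the differential to the summand with index \<open>(J, C)\<close>, and the homomorphism
  assembled from these restrictions.  Only \<open>q \<ge> 1\<close> is meaningful.
\<close>

definition res_diff_summand ::
  "('k, 'r) ring_scheme \<Rightarrow> 'p::order set \<Rightarrow> (nat \<Rightarrow> 'p set) \<Rightarrow> nat \<Rightarrow> nat \<Rightarrow> nat set \<times> 'p set
    \<Rightarrow> ('p, 'k) alg_elem \<Rightarrow> nat set \<times> 'p set \<Rightarrow> ('p, 'k) alg_elem" where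
  "res_diff_summand K T U m q = (\<lambda>(J, C) y. let Q = res_mod K T U m (q - 1) in
     \<Oplus>\<^bsub>Q\<^esub>r\<in>{..<q}. let D = face_comp T U J C r in
       [((-1) ^ r :: int)] \<cdot>\<^bsub>Q\<^esub>
         res_incl K T U m (q - 1) (face J r, D) (proj_push K C D (interval_incl K C D) y))"

definition res_diff ::
  "('k, 'r) ring_scheme \<Rightarrow> 'p::order set \<Rightarrow> (nat \<Rightarrow> 'p set) \<Rightarrow> nat \<Rightarrow> nat
    \<Rightarrow> (nat set \<times> 'p set \<Rightarrow> ('p, 'k) alg_elem) \<Rightarrow> nat set \<times> 'p set \<Rightarrow> ('p, 'k) alg_elem" where
  "res_diff K T U m q x =
     (\<Oplus>\<^bsub>res_mod K T U m (q - 1)\<^esub>i\<in>res_index T U m q. res_diff_summand K T U m q i (x i))"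

text \<open>
  The degree-zero module of the complex is a direct sum over the single index \<open>({}, T)\<close>;
  the coordinate at this index identifies it with \<^term>\<open>proj_mod K T\<close>.
\<close>

definition res_zero_coord ::
  "'p set \<Rightarrow> (nat set \<times> 'p set \<Rightarrow> ('p, 'k) alg_elem) \<Rightarrow> ('p, 'k) alg_elem" where
  "res_zero_coord T x = x ({}, T)"

end

theory Submission
  imports Defs
begin

text \<open>
  A morphism from the interval representation of \<open>R\<close> to that of \<open>S\<close> is a family of scalars at the
  points of \<open>R \<inter> S\<close> that is constant along comparable points and vanishes on every component that is
  not both a downset of \<open>R\<close> and an upset of \<open>S\<close>.  Fix \<open>R\<close> and a component \<open>D\<close> of \<open>R \<inter> T\<close> that is a
  downset of \<open>R\<close> and an upset of \<open>T\<close>.  A morphism from \<open>R\<close> to a component of the intersection of the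
  \<open>U j\<close>, \<open>j \<in> J\<close>, can be non-zero on \<open>D\<close> only if \<open>J\<close> is contained in \<open>{j. D \<subseteq> U j}\<close>.  So the part of
  the complex belonging to \<open>R\<close> is a direct sum, over the components \<open>D\<close>, of augmented chain complexes
  of simplices with vertex sets \<open>{j. D \<subseteq> U j}\<close>.  These are contractible unless the vertex set is empty,
  which means \<open>D = T\<close>; hence the complex is exact in positive degrees and its homology in degree zero
  consists of the morphisms from those \<open>R\<close> that contain \<open>T\<close> as a downset.

  This is the standard module: such \<open>R\<close> satisfy \<open>R = T\<close> or \<open>|R| > |T|\<close>, so all composition factors
  of the degree-zero homology are of the permitted form, while every morphism that is a boundary
  factors through an interval properly contained in \<open>T\<close>.
\<close>

section \<open>Modules over rings that need not be commutative\<close>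

text \<open>The condition in \<open>standard_kernel\<close> speaks about composition factors, and it
  is vacuous for a module without a composition series. So finite length is proved for every
  quotient of \<open>proj_mod K T\<close>; only then must an admissible submodule contain each
  inclusion of a proper upset interval into \<open>T\<close>. That these inclusions generate
  \<open>standard_sub K T\<close> is itself exactness in degree zero. Hence exactness is proved with
  \<open>standard_sub K T\<close> in place of the kernel, and the kernel is identified afterwards.
  The splitting into simplices is not carried out on modules but on scalars: for fixed
  \<open>R\<close> and \<open>x\<close> the differential is a simplicial boundary. A contraction
  chosen point by point has to give morphisms again, which forces its apex to be constant along each
  component of \<open>R \<inter> T\<close>. The least vertex \<open>Min (verts R x)\<close> has this
  property and also produces no signs.\<close>

lemma (in abelian_monoid) finsum_swap:
  assumes "finite A" "finite B" "\<And>a b. a \<in> A \<Longrightarrow> b \<in> B \<Longrightarrow> f a b \<in> carrier G"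
  shows "(\<Oplus>a\<in>A. \<Oplus>b\<in>B. f a b) = (\<Oplus>b\<in>B. \<Oplus>a\<in>A. f a b)"
  using assms(1,3)
proof (induction A)
  case empty
  then show ?case by (simp add: finsum_zero)
next
  case (insert x F)
  have "(\<Oplus>b\<in>B. \<Oplus>a\<in>insert x F. f a b) = (\<Oplus>b\<in>B. f x b \<oplus> (\<Oplus>a\<in>F. f a b))"
    by (rule finsum_cong') (use insert in \<open>auto simp: Pi_iff\<close>)
  also have "\<dots> = (\<Oplus>b\<in>B. f x b) \<oplus> (\<Oplus>b\<in>B. \<Oplus>a\<in>F. f a b)"
    by (rule finsum_addf) (use insert in \<open>auto simp: Pi_iff intro!: finsum_closed\<close>)
  also have "\<dots> = (\<Oplus>a\<in>insert x F. \<Oplus>b\<in>B. f a b)"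
    using insert by (subst finsum_insert) (auto simp: Pi_iff intro!: finsum_closed)
  finally show ?case by simp
qed

lemma (in abelian_monoid) finsum_delta:
  assumes "finite A" "a \<in> A \<Longrightarrow> f a \<in> carrier G"
  shows "(\<Oplus>x\<in>A. if x = a then f x else \<zero>) = (if a \<in> A then f a else \<zero>)"
proof (cases "a \<in> A")
  case True
  have "(\<Oplus>x\<in>A. if x = a then f x else \<zero>) = (\<Oplus>x\<in>A. if a = x then f a else \<zero>)"
    by (rule finsum_cong') (use assms True in auto)
  also have "\<dots> = f a"
    by (rule add.finprod_singleton[OF True]) (use assms True in auto)
  finally show ?thesis using True by simp
next
  case False
  then show ?thesis by (auto intro!: add.finprod_one_eqI)
qed

lemma finsum_additive:
  assumes "abelian_group M" "abelian_group N"
    and "\<And>x. x \<in> carrier M \<Longrightarrow> h x \<in> carrier N"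
    and "\<And>x y. x \<in> carrier M \<Longrightarrow> y \<in> carrier M \<Longrightarrow> h (x \<oplus>\<^bsub>M\<^esub> y) = h x \<oplus>\<^bsub>N\<^esub> h y"
    and "f \<in> A \<rightarrow> carrier M"
  shows "h (finsum M f A) = (\<Oplus>\<^bsub>N\<^esub>x\<in>A. h (f x))"
proof -
  interpret M: abelian_group M by fact
  interpret N: abelian_group N by fact
  \<comment> \<open>That \<open>h\<close> maps zero to zero serves the empty index set and also an
    infinite one, where \<open>finsum\<close> is zero by default.\<close>
  have "h \<zero>\<^bsub>M\<^esub> \<oplus>\<^bsub>N\<^esub> h \<zero>\<^bsub>M\<^esub> = h \<zero>\<^bsub>M\<^esub> \<oplus>\<^bsub>N\<^esub> \<zero>\<^bsub>N\<^esub>"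
    using assms(3)[of "\<zero>\<^bsub>M\<^esub>"] assms(4)[of "\<zero>\<^bsub>M\<^esub>" "\<zero>\<^bsub>M\<^esub>"] by simp
  then have zero: "h \<zero>\<^bsub>M\<^esub> = \<zero>\<^bsub>N\<^esub>"
    using assms(3)[of "\<zero>\<^bsub>M\<^esub>"] by (simp add: N.add.l_cancel_one)
  show ?thesis
    using assms(5)
  proof (induction A rule: infinite_finite_induct)
    case (insert x F)
    then show ?case
      by (auto simp: M.finsum_insert N.finsum_insert assms(3,4) Pi_iff)
  qed (use zero in auto)
qed

text \<open>Every module axiom is an equation that can be checked on preimages. \<open>Y\<close>
  carries no group structure in advance, which suits cosets, whose operations are understood through
  representatives.\<close>

lemma left_module_image:
  assumes "left_module R M" and onto: "g ` carrier M = carrier Y"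
    and add: "\<And>x y. x \<in> carrier M \<Longrightarrow> y \<in> carrier M \<Longrightarrow> g (x \<oplus>\<^bsub>M\<^esub> y) = g x \<oplus>\<^bsub>Y\<^esub> g y"
    and smult: "\<And>a x. a \<in> carrier R \<Longrightarrow> x \<in> carrier M \<Longrightarrow> g (a \<odot>\<^bsub>M\<^esub> x) = a \<odot>\<^bsub>Y\<^esub> g x"
    and zero: "g \<zero>\<^bsub>M\<^esub> = \<zero>\<^bsub>Y\<^esub>"
  shows "left_module R Y"
proof -
  interpret left_module R M by fact
  have pre: "\<exists>x\<in>carrier M. y = g x" if "y \<in> carrier Y" for y using that onto by auto
  have cl: "g x \<in> carrier Y" if "x \<in> carrier M" for x using that onto by auto
  have "abelian_group Y"
  proof (rule abelian_groupI)
    fix x y assume "x \<in> carrier Y" "y \<in> carrier Y"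
    then obtain x' y' where [simp]: "x = g x'" "y = g y'" "x' \<in> carrier M" "y' \<in> carrier M"
      using pre by metis
    show "x \<oplus>\<^bsub>Y\<^esub> y \<in> carrier Y" using cl[of "x' \<oplus>\<^bsub>M\<^esub> y'"] by (simp add: add)
    show "x \<oplus>\<^bsub>Y\<^esub> y = y \<oplus>\<^bsub>Y\<^esub> x" by (simp add: add[symmetric] M.a_comm)
    show "\<zero>\<^bsub>Y\<^esub> \<oplus>\<^bsub>Y\<^esub> x = x" by (simp add: zero[symmetric] add[symmetric])
    show "\<exists>y\<in>carrier Y. y \<oplus>\<^bsub>Y\<^esub> x = \<zero>\<^bsub>Y\<^esub>"
      by (intro bexI[of _ "g (\<ominus>\<^bsub>M\<^esub> x')"] cl)
        (simp_all add: add[symmetric] zero[symmetric] M.l_neg)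
    fix z assume "z \<in> carrier Y"
    then obtain z' where [simp]: "z = g z'" "z' \<in> carrier M" using pre by metis
    show "x \<oplus>\<^bsub>Y\<^esub> y \<oplus>\<^bsub>Y\<^esub> z = x \<oplus>\<^bsub>Y\<^esub> (y \<oplus>\<^bsub>Y\<^esub> z)" by (simp add: add[symmetric] M.a_assoc)
  qed (use zero cl[of "\<zero>\<^bsub>M\<^esub>"] in simp)
  moreover have "left_module_axioms R Y"
  proof (rule left_module_axioms.intro)
    fix a x assume a: "a \<in> carrier R" and "x \<in> carrier Y"
    then obtain x' where [simp]: "x = g x'" "x' \<in> carrier M" using pre by metis
    show "a \<odot>\<^bsub>Y\<^esub> x \<in> carrier Y" using cl[of "a \<odot>\<^bsub>M\<^esub> x'"] a by (simp add: smult)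
    fix b assume b: "b \<in> carrier R"
    show "(a \<oplus>\<^bsub>R\<^esub> b) \<odot>\<^bsub>Y\<^esub> x = a \<odot>\<^bsub>Y\<^esub> x \<oplus>\<^bsub>Y\<^esub> b \<odot>\<^bsub>Y\<^esub> x"
      using a b by (simp add: add[symmetric] smult[symmetric] smult_l_distr)
    show "(a \<otimes>\<^bsub>R\<^esub> b) \<odot>\<^bsub>Y\<^esub> x = a \<odot>\<^bsub>Y\<^esub> (b \<odot>\<^bsub>Y\<^esub> x)"
      using a b by (simp add: smult[symmetric] smult_assoc1)
  next
    fix a x y assume a: "a \<in> carrier R" and "x \<in> carrier Y" "y \<in> carrier Y"
    then obtain x' y' where [simp]: "x = g x'" "y = g y'" "x' \<in> carrier M" "y' \<in> carrier M"
      using pre by metis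
    show "a \<odot>\<^bsub>Y\<^esub> (x \<oplus>\<^bsub>Y\<^esub> y) = a \<odot>\<^bsub>Y\<^esub> x \<oplus>\<^bsub>Y\<^esub> a \<odot>\<^bsub>Y\<^esub> y"
      using a by (simp add: add[symmetric] smult[symmetric] smult_r_distr)
  next
    fix x assume "x \<in> carrier Y"
    then obtain x' where [simp]: "x = g x'" "x' \<in> carrier M" using pre by metis
    show "\<one>\<^bsub>R\<^esub> \<odot>\<^bsub>Y\<^esub> x = x" by (simp add: smult[symmetric])
  qed
  ultimately show ?thesis
    by (intro left_module.intro R.ring_axioms)
qed

section \<open>Arithmetic in a left module and its submodules\<close>

context left_module
begin

lemma smult_l_null [simp]: "x \<in> carrier M \<Longrightarrow> \<zero>\<^bsub>R\<^esub> \<odot>\<^bsub>M\<^esub> x = \<zero>\<^bsub>M\<^esub>"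
  using smult_l_distr[of "\<zero>\<^bsub>R\<^esub>" "\<zero>\<^bsub>R\<^esub>" x] M.add.l_cancel_one' by fastforce

lemma smult_r_null [simp]: "a \<in> carrier R \<Longrightarrow> a \<odot>\<^bsub>M\<^esub> \<zero>\<^bsub>M\<^esub> = \<zero>\<^bsub>M\<^esub>"
  using smult_r_distr[of a "\<zero>\<^bsub>M\<^esub>" "\<zero>\<^bsub>M\<^esub>"] M.add.l_cancel_one' by fastforce

lemma smult_minus_one:
  assumes "x \<in> carrier M" shows "(\<ominus>\<^bsub>R\<^esub> \<one>\<^bsub>R\<^esub>) \<odot>\<^bsub>M\<^esub> x = \<ominus>\<^bsub>M\<^esub> x"
proof -
  have "(\<ominus>\<^bsub>R\<^esub> \<one>\<^bsub>R\<^esub>) \<odot>\<^bsub>M\<^esub> x \<oplus>\<^bsub>M\<^esub> x = \<zero>\<^bsub>M\<^esub>"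
    using smult_l_distr[of "\<ominus>\<^bsub>R\<^esub> \<one>\<^bsub>R\<^esub>" "\<one>\<^bsub>R\<^esub>" x] assms by (simp add: R.l_neg)
  then show ?thesis using assms by (metis M.minus_equality R.a_inv_closed R.one_closed smult_closed)
qed

lemma smult_minus:
  assumes "a \<in> carrier R" "x \<in> carrier M" shows "a \<odot>\<^bsub>M\<^esub> (\<ominus>\<^bsub>M\<^esub> x) = \<ominus>\<^bsub>M\<^esub> (a \<odot>\<^bsub>M\<^esub> x)"
proof -
  have "a \<odot>\<^bsub>M\<^esub> (\<ominus>\<^bsub>M\<^esub> x) \<oplus>\<^bsub>M\<^esub> a \<odot>\<^bsub>M\<^esub> x = \<zero>\<^bsub>M\<^esub>"
    using smult_r_distr[of a "\<ominus>\<^bsub>M\<^esub> x" x] assms by (simp add: M.l_neg)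
  then show ?thesis using assms M.minus_equality[of "a \<odot>\<^bsub>M\<^esub> (\<ominus>\<^bsub>M\<^esub> x)" "a \<odot>\<^bsub>M\<^esub> x"] by simp
qed

text \<open>Closure under negation comes from closure under the scalar -1.\<close>

lemma submoduleI':
  assumes "H \<subseteq> carrier M" "\<zero>\<^bsub>M\<^esub> \<in> H" "\<And>a b. a \<in> H \<Longrightarrow> b \<in> H \<Longrightarrow> a \<oplus>\<^bsub>M\<^esub> b \<in> H"
    "\<And>a x. a \<in> carrier R \<Longrightarrow> x \<in> H \<Longrightarrow> a \<odot>\<^bsub>M\<^esub> x \<in> H"
  shows "submodule H R M"
proof -
  have "\<ominus>\<^bsub>M\<^esub> x \<in> H" if "x \<in> H" for x
    using assms(4)[OF _ that, of "\<ominus>\<^bsub>R\<^esub> \<one>\<^bsub>R\<^esub>"] smult_minus_one that assms(1) by auto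
  then show ?thesis
    using assms unfolding submodule_def submodule_axioms_def subgroup_def by (auto simp: a_inv_def)
qed

lemma submoduleD:
  assumes "submodule H R M"
  shows "H \<subseteq> carrier M" "\<zero>\<^bsub>M\<^esub> \<in> H" "\<And>a b. a \<in> H \<Longrightarrow> b \<in> H \<Longrightarrow> a \<oplus>\<^bsub>M\<^esub> b \<in> H"
    "\<And>a x. a \<in> carrier R \<Longrightarrow> x \<in> H \<Longrightarrow> a \<odot>\<^bsub>M\<^esub> x \<in> H" "\<And>x. x \<in> H \<Longrightarrow> \<ominus>\<^bsub>M\<^esub> x \<in> H"
    "\<And>a b. a \<in> H \<Longrightarrow> b \<in> H \<Longrightarrow> a \<ominus>\<^bsub>M\<^esub> b \<in> H"
  using assms unfolding submodule_def submodule_axioms_def subgroup_def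
  by (auto simp: a_inv_def a_minus_def)

lemma submodule_finsum:
  assumes "submodule H R M" "f \<in> A \<rightarrow> H" shows "finsum M f A \<in> H"
  using assms(2)
proof (induction A rule: infinite_finite_induct)
  case (insert x F)
  moreover have "f \<in> insert x F \<rightarrow> carrier M" using insert(4) submoduleD(1)[OF assms(1)] by auto
  ultimately show ?case using submoduleD(3)[OF assms(1)] by (subst M.finsum_insert) (auto simp: Pi_iff)
qed (use submoduleD(2)[OF assms(1)] in auto)

lemma submodule_zero: "submodule {\<zero>\<^bsub>M\<^esub>} R M"
  by (rule submoduleI') auto

lemma submodule_carrier: "submodule (carrier M) R M"
  by (rule submoduleI') auto

lemma diff_zero [simp]: "x \<in> carrier M \<Longrightarrow> x \<ominus>\<^bsub>M\<^esub> \<zero>\<^bsub>M\<^esub> = x"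
  using M.minus_equality[of "\<zero>\<^bsub>M\<^esub>" "\<zero>\<^bsub>M\<^esub>"] by (simp add: a_minus_def)

lemma diff_zero_iff:
  assumes "x \<in> carrier M" "y \<in> carrier M" shows "x \<ominus>\<^bsub>M\<^esub> y = \<zero>\<^bsub>M\<^esub> \<longleftrightarrow> x = y"

proof
  assume "x \<ominus>\<^bsub>M\<^esub> y = \<zero>\<^bsub>M\<^esub>"
  then have "\<ominus>\<^bsub>M\<^esub> (\<ominus>\<^bsub>M\<^esub> y) = x" using assms by (intro M.minus_equality) (simp_all add: a_minus_def)
  then show "x = y" using assms by simp
qed (use assms in \<open>simp add: a_minus_def M.r_neg\<close>)

end

section \<open>Homomorphisms, images, preimages and restrictions\<close>

lemma lm_homD:
  assumes "f \<in> lm_hom R M N"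
  shows "\<And>x. x \<in> carrier M \<Longrightarrow> f x \<in> carrier N"
    "\<And>x y. x \<in> carrier M \<Longrightarrow> y \<in> carrier M \<Longrightarrow> f (x \<oplus>\<^bsub>M\<^esub> y) = f x \<oplus>\<^bsub>N\<^esub> f y"
    "\<And>a x. a \<in> carrier R \<Longrightarrow> x \<in> carrier M \<Longrightarrow> f (a \<odot>\<^bsub>M\<^esub> x) = a \<odot>\<^bsub>N\<^esub> f x"
  using assms unfolding lm_hom_def by auto

lemma lm_homI:
  assumes "\<And>x. x \<in> carrier M \<Longrightarrow> f x \<in> carrier N"
    "\<And>x y. x \<in> carrier M \<Longrightarrow> y \<in> carrier M \<Longrightarrow> f (x \<oplus>\<^bsub>M\<^esub> y) = f x \<oplus>\<^bsub>N\<^esub> f y"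
    "\<And>a x. a \<in> carrier R \<Longrightarrow> x \<in> carrier M \<Longrightarrow> f (a \<odot>\<^bsub>M\<^esub> x) = a \<odot>\<^bsub>N\<^esub> f x"
  shows "f \<in> lm_hom R M N"
  using assms unfolding lm_hom_def by auto

lemma lm_hom_zero:
  assumes "left_module R M" "left_module R N" "f \<in> lm_hom R M N"
  shows "f \<zero>\<^bsub>M\<^esub> = \<zero>\<^bsub>N\<^esub>"
proof -
  interpret M: left_module R M by fact
  interpret N: left_module R N by fact
  have "f (\<zero>\<^bsub>R\<^esub> \<odot>\<^bsub>M\<^esub> \<zero>\<^bsub>M\<^esub>) = \<zero>\<^bsub>R\<^esub> \<odot>\<^bsub>N\<^esub> f \<zero>\<^bsub>M\<^esub>" using lm_homD[OF assms(3)] by blast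
  then show ?thesis using lm_homD(1)[OF assms(3), of "\<zero>\<^bsub>M\<^esub>"] by simp
qed

lemma lm_hom_minus:
  assumes "left_module R M" "left_module R N" "f \<in> lm_hom R M N" "x \<in> carrier M" "y \<in> carrier M"
  shows "f (x \<ominus>\<^bsub>M\<^esub> y) = f x \<ominus>\<^bsub>N\<^esub> f y"
proof -
  interpret M: left_module R M by fact
  interpret N: left_module R N by fact
  have "f (\<ominus>\<^bsub>M\<^esub> y) = \<ominus>\<^bsub>N\<^esub> f y"
    using lm_homD[OF assms(3)] assms(5)
    by (metis M.smult_minus_one N.smult_minus_one M.R.a_inv_closed M.R.one_closed)
  then show ?thesis using lm_homD[OF assms(3)] assms(4,5) by (simp add: a_minus_def)
qed

lemma lm_hom_finsum:
  assumes "left_module R M" "left_module R N" "h \<in> lm_hom R M N" "f \<in> A \<rightarrow> carrier M"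
  shows "h (finsum M f A) = (\<Oplus>\<^bsub>N\<^esub>x\<in>A. h (f x))"
proof -
  interpret M: left_module R M by fact
  interpret N: left_module R N by fact
  show ?thesis
    by (rule finsum_additive[OF M.M.abelian_group_axioms N.M.abelian_group_axioms _ _ assms(4)])
      (use lm_homD[OF assms(3)] in auto)
qed

lemma lm_hom_compose:
  assumes "f \<in> lm_hom R M N" "g \<in> lm_hom R N L" shows "g \<circ> f \<in> lm_hom R M L"
  by (rule lm_homI) (use lm_homD[OF assms(1)] lm_homD[OF assms(2)] in auto)

lemma lm_hom_vimage_submodule:
  assumes "left_module R M" "left_module R N" "f \<in> lm_hom R M N" "submodule H R N"
  shows "submodule {x \<in> carrier M. f x \<in> H} R M"
proof -
  interpret M: left_module R M by fact
  interpret N: left_module R N by fact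
  show ?thesis
    by (rule M.submoduleI')
      (use N.submoduleD[OF assms(4)] lm_homD[OF assms(3)] lm_hom_zero[OF assms(1-3)] in auto)
qed

lemma lm_hom_image_submodule:
  assumes "left_module R M" "left_module R N" "f \<in> lm_hom R M N" "submodule H R M"
  shows "submodule (f ` H) R N"
proof -
  interpret M: left_module R M by fact
  interpret N: left_module R N by fact
  note H = M.submoduleD[OF assms(4)] and f = lm_homD[OF assms(3)]
  show ?thesis
  proof (rule N.submoduleI')
    show "f ` H \<subseteq> carrier N" using H f by auto
    show "\<zero>\<^bsub>N\<^esub> \<in> f ` H" using H(2) lm_hom_zero[OF assms(1-3)] by force
    show "a \<oplus>\<^bsub>N\<^esub> b \<in> f ` H" if ab: "a \<in> f ` H" "b \<in> f ` H" for a b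
    proof -
      obtain x y where "x \<in> H" "y \<in> H" "a = f x" "b = f y" using ab by blast
      moreover from this have "x \<in> carrier M" "y \<in> carrier M" using H(1) by auto
      ultimately have "a \<oplus>\<^bsub>N\<^esub> b = f (x \<oplus>\<^bsub>M\<^esub> y)" "x \<oplus>\<^bsub>M\<^esub> y \<in> H" using f(2) H(3) by auto
      then show ?thesis by auto
    qed
    show "a \<odot>\<^bsub>N\<^esub> b \<in> f ` H" if ab: "a \<in> carrier R" "b \<in> f ` H" for a b
    proof -
      obtain y where "y \<in> H" "b = f y" using ab by auto
      moreover from this have "y \<in> carrier M" using H(1) by auto
      ultimately have "a \<odot>\<^bsub>N\<^esub> b = f (a \<odot>\<^bsub>M\<^esub> y)" "a \<odot>\<^bsub>M\<^esub> y \<in> H" using f(3) H(4) ab(1) by auto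
      then show ?thesis by auto
    qed
  qed
qed

lemma lm_restrict_simps [simp]:
  "carrier (lm_restrict M H) = H" "add (lm_restrict M H) = add M"
  "zero (lm_restrict M H) = zero M" "smult (lm_restrict M H) = smult M"
  by (simp_all add: lm_restrict_def)

lemma left_module_restrict:
  assumes "left_module R M" "submodule H R M"
  shows "left_module R (lm_restrict M H)"
proof -
  interpret left_module R M by fact
  note H = submoduleD[OF assms(2)]
  have H1: "x \<in> carrier M" if "x \<in> H" for x using H that by auto
  have "abelian_group (lm_restrict M H)"
  proof (rule abelian_groupI)
    fix x assume "x \<in> carrier (lm_restrict M H)"
    then show "\<exists>y\<in>carrier (lm_restrict M H). y \<oplus>\<^bsub>lm_restrict M H\<^esub> x = \<zero>\<^bsub>lm_restrict M H\<^esub>"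
      by (intro bexI[of _ "\<ominus>\<^bsub>M\<^esub> x"]) (auto simp: H H1 M.l_neg)
  qed (auto simp: H H1 M.a_ac)
  then show ?thesis
    by (intro left_module.intro R.ring_axioms left_module_axioms.intro)
      (auto simp: H H1 smult_l_distr smult_r_distr smult_assoc1)
qed

lemma submodule_restrict_iff:
  assumes "left_module R M" "submodule N R M"
  shows "submodule H R (lm_restrict M N) \<longleftrightarrow> submodule H R M \<and> H \<subseteq> N"
proof -
  interpret left_module R M by fact
  interpret N: left_module R "lm_restrict M N" by (rule left_module_restrict) fact+
  note N' = submoduleD[OF assms(2)]
  show ?thesis
  proof safe
    assume H: "submodule H R (lm_restrict M N)"
    show "submodule H R M"
      by (rule submoduleI') (use N.submoduleD[OF H] N' in auto)
    show "x \<in> N" if "x \<in> H" for x using N.submoduleD[OF H] that by auto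
  next
    assume H: "submodule H R M" "H \<subseteq> N"
    show "submodule H R (lm_restrict M N)"
      by (rule N.submoduleI') (use submoduleD[OF H(1)] H(2) in auto)
  qed
qed

section \<open>Quotients and the first isomorphism theorem\<close>

lemma quot_coset:
  assumes "left_module R M" "submodule N R M"
  shows "carrier (lm_quot M N) = (\<lambda>x. N +>\<^bsub>M\<^esub> x) ` carrier M"
    "\<And>x y. x \<in> carrier M \<Longrightarrow> y \<in> carrier M \<Longrightarrow>
       (N +>\<^bsub>M\<^esub> x) \<oplus>\<^bsub>lm_quot M N\<^esub> (N +>\<^bsub>M\<^esub> y) = N +>\<^bsub>M\<^esub> (x \<oplus>\<^bsub>M\<^esub> y)"
    "\<And>a x. a \<in> carrier R \<Longrightarrow> x \<in> carrier M \<Longrightarrow>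
       a \<odot>\<^bsub>lm_quot M N\<^esub> (N +>\<^bsub>M\<^esub> x) = N +>\<^bsub>M\<^esub> (a \<odot>\<^bsub>M\<^esub> x)"
    "\<And>x y. x \<in> carrier M \<Longrightarrow> y \<in> carrier M \<Longrightarrow> N +>\<^bsub>M\<^esub> x = N +>\<^bsub>M\<^esub> y \<longleftrightarrow> x \<ominus>\<^bsub>M\<^esub> y \<in> N"
    "N +>\<^bsub>M\<^esub> \<zero>\<^bsub>M\<^esub> = \<zero>\<^bsub>lm_quot M N\<^esub>"
    "\<And>x. x \<in> carrier M \<Longrightarrow> N +>\<^bsub>M\<^esub> x = {y \<in> carrier M. y \<ominus>\<^bsub>M\<^esub> x \<in> N}"
proof -
  interpret left_module R M by fact
  note N = submoduleD[OF assms(2)]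
  interpret N: abelian_subgroup N M
    by (rule abelian_subgroupI3)
      (use assms(2) M.abelian_group_axioms in \<open>auto simp: additive_subgroup_def submodule_def\<close>)
  show "carrier (lm_quot M N) = (\<lambda>x. N +>\<^bsub>M\<^esub> x) ` carrier M"
    by (auto simp: lm_quot_def A_RCOSETS_def')
  show "(N +>\<^bsub>M\<^esub> x) \<oplus>\<^bsub>lm_quot M N\<^esub> (N +>\<^bsub>M\<^esub> y) = N +>\<^bsub>M\<^esub> (x \<oplus>\<^bsub>M\<^esub> y)"
    if "x \<in> carrier M" "y \<in> carrier M" for x y
    using that by (simp add: lm_quot_def N.a_rcos_sum)
  show eq: "N +>\<^bsub>M\<^esub> x = N +>\<^bsub>M\<^esub> y \<longleftrightarrow> x \<ominus>\<^bsub>M\<^esub> y \<in> N" if "x \<in> carrier M" "y \<in> carrier M" for x y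
    using that N.a_repr_independence'[of x y] N.a_rcos_self[of x]
      N.a_rcos_module[of y x] by (auto simp: a_minus_def)
  show cos: "N +>\<^bsub>M\<^esub> x = {y \<in> carrier M. y \<ominus>\<^bsub>M\<^esub> x \<in> N}" if "x \<in> carrier M" for x
    using that N.a_rcos_module[of x] M.a_r_coset_subset_G[OF N(1) that] by (auto simp: a_minus_def)
  show "N +>\<^bsub>M\<^esub> \<zero>\<^bsub>M\<^esub> = \<zero>\<^bsub>lm_quot M N\<^esub>"
    using N(1) by (simp add: lm_quot_def)
  show "a \<odot>\<^bsub>lm_quot M N\<^esub> (N +>\<^bsub>M\<^esub> x) = N +>\<^bsub>M\<^esub> (a \<odot>\<^bsub>M\<^esub> x)"
    if a: "a \<in> carrier R" and x: "x \<in> carrier M" for a x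
  proof -
    \<comment> \<open>The scalar multiple of a coset is defined as a union over its elements. All
      sets in this union coincide, because a multiple of an element of \<open>N\<close> lies in
      \<open>N\<close>.\<close>
    have "N +>\<^bsub>M\<^esub> (a \<odot>\<^bsub>M\<^esub> y) = N +>\<^bsub>M\<^esub> (a \<odot>\<^bsub>M\<^esub> x)" if "y \<in> N +>\<^bsub>M\<^esub> x" for y
    proof -
      have y: "y \<in> carrier M" "y \<ominus>\<^bsub>M\<^esub> x \<in> N" using that cos[OF x] by auto
      have "a \<odot>\<^bsub>M\<^esub> y \<ominus>\<^bsub>M\<^esub> a \<odot>\<^bsub>M\<^esub> x = a \<odot>\<^bsub>M\<^esub> (y \<ominus>\<^bsub>M\<^esub> x)"
        using a x y(1) by (simp add: a_minus_def smult_r_distr smult_minus)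
      then show ?thesis using eq[of "a \<odot>\<^bsub>M\<^esub> y" "a \<odot>\<^bsub>M\<^esub> x"] a x y N(4) by auto
    qed
    moreover have "x \<in> N +>\<^bsub>M\<^esub> x" using x by (rule N.a_rcos_self)
    ultimately have "(\<Union>y\<in>N +>\<^bsub>M\<^esub> x. N +>\<^bsub>M\<^esub> (a \<odot>\<^bsub>M\<^esub> y)) = N +>\<^bsub>M\<^esub> (a \<odot>\<^bsub>M\<^esub> x)"
      by (intro UN_constant_eq ballI)
    then show ?thesis by (simp add: lm_quot_def)
  qed
qed

lemma left_module_quot:
  assumes "left_module R M" "submodule N R M"
  shows "left_module R (lm_quot M N)"
  by (rule left_module_image[OF assms(1), where g = "\<lambda>x. N +>\<^bsub>M\<^esub> x"])
    (simp_all add: quot_coset(1-3,5)[OF assms])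

lemma quot_proj_hom:
  assumes "left_module R M" "submodule N R M"
  shows "lm_quot_proj M N \<in> lm_hom R M (lm_quot M N)"
    "lm_quot_proj M N ` carrier M = carrier (lm_quot M N)"
    "\<And>x. x \<in> carrier M \<Longrightarrow> lm_quot_proj M N x = \<zero>\<^bsub>lm_quot M N\<^esub> \<longleftrightarrow> x \<in> N"
proof -
  interpret left_module R M by fact
  show "lm_quot_proj M N \<in> lm_hom R M (lm_quot M N)"
    by (rule lm_homI) (use quot_coset[OF assms] in \<open>auto simp: lm_quot_proj_def\<close>)
  show "lm_quot_proj M N ` carrier M = carrier (lm_quot M N)"
    using quot_coset[OF assms] by (auto simp: lm_quot_proj_def)
  show "lm_quot_proj M N x = \<zero>\<^bsub>lm_quot M N\<^esub> \<longleftrightarrow> x \<in> N" if "x \<in> carrier M" for x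
    using that quot_coset(4)[OF assms that M.zero_closed] quot_coset(5)[OF assms]
    by (simp add: lm_quot_proj_def)
qed

text \<open>First isomorphism theorem, with the map going from \<open>X\<close> to the quotient, as
  the definition of the standard kernel compares a factor with a simple module in this
  direction.\<close>

lemma lm_isomorphic_quot:
  assumes "left_module R M" "left_module R X" "g \<in> lm_hom R M X" "g ` carrier M = carrier X"
    and ker: "{x \<in> carrier M. g x = \<zero>\<^bsub>X\<^esub>} = N"
  shows "lm_isomorphic R X (lm_quot M N)"
proof -
  interpret M: left_module R M by fact
  interpret X: left_module R X by fact
  have N: "submodule N R M"
    using lm_hom_vimage_submodule[OF assms(1-3) X.submodule_zero] ker by simp
  note g = lm_homD[OF assms(3)] and q = quot_coset(1-3,5)[OF assms(1) N] and q6 = quot_coset(6)[OF assms(1) N]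
  \<comment> \<open>The fibre over \<open>y\<close> is a coset of the kernel, so the inverse
    isomorphism needs no choice of preimages.\<close>
  define f where "f y = {x \<in> carrier M. g x = y}" for y
  have f: "f (g x) = N +>\<^bsub>M\<^esub> x" if "x \<in> carrier M" for x
  proof -
    have "y \<ominus>\<^bsub>M\<^esub> x \<in> N \<longleftrightarrow> g y = g x" if "y \<in> carrier M" for y
      unfolding ker[symmetric]
      using that \<open>x \<in> carrier M\<close> g(1) X.diff_zero_iff lm_hom_minus[OF assms(1-3)] by auto
    then show ?thesis using q6[OF that] by (auto simp: f_def)
  qed
  have pre: "\<exists>x\<in>carrier M. y = g x" if "y \<in> carrier X" for y using that assms(4) by auto
  have "f \<in> lm_hom R X (lm_quot M N)"
  proof (rule lm_homI)
    fix x assume "x \<in> carrier X"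
    then obtain x' where x: "x = g x'" "x' \<in> carrier M" using pre by metis
    then show "f x \<in> carrier (lm_quot M N)" by (simp add: f q)
    show "f (a \<odot>\<^bsub>X\<^esub> x) = a \<odot>\<^bsub>lm_quot M N\<^esub> f x" if "a \<in> carrier R" for a
      using x that by (simp add: f q g(3)[symmetric])
    fix y assume "y \<in> carrier X"
    then obtain y' where y: "y = g y'" "y' \<in> carrier M" using pre by metis
    show "f (x \<oplus>\<^bsub>X\<^esub> y) = f x \<oplus>\<^bsub>lm_quot M N\<^esub> f y"
      using x y by (simp add: f q g(2)[symmetric])
  qed
  moreover have "inj_on f (carrier X)"
  proof (rule inj_onI)
    fix x y assume "x \<in> carrier X" "y \<in> carrier X" "f x = f y"
    then show "x = y" using pre[of x] unfolding f_def by auto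
  qed
  moreover have "f ` carrier X = carrier (lm_quot M N)"
  proof -
    have "f ` carrier X = (\<lambda>x. f (g x)) ` carrier M" using assms(4) by (metis image_image)
    then show ?thesis using f q(1) by auto
  qed
  ultimately have "f \<in> lm_iso R X (lm_quot M N)" by (auto simp: lm_iso_def bij_betw_def)
  then show ?thesis by (auto simp: lm_isomorphic_def)
qed

section \<open>Simple modules and composition series\<close>

lemma quot_simple:
  assumes "left_module R M" "maximal_submodule R M N"
  shows "simple_lm R (lm_quot M N)"
proof -
  interpret M: left_module R M by fact
  have N: "submodule N R M" "N \<noteq> carrier M"
    "\<And>N'. submodule N' R M \<Longrightarrow> N \<subseteq> N' \<Longrightarrow> N' = N \<or> N' = carrier M"
    using assms(2) by (auto simp: maximal_submodule_def)
  note lm = left_module_quot[OF assms(1) N(1)]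
  note p = quot_proj_hom[OF assms(1) N(1)]
  interpret Q: left_module R "lm_quot M N" by fact
  have 1: "carrier (lm_quot M N) \<noteq> {\<zero>\<^bsub>lm_quot M N\<^esub>}"
  proof
    assume *: "carrier (lm_quot M N) = {\<zero>\<^bsub>lm_quot M N\<^esub>}"
    have "x \<in> N" if "x \<in> carrier M" for x
      using p(3)[OF that] lm_homD(1)[OF p(1) that] * by simp
    then show False using N(2) M.submoduleD(1)[OF N(1)] by auto
  qed
  have "H = {\<zero>\<^bsub>lm_quot M N\<^esub>} \<or> H = carrier (lm_quot M N)" if H: "submodule H R (lm_quot M N)" for H
  proof -
    \<comment> \<open>The preimage of \<open>H\<close> lies between \<open>N\<close> and the whole
      module, so maximality leaves two cases; \<open>H\<close> is recovered as the image of its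
      preimage because the projection is onto.\<close>
    let ?H = "{x \<in> carrier M. lm_quot_proj M N x \<in> H}"
    have "lm_quot_proj M N ` ?H = lm_quot_proj M N ` carrier M \<inter> H" by auto
    then have im: "lm_quot_proj M N ` ?H = H" using p(2) Q.submoduleD(1)[OF H] by auto
    have N_H: "lm_quot_proj M N x \<in> H" if "x \<in> N" for x
    proof -
      have "lm_quot_proj M N x = \<zero>\<^bsub>lm_quot M N\<^esub>" using p(3)[of x] that M.submoduleD(1)[OF N(1)] by blast
      then show ?thesis using Q.submoduleD(2)[OF H] by simp
    qed
    have "submodule ?H R M" by (rule lm_hom_vimage_submodule[OF assms(1) lm p(1) H])
    moreover have "N \<subseteq> ?H" using M.submoduleD(1)[OF N(1)] N_H by auto
    ultimately have "?H = N \<or> ?H = carrier M" using N(3) by blast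
    then show ?thesis
    proof
      assume "?H = carrier M" then show ?thesis using im p(2) by simp
    next
      assume h: "?H = N"
      have "lm_quot_proj M N ` N \<subseteq> {\<zero>\<^bsub>lm_quot M N\<^esub>}" using p(3) M.submoduleD(1)[OF N(1)] by auto
      then show ?thesis using im h Q.submoduleD(2)[OF H] by auto
    qed
  qed
  then show ?thesis using 1 lm by (auto simp: simple_lm_def)
qed

text \<open>\<open>len\<close> stands in for the dimension. Below a non-zero submodule, a proper
  submodule with the largest value of \<open>len\<close> is maximal, so the top quotient is simple,
  and the induction continues with that submodule.\<close>

lemma composition_series_exists:
  fixes len :: "'b set \<Rightarrow> nat"
  assumes M: "left_module R M"
    and mono: "\<And>N N'. submodule N R M \<Longrightarrow> submodule N' R M \<Longrightarrow> N \<subset> N' \<Longrightarrow> len N < len N'"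
  shows "\<exists>Ns. composition_series R M Ns"
proof -
  interpret M: left_module R M by fact
  have "\<exists>Ns. Ns \<noteq> [] \<and> hd Ns = {\<zero>\<^bsub>M\<^esub>} \<and> last Ns = N \<and> (\<forall>N\<in>set Ns. submodule N R M) \<and>
     (\<forall>i. Suc i < length Ns \<longrightarrow> Ns ! i \<subseteq> Ns ! Suc i \<and>
        simple_lm R (lm_quot (lm_restrict M (Ns ! Suc i)) (Ns ! i)))"
    if "submodule N R M" for N
    using that
  proof (induction "len N" arbitrary: N rule: less_induct)
    case less
    show ?case
    proof (cases "N = {\<zero>\<^bsub>M\<^esub>}")
      case True
      then show ?thesis using M.submodule_zero by (intro exI[of _ "[N]"]) auto
    next
      case False
      let ?P = "\<lambda>N'. submodule N' R M \<and> N' \<subset> N"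
      have "?P {\<zero>\<^bsub>M\<^esub>}" using False M.submodule_zero M.submoduleD(2)[OF less.prems] by auto
      moreover have "\<forall>N'. ?P N' \<longrightarrow> len N' \<le> len N" using mono less.prems by (simp add: less_imp_le)
      ultimately have "\<exists>N'. ?P N' \<and> (\<forall>L. ?P L \<longrightarrow> len L \<le> len N')"
        by (intro ex_has_greatest_nat[of ?P "{\<zero>\<^bsub>M\<^esub>}" len "Suc (len N)"]) (auto simp: less_Suc_eq_le)
      then obtain N' where N': "?P N'" and max: "\<And>L. ?P L \<Longrightarrow> len L \<le> len N'" by blast
      obtain Ns where Ns: "Ns \<noteq> []" "hd Ns = {\<zero>\<^bsub>M\<^esub>}" "last Ns = N'"
        "\<forall>N\<in>set Ns. submodule N R M"
        "\<forall>i. Suc i < length Ns \<longrightarrow> Ns ! i \<subseteq> Ns ! Suc i \<and>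
          simple_lm R (lm_quot (lm_restrict M (Ns ! Suc i)) (Ns ! i))"
        using less.hyps[of N'] mono[of N' N] N' less.prems by blast
      have "L = N' \<or> L = N" if "submodule L R M" "L \<subseteq> N" "N' \<subseteq> L" for L
        using max[of L] mono[of N' L] that N' by fastforce
      then have "maximal_submodule R (lm_restrict M N) N'"
        using N' unfolding maximal_submodule_def by (auto simp: submodule_restrict_iff[OF M less.prems])
      then have simple: "simple_lm R (lm_quot (lm_restrict M N) N')"
        by (intro quot_simple left_module_restrict M less.prems)
      show ?thesis
      proof (intro exI[of _ "Ns @ [N]"] conjI allI impI)
        fix i assume i: "Suc i < length (Ns @ [N])"
        have *: "Ns ! i = N'" if "Suc i = length Ns"
          using that Ns(1,3) by (metis diff_Suc_1 last_conv_nth)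
        show "(Ns @ [N]) ! i \<subseteq> (Ns @ [N]) ! Suc i"
          using Ns(5) i * N' by (auto simp: nth_append less_Suc_eq)
        show "simple_lm R (lm_quot (lm_restrict M ((Ns @ [N]) ! Suc i)) ((Ns @ [N]) ! i))"
          using Ns(5) i * simple by (auto simp: nth_append less_Suc_eq)
      qed (use Ns less.prems in auto)
    qed
  qed
  then show ?thesis using M.submodule_carrier unfolding composition_series_def by blast
qed

text \<open>The kernel of \<open>g\<close> is proper, so it lies in \<open>N\<close>. The image of
  \<open>N\<close> is zero or all of \<open>X\<close>. If it were all of \<open>X\<close>, each
  element of \<open>P\<close> would differ from one of \<open>N\<close> by an element of the kernel,
  and \<open>N\<close> would be the whole module. Hence \<open>N\<close> is the kernel.\<close>

lemma simple_lm_isomorphic: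
  assumes P: "left_module R P" and X: "simple_lm R X" and g: "g \<in> lm_hom R P X"
    and nz: "p \<in> carrier P" "g p \<noteq> \<zero>\<^bsub>X\<^esub>"
    and N: "submodule N R P" "N \<noteq> carrier P"
    and loc: "\<And>L. submodule L R P \<Longrightarrow> L \<noteq> carrier P \<Longrightarrow> L \<subseteq> N"
  shows "lm_isomorphic R X (lm_quot P N)"
proof -
  interpret P: left_module R P by fact
  have X': "left_module R X" using X by (simp add: simple_lm_def)
  interpret X: left_module R X by fact
  have sim: "L = {\<zero>\<^bsub>X\<^esub>} \<or> L = carrier X" if "submodule L R X" for L
    using X that by (auto simp: simple_lm_def)
  note h = lm_homD[OF g]
  let ?k = "{x \<in> carrier P. g x = \<zero>\<^bsub>X\<^esub>}"
  have k: "submodule ?k R P" using lm_hom_vimage_submodule[OF P X' g X.submodule_zero] by simp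
  have kN: "?k \<subseteq> N" using loc[OF k] nz by blast
  have onto: "g ` carrier P = carrier X"
    using sim[OF lm_hom_image_submodule[OF P X' g P.submodule_carrier]] nz by blast
  have "g ` N \<noteq> carrier X"
  proof
    assume *: "g ` N = carrier X"
    have "p \<in> N" if "p \<in> carrier P" for p
    proof -
      have "g p \<in> g ` N" using * h(1)[OF that] by simp
      then obtain n where n: "n \<in> N" "g n = g p" by (metis imageE)
      have n': "n \<in> carrier P" using n P.submoduleD(1)[OF N(1)] by auto
      have "g (p \<ominus>\<^bsub>P\<^esub> n) = \<zero>\<^bsub>X\<^esub>"
        using n n' that by (simp add: lm_hom_minus[OF P X' g] X.diff_zero_iff h)
      then have "p \<ominus>\<^bsub>P\<^esub> n \<in> N" using kN that n' by auto
      then have "(p \<ominus>\<^bsub>P\<^esub> n) \<oplus>\<^bsub>P\<^esub> n \<in> N" using n P.submoduleD(3)[OF N(1)] by auto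
      then show ?thesis using that n' by (simp add: P.M.minus_eq P.M.a_assoc P.M.l_neg)
    qed
    then show False using N(2) P.submoduleD(1)[OF N(1)] by auto
  qed
  then have "g ` N = {\<zero>\<^bsub>X\<^esub>}" using sim[OF lm_hom_image_submodule[OF P X' g N(1)]] by auto
  then have "N \<subseteq> ?k" using P.submoduleD(1)[OF N(1)] by auto
  then show ?thesis using kN by (intro lm_isomorphic_quot[OF P X' g onto]) auto
qed

text \<open>A proper submodule that contains all proper submodules is the only maximal one, so the
  intersection in \<open>lm_rad\<close> runs over a single set.\<close>

lemma lm_rad_local:
  assumes N: "submodule N R P" "N \<noteq> carrier P"
    and loc: "\<And>L. submodule L R P \<Longrightarrow> L \<noteq> carrier P \<Longrightarrow> L \<subseteq> N"
    and sub: "N \<subseteq> carrier P"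
  shows "lm_rad R P = N"
proof -
  have "maximal_submodule R P L \<longleftrightarrow> L = N" for L
    using N loc unfolding maximal_submodule_def by blast
  then show ?thesis using sub unfolding lm_rad_def by auto
qed

section \<open>Finite direct sums\<close>

lemma lm_dsum_simps [simp]:
  "carrier (lm_dsum I M) = (\<Pi>\<^sub>E i\<in>I. carrier (M i))"
  "zero (lm_dsum I M) = (\<lambda>i\<in>I. \<zero>\<^bsub>M i\<^esub>)"
  "add (lm_dsum I M) v w = (\<lambda>i\<in>I. v i \<oplus>\<^bsub>M i\<^esub> w i)"
  "smult (lm_dsum I M) a v = (\<lambda>i\<in>I. a \<odot>\<^bsub>M i\<^esub> v i)"
  by (simp_all add: lm_dsum_def)

lemma left_module_dsum:
  assumes "ring R" "\<And>i. i \<in> I \<Longrightarrow> left_module R (M i)"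
  shows "left_module R (lm_dsum I M)"
proof -
  interpret R: ring R by fact
  note ax = left_module.axioms[OF assms(2)]
  have ag: "abelian_group (M i)" if "i \<in> I" for i using ax(2)[OF that] .
  have cl: "v i \<in> carrier (M i)" if "v \<in> (\<Pi>\<^sub>E i\<in>I. carrier (M i))" "i \<in> I" for v i
    using that by auto
  have am: "abelian_monoid (M i)" if "i \<in> I" for i using ag[OF that] by (simp add: abelian_group_def)
  have "abelian_group (lm_dsum I M)"
  proof (rule abelian_groupI)
    fix v assume v: "v \<in> carrier (lm_dsum I M)"
    show "\<exists>w\<in>carrier (lm_dsum I M). w \<oplus>\<^bsub>lm_dsum I M\<^esub> v = \<zero>\<^bsub>lm_dsum I M\<^esub>"
      using v by (intro bexI[of _ "\<lambda>i\<in>I. \<ominus>\<^bsub>M i\<^esub> v i"])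
        (auto intro!: restrict_ext simp: abelian_group.l_neg[OF ag] abelian_group.a_inv_closed[OF ag] cl)
    show "\<zero>\<^bsub>lm_dsum I M\<^esub> \<oplus>\<^bsub>lm_dsum I M\<^esub> v = v"
      using v by (auto intro!: extensionalityI[of _ I] simp: abelian_monoid.l_zero[OF am] cl PiE_iff)
    fix w assume w: "w \<in> carrier (lm_dsum I M)"
    show "v \<oplus>\<^bsub>lm_dsum I M\<^esub> w \<in> carrier (lm_dsum I M)"
      using v w by (auto intro!: abelian_monoid.a_closed[OF am] simp: cl)
    show "v \<oplus>\<^bsub>lm_dsum I M\<^esub> w = w \<oplus>\<^bsub>lm_dsum I M\<^esub> v"
      using v w by (auto intro!: restrict_ext simp: cl abelian_monoid.a_comm[OF am])
    fix u assume u: "u \<in> carrier (lm_dsum I M)"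
    show "v \<oplus>\<^bsub>lm_dsum I M\<^esub> w \<oplus>\<^bsub>lm_dsum I M\<^esub> u = v \<oplus>\<^bsub>lm_dsum I M\<^esub> (w \<oplus>\<^bsub>lm_dsum I M\<^esub> u)"
      using u v w by (auto intro!: restrict_ext simp: cl abelian_monoid.a_assoc[OF am])
  qed (auto intro: abelian_monoid.zero_closed[OF am])
  then show ?thesis
    by (intro left_module.intro assms(1) left_module_axioms.intro)
      (auto intro!: restrict_ext left_module.smult_closed[OF assms(2)] extensionalityI[of _ I]
         simp: cl PiE_iff left_module.smult_l_distr[OF assms(2)] left_module.smult_r_distr[OF assms(2)]
           left_module.smult_assoc1[OF assms(2)] left_module.smult_one[OF assms(2)])
qed

lemma finsum_lm_dsum:
  assumes "ring R" "\<And>i. i \<in> I \<Longrightarrow> left_module R (M i)"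
    and "finite A" "f \<in> A \<rightarrow> (\<Pi>\<^sub>E i\<in>I. carrier (M i))"
  shows "finsum (lm_dsum I M) f A = (\<lambda>i\<in>I. \<Oplus>\<^bsub>M i\<^esub>a\<in>A. f a i)"
proof -
  interpret left_module R "lm_dsum I M" by (rule left_module_dsum) fact+
  note ax = left_module.axioms[OF assms(2)]
  have am: "abelian_monoid (M i)" if "i \<in> I" for i using ax(2)[OF that] by (simp add: abelian_group_def)
  show ?thesis
    using assms(3,4)
  proof (induction A)
    case empty
    then show ?case by (auto intro!: restrict_ext simp: abelian_monoid.finsum_empty[OF am])
  next
    case (insert x F)
    then have f: "f x \<in> (\<Pi>\<^sub>E i\<in>I. carrier (M i))" "f \<in> F \<rightarrow> (\<Pi>\<^sub>E i\<in>I. carrier (M i))" by auto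
    have "(\<Oplus>\<^bsub>M i\<^esub>a\<in>insert x F. f a i) = f x i \<oplus>\<^bsub>M i\<^esub> (\<Oplus>\<^bsub>M i\<^esub>a\<in>F. f a i)" if "i \<in> I" for i
      using f that insert(1,2) by (subst abelian_monoid.finsum_insert[OF am]) (auto simp: Pi_iff PiE_iff)
    then show ?case
      using insert f by (subst M.finsum_insert) (auto intro!: restrict_ext)
  qed
qed

lemma lm_incl_hom:
  assumes "ring R" "\<And>i. i \<in> I \<Longrightarrow> left_module R (M i)" "j \<in> I"
  shows "lm_incl I M j \<in> lm_hom R (M j) (lm_dsum I M)"
proof (rule lm_homI)
  have ag: "abelian_group (M i)" if "i \<in> I" for i using left_module.axioms(2)[OF assms(2)[OF that]] .
  have am: "abelian_monoid (M i)" if "i \<in> I" for i using ag[OF that] by (simp add: abelian_group_def)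
  show "lm_incl I M j x \<in> carrier (lm_dsum I M)" if "x \<in> carrier (M j)" for x
    using that by (auto simp: lm_incl_def abelian_monoid.zero_closed[OF am])
  show "lm_incl I M j (x \<oplus>\<^bsub>M j\<^esub> y) = lm_incl I M j x \<oplus>\<^bsub>lm_dsum I M\<^esub> lm_incl I M j y" for x y
    by (auto intro!: restrict_ext simp: lm_incl_def abelian_monoid.l_zero[OF am] abelian_monoid.zero_closed[OF am])
  show "lm_incl I M j (a \<odot>\<^bsub>M j\<^esub> x) = a \<odot>\<^bsub>lm_dsum I M\<^esub> lm_incl I M j x" if "a \<in> carrier R" for a x
    using that by (auto intro!: restrict_ext simp: lm_incl_def left_module.smult_r_null[OF assms(2)])
qed

lemma regular_lm_simps [simp]:
  "carrier (regular_lm R) = carrier R" "add (regular_lm R) = add R"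
  "zero (regular_lm R) = zero R" "smult (regular_lm R) = mult R"
  by (simp_all add: regular_lm_def)

section \<open>Direct sums of left ideals generated by idempotents\<close>

context ring
begin

lemma regular_submodule_principal:
  assumes "e \<in> carrier R" shows "submodule {a \<otimes> e | a. a \<in> carrier R} R (regular_lm R)"
proof -
  interpret left_module R "regular_lm R" by (rule left_module_regular_lm) unfold_locales
  show ?thesis
  proof (rule submoduleI')
    show "\<zero>\<^bsub>regular_lm R\<^esub> \<in> {a \<otimes> e |a. a \<in> carrier R}" using assms by (auto intro!: exI[of _ \<zero>])
    fix x y assume "x \<in> {a \<otimes> e |a. a \<in> carrier R}" "y \<in> {a \<otimes> e |a. a \<in> carrier R}"
    then obtain a b where *: "x = a \<otimes> e" "y = b \<otimes> e" "a \<in> carrier R" "b \<in> carrier R" by blast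
    then have "x \<oplus> y = (a \<oplus> b) \<otimes> e" using assms by (simp add: l_distr)
    then show "x \<oplus>\<^bsub>regular_lm R\<^esub> y \<in> {a \<otimes> e |a. a \<in> carrier R}" using * by auto
  next
    fix a x assume "a \<in> carrier R" "x \<in> {a \<otimes> e |a. a \<in> carrier R}"
    then obtain b where *: "x = b \<otimes> e" "a \<in> carrier R" "b \<in> carrier R" by blast
    then have "a \<otimes> x = (a \<otimes> b) \<otimes> e" using assms by (simp add: m_assoc)
    then show "a \<odot>\<^bsub>regular_lm R\<^esub> x \<in> {a \<otimes> e |a. a \<in> carrier R}" using * by auto
  qed (use assms in auto)
qed

lemma left_module_principal:
  assumes "e \<in> carrier R"
  shows "left_module R (lm_restrict (regular_lm R) {a \<otimes> e | a. a \<in> carrier R})"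
  by (rule left_module_restrict[OF left_module_regular_lm regular_submodule_principal])
    (use assms ring_axioms in auto)

text \<open>A coordinate \<open>v i\<close> is a left multiple of the idempotent \<open>e i\<close>,
  hence is fixed by right multiplication with it. So \<open>v\<close> is a combination of the
  elements \<open>lm_incl I M i (e i)\<close> with its own coordinates as coefficients. Projectivity
  and finite generation both rest on this expansion.\<close>

lemma dsum_principal:
  assumes fin: "finite I"
    and idem: "\<forall>i\<in>I. e i \<in> carrier R \<and> e i \<otimes> e i = e i"
    and princ: "\<forall>i\<in>I. M i = lm_restrict (regular_lm R) {a \<otimes> e i | a. a \<in> carrier R}"
  shows "left_module R (lm_dsum I M)"
    "\<And>i. i \<in> I \<Longrightarrow> lm_incl I M i (e i) \<in> carrier (lm_dsum I M)"
    "\<And>v i. v \<in> carrier (lm_dsum I M) \<Longrightarrow> i \<in> I \<Longrightarrow> v i \<in> carrier R"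
    "\<And>v. v \<in> carrier (lm_dsum I M) \<Longrightarrow>
       v = (\<Oplus>\<^bsub>lm_dsum I M\<^esub>i\<in>I. v i \<odot>\<^bsub>lm_dsum I M\<^esub> lm_incl I M i (e i))"
proof -
  have e: "e i \<in> carrier R" "e i \<otimes> e i = e i"
    and M: "M i = lm_restrict (regular_lm R) {a \<otimes> e i | a. a \<in> carrier R}" if "i \<in> I" for i
    using idem princ that by auto
  have lm: "left_module R (M i)" if "i \<in> I" for i
    using left_module_principal[OF e(1)[OF that]] M[OF that] by simp
  show 1: "left_module R (lm_dsum I M)"
    by (rule left_module_dsum) (use lm ring_axioms in auto)
  interpret left_module R "lm_dsum I M" by fact
  have ei: "e i \<in> carrier (M i)" if "i \<in> I" for i
    using M[OF that] e(1)[OF that] e(2)[OF that, symmetric] by auto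
  show 2: "lm_incl I M i (e i) \<in> carrier (lm_dsum I M)" if "i \<in> I" for i
    using lm_homD(1)[OF lm_incl_hom[where M = M, OF ring_axioms lm that] ei[OF that]] .
  show 3: "v i \<in> carrier R" if "v \<in> carrier (lm_dsum I M)" "i \<in> I" for v i
  proof -
    have "v i \<in> carrier (M i)" using that by auto
    then show ?thesis using M[OF that(2)] e(1)[OF that(2)] by auto
  qed
  fix v assume v: "v \<in> carrier (lm_dsum I M)"
  have *: "(\<Oplus>\<^bsub>lm_dsum I M\<^esub>i\<in>I. v i \<odot>\<^bsub>lm_dsum I M\<^esub> lm_incl I M i (e i)) =
    (\<lambda>j\<in>I. \<Oplus>\<^bsub>M j\<^esub>i\<in>I. (v i \<odot>\<^bsub>lm_dsum I M\<^esub> lm_incl I M i (e i)) j)"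
    by (rule finsum_lm_dsum[where M = M, OF ring_axioms lm fin]) (use 2 3[OF v] smult_closed in auto)
  have "(\<Oplus>\<^bsub>M j\<^esub>i\<in>I. (v i \<odot>\<^bsub>lm_dsum I M\<^esub> lm_incl I M i (e i)) j) = v j" if j: "j \<in> I" for j
  proof -
    interpret Mj: left_module R "M j" by (rule lm[OF j])
    have "v j \<in> carrier (M j)" using v j by auto
    then obtain a where a: "a \<in> carrier R" "v j = a \<otimes> e j" using M[OF j] by auto
    have ve: "v j \<otimes> e j = v j" using a e[OF j] by (simp add: m_assoc)
    have vj: "v j \<in> carrier (M j)" using v j by auto
    have "(\<Oplus>\<^bsub>M j\<^esub>i\<in>I. (v i \<odot>\<^bsub>lm_dsum I M\<^esub> lm_incl I M i (e i)) j) =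
      (\<Oplus>\<^bsub>M j\<^esub>i\<in>I. if i = j then v j else \<zero>\<^bsub>M j\<^esub>)"
      by (rule Mj.M.finsum_cong')
        (use j vj ve 3[OF v] Mj.M.zero_closed in \<open>auto simp: lm_incl_def M[OF j]
           simp del: Mj.M.zero_closed intro: Mj.smult_r_null\<close>)
    also have "\<dots> = v j" using j vj fin Mj.M.finsum_delta[of I j "\<lambda>_. v j"] by simp
    finally show ?thesis .
  qed
  then show "v = (\<Oplus>\<^bsub>lm_dsum I M\<^esub>i\<in>I. v i \<odot>\<^bsub>lm_dsum I M\<^esub> lm_incl I M i (e i))"
    unfolding * using v by (auto intro!: extensionalityI[of _ I] simp: PiE_iff)
qed

lemma projective_dsum_principal:
  assumes fin: "finite I"
    and idem: "\<forall>i\<in>I. e i \<in> carrier R \<and> e i \<otimes> e i = e i"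
    and princ: "\<forall>i\<in>I. M i = lm_restrict (regular_lm R) {a \<otimes> e i | a. a \<in> carrier R}"
  shows "projective_lm (tx :: 'x itself) (ty :: 'y itself) R (lm_dsum I M)"
  unfolding projective_lm_def
proof (intro conjI allI impI)
  have e: "e i \<in> carrier R" "e i \<otimes> e i = e i"
    and M: "M i = lm_restrict (regular_lm R) {a \<otimes> e i | a. a \<in> carrier R}" if "i \<in> I" for i
    using idem princ that by auto
  note D = dsum_principal[OF assms]
  show "left_module R (lm_dsum I M)" using D by blast
  fix X :: "('a, 'x) module" and Y :: "('a, 'y) module" and g f
  assume "left_module R X \<and> left_module R Y \<and> g \<in> lm_hom R X Y \<and> g ` carrier X = carrier Y \<and>
    f \<in> lm_hom R (lm_dsum I M) Y"
  then have X: "left_module R X" and Y: "left_module R Y" and g: "g \<in> lm_hom R X Y"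
    "g ` carrier X = carrier Y" and f: "f \<in> lm_hom R (lm_dsum I M) Y" by auto
  interpret X: left_module R X by fact
  interpret Y: left_module R Y by fact
  interpret Q: left_module R "lm_dsum I M" using D by blast
  note f' = lm_homD[OF f] and g' = lm_homD[OF g(1)]
  have "\<forall>i\<in>I. \<exists>x\<in>carrier X. g x = f (lm_incl I M i (e i))"
    using D(2) f'(1) g(2) by (metis (no_types, lifting) imageE)
  then obtain x where x: "\<And>i. i \<in> I \<Longrightarrow> x i \<in> carrier X"
    "\<And>i. i \<in> I \<Longrightarrow> g (x i) = f (lm_incl I M i (e i))" by metis
  \<comment> \<open>The coefficients are the coordinates of \<open>v\<close>, so \<open>h\<close> is
    linear for every choice of the preimages \<open>x i\<close>, and the expansion of
    \<open>v\<close> gives the lifting property.\<close>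
  define h where "h v = (\<Oplus>\<^bsub>X\<^esub>i\<in>I. v i \<odot>\<^bsub>X\<^esub> x i)" for v
  have vi: "v i \<otimes> e i = v i" "v i \<in> carrier R" if v: "v \<in> carrier (lm_dsum I M)" "i \<in> I" for v i
  proof -
    have "v i \<in> carrier (M i)" using v by auto
    then obtain a where a: "a \<in> carrier R" "v i = a \<otimes> e i" using M[OF v(2)] by auto
    then show "v i \<otimes> e i = v i" "v i \<in> carrier R" using e[OF v(2)] by (simp_all add: m_assoc)
  qed
  show "\<exists>h\<in>lm_hom R (lm_dsum I M) X. \<forall>v\<in>carrier (lm_dsum I M). g (h v) = f v"
  proof (intro bexI[of _ h] ballI lm_homI)
    fix v assume v: "v \<in> carrier (lm_dsum I M)"
    show "h v \<in> carrier X" unfolding h_def using x vi[OF v] by (intro X.M.finsum_closed) auto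
    have "g (h v) = (\<Oplus>\<^bsub>Y\<^esub>i\<in>I. g (v i \<odot>\<^bsub>X\<^esub> x i))"
      unfolding h_def by (rule lm_hom_finsum[OF X Y g(1)]) (use x vi[OF v] in auto)
    also have "\<dots> = (\<Oplus>\<^bsub>Y\<^esub>i\<in>I. f (v i \<odot>\<^bsub>lm_dsum I M\<^esub> lm_incl I M i (e i)))"
      using vi[OF v] x D(2) f' g'(3) by (intro Y.M.finsum_cong') (auto simp del: lm_dsum_simps)
    also have "\<dots> = f (\<Oplus>\<^bsub>lm_dsum I M\<^esub>i\<in>I. v i \<odot>\<^bsub>lm_dsum I M\<^esub> lm_incl I M i (e i))"
      by (rule lm_hom_finsum[OF D(1) Y f, symmetric]) (use D(2) vi[OF v] Q.smult_closed in auto)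
    also have "\<dots> = f v" using D(4)[OF v] by simp
    finally show "g (h v) = f v" .
    fix a assume a: "a \<in> carrier R"
    have "h (a \<odot>\<^bsub>lm_dsum I M\<^esub> v) = (\<Oplus>\<^bsub>X\<^esub>i\<in>I. a \<odot>\<^bsub>X\<^esub> (v i \<odot>\<^bsub>X\<^esub> x i))"
      unfolding h_def using vi[OF v] x a M
      by (intro X.M.finsum_cong') (auto simp: X.smult_assoc1)
    also have "\<dots> = a \<odot>\<^bsub>X\<^esub> h v"
      unfolding h_def using vi[OF v] x a
      by (intro finsum_additive[symmetric] X.M.abelian_group_axioms) (auto simp: X.smult_r_distr)
    finally show "h (a \<odot>\<^bsub>lm_dsum I M\<^esub> v) = a \<odot>\<^bsub>X\<^esub> h v" .
  next
    fix v w assume v: "v \<in> carrier (lm_dsum I M)" and w: "w \<in> carrier (lm_dsum I M)"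
    have "h (v \<oplus>\<^bsub>lm_dsum I M\<^esub> w) = (\<Oplus>\<^bsub>X\<^esub>i\<in>I. v i \<odot>\<^bsub>X\<^esub> x i \<oplus>\<^bsub>X\<^esub> w i \<odot>\<^bsub>X\<^esub> x i)"
      unfolding h_def using vi[OF v] vi[OF w] x M
      by (intro X.M.finsum_cong') (auto simp: X.smult_l_distr)
    also have "\<dots> = h v \<oplus>\<^bsub>X\<^esub> h w"
      unfolding h_def using vi[OF v] vi[OF w] x by (intro X.M.finsum_addf) auto
    finally show "h (v \<oplus>\<^bsub>lm_dsum I M\<^esub> w) = h v \<oplus>\<^bsub>X\<^esub> h w" .
  qed
qed

lemma fin_gen_dsum_principal:
  assumes fin: "finite I"
    and idem: "\<forall>i\<in>I. e i \<in> carrier R \<and> e i \<otimes> e i = e i"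
    and princ: "\<forall>i\<in>I. M i = lm_restrict (regular_lm R) {a \<otimes> e i | a. a \<in> carrier R}"
  shows "lm_fin_gen R (lm_dsum I M)"
  unfolding lm_fin_gen_def
proof (intro exI[of _ "(\<lambda>i. lm_incl I M i (e i)) ` I"] conjI allI impI)
  note D = dsum_principal[OF assms]
  interpret Q: left_module R "lm_dsum I M" using D by blast
  show "(\<lambda>i. lm_incl I M i (e i)) ` I \<subseteq> carrier (lm_dsum I M)" using D(2) by blast
  fix N assume N: "submodule N R (lm_dsum I M) \<and> (\<lambda>i. lm_incl I M i (e i)) ` I \<subseteq> N"
  note N' = Q.submoduleD[OF conjunct1[OF N]]
  have "v \<in> N" if v: "v \<in> carrier (lm_dsum I M)" for v
  proof -
    have "(\<Oplus>\<^bsub>lm_dsum I M\<^esub>i\<in>I. v i \<odot>\<^bsub>lm_dsum I M\<^esub> lm_incl I M i (e i)) \<in> N"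
      using D(3)[OF v] N N'(4) by (intro Q.submodule_finsum) (auto simp del: lm_dsum_simps)
    then show ?thesis using D(4)[OF v] by simp
  qed
  then show "N = carrier (lm_dsum I M)" using N'(1) by blast
qed (use fin in auto)

end

lemma lm_fin_gen_image:
  assumes "left_module R M" "left_module R X" "g \<in> lm_hom R M X" "g ` carrier M = carrier X"
    and "lm_fin_gen R M"
  shows "lm_fin_gen R X"
proof -
  interpret X: left_module R X by fact
  obtain A where A: "finite A" "A \<subseteq> carrier M" "\<And>N. submodule N R M \<Longrightarrow> A \<subseteq> N \<Longrightarrow> N = carrier M"
    using assms(5) by (auto simp: lm_fin_gen_def)
  show ?thesis
    unfolding lm_fin_gen_def
  proof (intro exI[of _ "g ` A"] conjI allI impI)
    fix N assume N: "submodule N R X \<and> g ` A \<subseteq> N"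
    have "{x \<in> carrier M. g x \<in> N} = carrier M"
      by (rule A(3)[OF lm_hom_vimage_submodule[OF assms(1-3)]]) (use N A(2) in auto)
    then have "g ` carrier M \<subseteq> N" by auto
    then have "carrier X \<subseteq> N" using assms(4) by simp
    then show "N = carrier X" using X.submoduleD(1) N by blast
  qed (use A assms(4) in auto)
qed

section \<open>The interval algebra in coordinates\<close>

lemma rep_hom_eqI:
  assumes "f \<in> rep_hom K V W" "g \<in> rep_hom K V W"
    and "\<And>x v. v \<in> carrier (rep_space V x) \<Longrightarrow> f x v = g x v"
  shows "f = g"
proof
  fix x
  show "f x = g x"
    by (rule extensionalityI[of _ "carrier (rep_space V x)"])
      (use assms in \<open>auto simp: rep_hom_def\<close>)
qed

lemma rep_homD:
  assumes "f \<in> rep_hom K V W"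
  shows "f x \<in> lm_hom K (rep_space V x) (rep_space W x)"
    "f x \<in> extensional (carrier (rep_space V x))"
    "x \<le> y \<Longrightarrow> v \<in> carrier (rep_space V x) \<Longrightarrow> f y (rep_map V x y v) = rep_map W x y (f x v)"
  using assms by (auto simp: rep_hom_def)

lemma rep_comp_hom:
  assumes "f \<in> rep_hom K V W" "g \<in> rep_hom K W Z"
    and "\<And>x y. x \<le> y \<Longrightarrow> rep_map V x y \<in> lm_hom K (rep_space V x) (rep_space V y)"
    and V: "\<And>x. left_module K (rep_space V x)"
  shows "rep_comp V g f \<in> rep_hom K V Z"
proof -
  note f = lm_homD[OF rep_homD(1)[OF assms(1)]] and g = lm_homD[OF rep_homD(1)[OF assms(2)]]
  have "rep_comp V g f x \<in> lm_hom K (rep_space V x) (rep_space Z x)" for x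
  proof -
    interpret left_module K "rep_space V x" by (rule V)
    show ?thesis
      by (rule lm_homI) (auto simp: rep_comp_def compose_def f g)
  qed
  moreover have "rep_comp V g f x \<in> extensional (carrier (rep_space V x))" for x
    by (simp add: rep_comp_def)
  moreover have "rep_comp V g f y (rep_map V x y v) = rep_map Z x y (rep_comp V g f x v)"
    if "x \<le> y" "v \<in> carrier (rep_space V x)" for x y v
    using that lm_homD(1)[OF assms(3)[OF that(1)] that(2)] rep_homD(3)[OF assms(1) that]
      rep_homD(3)[OF assms(2) that(1)] f(1)[OF that(2)]
    by (simp add: rep_comp_def compose_def)
  ultimately show ?thesis unfolding rep_hom_def by blast
qed

lemma rep_End_simps [simp]:
  "carrier (rep_End K V) = rep_hom K V V" "mult (rep_End K V) = rep_comp V"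
  "one (rep_End K V) = rep_id V"
  "zero (rep_End K V) = (\<lambda>x. \<lambda>v\<in>carrier (rep_space V x). \<zero>\<^bsub>rep_space V x\<^esub>)"
  "add (rep_End K V) f g = (\<lambda>x. \<lambda>v\<in>carrier (rep_space V x). f x v \<oplus>\<^bsub>rep_space V x\<^esub> g x v)"
  by (simp_all add: rep_End_def)

lemma ring_rep_End:
  assumes V: "\<And>x. left_module K (rep_space V x)"
    and map: "\<And>x y. x \<le> y \<Longrightarrow> rep_map V x y \<in> lm_hom K (rep_space V x) (rep_space V y)"
    and K: "cring K"
  shows "ring (rep_End K V)"
proof (rule ringI)
  interpret K: cring K by fact
  have ag: "abelian_group (rep_space V x)" and am: "abelian_monoid (rep_space V x)" for x
    using left_module.axioms(2)[OF V[of x]] by (auto simp: abelian_group_def)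
  note sm = left_module.smult_closed[OF V] left_module.smult_r_distr[OF V]
    left_module.smult_r_null[OF V] left_module.smult_minus[OF V]
  note cl = abelian_monoid.a_closed[OF am] abelian_monoid.zero_closed[OF am]
    abelian_group.a_inv_closed[OF ag] abelian_monoid.l_zero[OF am]
  have f0: "f x v \<in> carrier (rep_space V x)"
    if "f \<in> rep_hom K V V" "v \<in> carrier (rep_space V x)" for f x v
    using lm_homD(1)[OF rep_homD(1)[OF that(1)] that(2)] .
  have f1: "f x (v \<oplus>\<^bsub>rep_space V x\<^esub> w) = f x v \<oplus>\<^bsub>rep_space V x\<^esub> f x w"
    if "f \<in> rep_hom K V V" "v \<in> carrier (rep_space V x)" "w \<in> carrier (rep_space V x)" for f x v w
    using lm_homD(2)[OF rep_homD(1)[OF that(1)] that(2,3)] .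
  have f2: "f x (a \<odot>\<^bsub>rep_space V x\<^esub> v) = a \<odot>\<^bsub>rep_space V x\<^esub> f x v"
    if "f \<in> rep_hom K V V" "a \<in> carrier K" "v \<in> carrier (rep_space V x)" for f x v a
    using lm_homD(3)[OF rep_homD(1)[OF that(1)] that(2,3)] .
  have m: "rep_map V x y v \<in> carrier (rep_space V y)"
    "rep_map V x y (v \<oplus>\<^bsub>rep_space V x\<^esub> w) = rep_map V x y v \<oplus>\<^bsub>rep_space V y\<^esub> rep_map V x y w"
    if "x \<le> y" "v \<in> carrier (rep_space V x)" "w \<in> carrier (rep_space V x)" for x y v w
    using lm_homD(1,2)[OF map[OF that(1)]] that(2,3) by blast+
  have m0: "rep_map V x y \<zero>\<^bsub>rep_space V x\<^esub> = \<zero>\<^bsub>rep_space V y\<^esub>" if "x \<le> y" for x y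
    by (rule lm_hom_zero[OF V V map[OF that]])
  have mm: "rep_map V x y (\<ominus>\<^bsub>rep_space V x\<^esub> v) = \<ominus>\<^bsub>rep_space V y\<^esub> rep_map V x y v"
    if "x \<le> y" "v \<in> carrier (rep_space V x)" for x y v
    using lm_homD(3)[OF map[OF that(1)], of "\<ominus>\<^bsub>K\<^esub> \<one>\<^bsub>K\<^esub>" v] that(2) m(1)[OF that(1,2,2)]
    by (simp add: left_module.smult_minus_one[OF V])
  have zero: "\<zero>\<^bsub>rep_End K V\<^esub> \<in> rep_hom K V V"
    unfolding rep_hom_def by (auto intro!: lm_homI simp: cl sm m m0)
  have add: "f \<oplus>\<^bsub>rep_End K V\<^esub> g \<in> rep_hom K V V"
    if f: "f \<in> rep_hom K V V" "g \<in> rep_hom K V V" for f g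
  proof -
    have "(f x v \<oplus>\<^bsub>rep_space V x\<^esub> f x w) \<oplus>\<^bsub>rep_space V x\<^esub> (g x v \<oplus>\<^bsub>rep_space V x\<^esub> g x w) =
      (f x v \<oplus>\<^bsub>rep_space V x\<^esub> g x v) \<oplus>\<^bsub>rep_space V x\<^esub> (f x w \<oplus>\<^bsub>rep_space V x\<^esub> g x w)"
      if "v \<in> carrier (rep_space V x)" "w \<in> carrier (rep_space V x)" for v w x
    proof -
      interpret left_module K "rep_space V x" by (rule V)
      show ?thesis using that f by (simp add: f0 M.a_ac)
    qed
    then show ?thesis unfolding rep_hom_def using f
      by (auto intro!: lm_homI simp: cl sm m f0 f1 f2 rep_homD(3))
  qed
  have uminus: "(\<lambda>x. \<lambda>v\<in>carrier (rep_space V x). \<ominus>\<^bsub>rep_space V x\<^esub> f x v) \<in> rep_hom K V V"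
    if f: "f \<in> rep_hom K V V" for f
    unfolding rep_hom_def using f
    by (auto intro!: lm_homI simp: cl sm m f0 f1 f2 rep_homD(3) mm abelian_group.minus_add[OF ag])
  have comp: "rep_comp V f g \<in> rep_hom K V V" if "f \<in> rep_hom K V V" "g \<in> rep_hom K V V" for f g
    using rep_comp_hom[OF that(2,1)] map V by blast
  show "abelian_group (rep_End K V)"
  proof (rule abelian_groupI)
    fix f assume f: "f \<in> carrier (rep_End K V)"
    show "\<exists>g\<in>carrier (rep_End K V). g \<oplus>\<^bsub>rep_End K V\<^esub> f = \<zero>\<^bsub>rep_End K V\<^esub>"
      using f uminus[of f] abelian_group.l_neg[OF ag]
      by (intro bexI[of _ "\<lambda>x. \<lambda>v\<in>carrier (rep_space V x). \<ominus>\<^bsub>rep_space V x\<^esub> f x v"])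
        (auto intro!: ext simp: f0)
    show "\<zero>\<^bsub>rep_End K V\<^esub> \<oplus>\<^bsub>rep_End K V\<^esub> f = f"
      by (rule rep_hom_eqI[OF add[OF zero]]) (use f in \<open>auto simp: f0 cl\<close>)
    fix g assume g: "g \<in> carrier (rep_End K V)"
    show "f \<oplus>\<^bsub>rep_End K V\<^esub> g = g \<oplus>\<^bsub>rep_End K V\<^esub> f"
      using f g by (auto intro!: ext abelian_monoid.a_comm[OF am] simp: f0)
    fix h assume h: "h \<in> carrier (rep_End K V)"
    show "f \<oplus>\<^bsub>rep_End K V\<^esub> g \<oplus>\<^bsub>rep_End K V\<^esub> h = f \<oplus>\<^bsub>rep_End K V\<^esub> (g \<oplus>\<^bsub>rep_End K V\<^esub> h)"
      using f g h by (auto intro!: ext abelian_monoid.a_assoc[OF am] simp: f0)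
  qed (use zero add in auto)
  have id: "rep_id V \<in> rep_hom K V V"
    unfolding rep_hom_def rep_id_def by (auto intro!: lm_homI simp: cl sm m)
  show "monoid (rep_End K V)"
  proof (rule monoidI)
    fix f assume f: "f \<in> carrier (rep_End K V)"
    then have f': "f \<in> rep_hom K V V" by simp
    show "\<one>\<^bsub>rep_End K V\<^esub> \<otimes>\<^bsub>rep_End K V\<^esub> f = f" unfolding rep_End_simps
      by (rule rep_hom_eqI[OF comp[OF id f'] f'])
        (use f0[OF f'] in \<open>auto simp: rep_comp_def compose_def rep_id_def\<close>)
    show "f \<otimes>\<^bsub>rep_End K V\<^esub> \<one>\<^bsub>rep_End K V\<^esub> = f" unfolding rep_End_simps
      by (rule rep_hom_eqI[OF comp[OF f' id] f'])
        (auto simp: rep_comp_def compose_def rep_id_def)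
    fix g h assume "g \<in> carrier (rep_End K V)" "h \<in> carrier (rep_End K V)"
    then show "f \<otimes>\<^bsub>rep_End K V\<^esub> g \<otimes>\<^bsub>rep_End K V\<^esub> h = f \<otimes>\<^bsub>rep_End K V\<^esub> (g \<otimes>\<^bsub>rep_End K V\<^esub> h)"
      using f by (auto intro!: ext simp: rep_comp_def compose_def f0)
  qed (use comp id in auto)
  fix f g h assume "f \<in> carrier (rep_End K V)" "g \<in> carrier (rep_End K V)" "h \<in> carrier (rep_End K V)"
  then show "(f \<oplus>\<^bsub>rep_End K V\<^esub> g) \<otimes>\<^bsub>rep_End K V\<^esub> h =
      f \<otimes>\<^bsub>rep_End K V\<^esub> h \<oplus>\<^bsub>rep_End K V\<^esub> g \<otimes>\<^bsub>rep_End K V\<^esub> h"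
    "h \<otimes>\<^bsub>rep_End K V\<^esub> (f \<oplus>\<^bsub>rep_End K V\<^esub> g) =
      h \<otimes>\<^bsub>rep_End K V\<^esub> f \<oplus>\<^bsub>rep_End K V\<^esub> h \<otimes>\<^bsub>rep_End K V\<^esub> g"
    by (auto intro!: ext simp: rep_comp_def compose_def f0 f1)
qed

lemma opposite_ring_simps [simp]:
  "carrier (opposite_ring R) = carrier R" "zero (opposite_ring R) = zero R"
  "one (opposite_ring R) = one R" "add (opposite_ring R) = add R"
  "mult (opposite_ring R) a b = b \<otimes>\<^bsub>R\<^esub> a"
  by (simp_all add: opposite_ring_def)

lemma ring_opposite_ring:
  assumes "ring R" shows "ring (opposite_ring R)"
proof -
  interpret ring R by fact
  show ?thesis
  proof (rule ringI)
    show "abelian_group (opposite_ring R)"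
    proof (rule abelian_groupI)
      show "\<exists>y\<in>carrier (opposite_ring R). y \<oplus>\<^bsub>opposite_ring R\<^esub> x = \<zero>\<^bsub>opposite_ring R\<^esub>"
        if "x \<in> carrier (opposite_ring R)" for x
        using that by (intro bexI[of _ "\<ominus>\<^bsub>R\<^esub> x"]) (auto simp: l_neg)
    qed (auto simp: a_ac)
    show "monoid (opposite_ring R)" by (rule monoidI) (auto simp: m_assoc)
  qed (auto simp: l_distr r_distr)
qed

section \<open>Endomorphisms as matrices of scalar functions\<close>

definition unit_vec :: "('k, 'r) ring_scheme \<Rightarrow> 'p::order \<Rightarrow> 'p set \<Rightarrow> 'p set \<Rightarrow> 'k" where
  "unit_vec K x R = (\<lambda>Q\<in>poset_intervals. if Q = R \<and> x \<in> R then \<one>\<^bsub>K\<^esub> else \<zero>\<^bsub>K\<^esub>)"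

text \<open>The scalar by which the component of \<open>a\<close> from the summand of
  \<open>R\<close> to the summand of \<open>S\<close> acts at \<open>x\<close>. Since
  \<open>unit_vec K x R\<close> is the zero vector for \<open>x\<close> outside \<open>R\<close>, it
  is a legitimate argument of \<open>a x\<close> for all \<open>x\<close> and
  \<open>R\<close>.\<close>

definition coef ::
  "('k, 'r) ring_scheme \<Rightarrow> ('p::order, 'k) alg_elem \<Rightarrow> 'p set \<Rightarrow> 'p set \<Rightarrow> 'p \<Rightarrow> 'k" where
  "coef K a R S x = (if R \<in> poset_intervals \<and> S \<in> poset_intervals \<and> x \<in> R \<and> x \<in> S
     then a x (unit_vec K x R) S else \<zero>\<^bsub>K\<^esub>)"

text \<open>
  The space of morphisms from the interval representation of \<^term>\<open>R\<close> to that of \<^term>\<open>S\<close>: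
  a morphism is given by scalars at the points of \<^term>\<open>R \<inter> S\<close>, and the naturality squares say
  exactly that the scalars at \<^term>\<open>x\<close> and \<^term>\<open>y\<close> agree for \<^term>\<open>x \<le> y\<close> with
  \<^term>\<open>x \<in> R\<close> and \<^term>\<open>y \<in> S\<close>, where the scalar outside \<^term>\<open>R \<inter> S\<close> is zero.
\<close>

definition hom_fun :: "('k, 'r) ring_scheme \<Rightarrow> 'p::order set \<Rightarrow> 'p set \<Rightarrow> ('p \<Rightarrow> 'k) \<Rightarrow> bool" where
  "hom_fun K R S \<phi> \<longleftrightarrow> (\<forall>x. \<phi> x \<in> carrier K) \<and> (\<forall>x. x \<notin> R \<inter> S \<longrightarrow> \<phi> x = \<zero>\<^bsub>K\<^esub>) \<and>
     (\<forall>x y. x \<le> y \<and> x \<in> R \<and> y \<in> S \<longrightarrow> \<phi> x = \<phi> y)"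

text \<open>Inverse to \<open>coef\<close>: the endomorphism with a prescribed matrix, acting on row
  vectors at each point.\<close>

definition alg_of ::
  "('k, 'r) ring_scheme \<Rightarrow> ('p::order set \<Rightarrow> 'p set \<Rightarrow> 'p \<Rightarrow> 'k) \<Rightarrow> ('p, 'k) alg_elem" where
  "alg_of K c = (\<lambda>x. \<lambda>v\<in>carrier (rep_space (gen_rep K) x). \<lambda>S\<in>poset_intervals.
     \<Oplus>\<^bsub>K\<^esub>R\<in>poset_intervals. v R \<otimes>\<^bsub>K\<^esub> c R S x)"

text \<open>The second clause fixes the entries at sets that are not intervals, so that the whole
  family can be recovered by \<open>coef\<close>.\<close>

definition matrix_fun ::
  "('k, 'r) ring_scheme \<Rightarrow> ('p::order set \<Rightarrow> 'p set \<Rightarrow> 'p \<Rightarrow> 'k) \<Rightarrow> bool" where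
  "matrix_fun K c \<longleftrightarrow> (\<forall>R S. hom_fun K R S (c R S)) \<and>
     (\<forall>R S x. R \<notin> poset_intervals \<or> S \<notin> poset_intervals \<longrightarrow> c R S x = \<zero>\<^bsub>K\<^esub>)"

abbreviation incl_elem ::
  "('k, 'r) ring_scheme \<Rightarrow> 'p::order set \<Rightarrow> 'p set \<Rightarrow> ('p, 'k) alg_elem" where
  "incl_elem K C D \<equiv> alg_elem_of K C D (interval_incl K C D)"

lemma gen_rep_simps:
  "rep_space (gen_rep K) x = lm_dsum poset_intervals (\<lambda>S. rep_space (interval_rep K S) x)"
  "rep_map (gen_rep K) x y v = (\<lambda>S\<in>poset_intervals. if x \<in> S \<and> y \<in> S then v S else \<zero>\<^bsub>K\<^esub>)"
  by (simp_all add: gen_rep_def rep_dsum_def interval_rep_def)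

lemma interval_space_simps:
  "carrier (rep_space (interval_rep K S) x) = (if x \<in> S then carrier K else {\<zero>\<^bsub>K\<^esub>})"
  "add (rep_space (interval_rep K S) x) = add K"
  "zero (rep_space (interval_rep K S) x) = zero K"
  "smult (rep_space (interval_rep K S) x) = mult K"
  by (simp_all add: interval_rep_def)

lemma gen_rep_carrier:
  "v \<in> carrier (rep_space (gen_rep K) x) \<longleftrightarrow> v \<in> extensional poset_intervals \<and>
     (\<forall>S\<in>poset_intervals. v S \<in> (if x \<in> S then carrier K else {\<zero>\<^bsub>K\<^esub>}))"
  by (auto simp: gen_rep_simps interval_space_simps PiE_iff)

lemma gen_rep_ops:
  "add (rep_space (gen_rep K) x) v w = (\<lambda>S\<in>poset_intervals. v S \<oplus>\<^bsub>K\<^esub> w S)"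
  "zero (rep_space (gen_rep K) x) = (\<lambda>S\<in>poset_intervals. \<zero>\<^bsub>K\<^esub>)"
  "smult (rep_space (gen_rep K) x) a v = (\<lambda>S\<in>poset_intervals. a \<otimes>\<^bsub>K\<^esub> v S)"
  by (simp_all add: gen_rep_simps interval_space_simps)

locale interval_field = field K for K :: "'k ring" (structure)
begin

lemma gen_rep_module: "left_module K (rep_space (gen_rep K) x)"
  unfolding gen_rep_simps
proof (rule left_module_dsum[OF ring_axioms])
  show "left_module K (rep_space (interval_rep K S) x)" if "S \<in> poset_intervals" for S
    using representation_interval_rep[OF field_axioms that] by (simp add: representation_def)
qed

lemma gen_rep_map_hom:
  "rep_map (gen_rep K) x y \<in> lm_hom K (rep_space (gen_rep K) x) (rep_space (gen_rep K) y)"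
proof (rule lm_homI)
  fix v assume v: "v \<in> carrier (rep_space (gen_rep K) x)"
  then show "rep_map (gen_rep K) x y v \<in> carrier (rep_space (gen_rep K) y)"
    by (auto simp: gen_rep_carrier gen_rep_simps(2))
  show "rep_map (gen_rep K) x y (a \<odot>\<^bsub>rep_space (gen_rep K) x\<^esub> v) =
      a \<odot>\<^bsub>rep_space (gen_rep K) y\<^esub> rep_map (gen_rep K) x y v" if "a \<in> carrier K" for a
    using v that by (auto intro!: restrict_ext simp: gen_rep_simps(2) gen_rep_ops)
  show "rep_map (gen_rep K) x y (v \<oplus>\<^bsub>rep_space (gen_rep K) x\<^esub> w) =
      rep_map (gen_rep K) x y v \<oplus>\<^bsub>rep_space (gen_rep K) y\<^esub> rep_map (gen_rep K) x y w" for w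
    by (auto intro!: restrict_ext simp: gen_rep_simps(2) gen_rep_ops)
qed

lemma ring_interval_alg: "ring (interval_alg K)"
  unfolding interval_alg_def
  by (intro ring_opposite_ring ring_rep_End gen_rep_module gen_rep_map_hom cring_axioms)

lemma interval_alg_simps:
  "carrier (interval_alg K) = rep_hom K (gen_rep K) (gen_rep K)"
  "a \<otimes>\<^bsub>interval_alg K\<^esub> b = rep_comp (gen_rep K) b a"
  "\<one>\<^bsub>interval_alg K\<^esub> = rep_id (gen_rep K)"
  "\<zero>\<^bsub>interval_alg K\<^esub> = (\<lambda>x. \<lambda>v\<in>carrier (rep_space (gen_rep K) x). \<lambda>S\<in>poset_intervals. \<zero>)"
  "a \<oplus>\<^bsub>interval_alg K\<^esub> b = (\<lambda>x. \<lambda>v\<in>carrier (rep_space (gen_rep K) x). \<lambda>S\<in>poset_intervals. a x v S \<oplus> b x v S)"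
  by (simp_all add: interval_alg_def gen_rep_ops)

lemma alg_carrier:
  assumes "a \<in> carrier (interval_alg K)" "v \<in> carrier (rep_space (gen_rep K) x)"
  shows "a x v \<in> carrier (rep_space (gen_rep K) x)"
  using lm_homD(1)[OF rep_homD(1)] assms by (metis interval_alg_simps(1))

lemma gen_rep_carrierD:
  assumes "v \<in> carrier (rep_space (gen_rep K) x)" "R \<in> poset_intervals"
  shows "v R \<in> carrier K" "x \<notin> R \<Longrightarrow> v R = \<zero>"
proof -
  have "v R \<in> (if x \<in> R then carrier K else {\<zero>})"
    using assms unfolding gen_rep_carrier by blast
  then show "v R \<in> carrier K" "x \<notin> R \<Longrightarrow> v R = \<zero>" by (auto split: if_splits)
qed

lemma unit_vec_carrier: "unit_vec K x R \<in> carrier (rep_space (gen_rep K) x)"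
  by (auto simp: unit_vec_def gen_rep_carrier)

lemma coef_closed [simp]:
  assumes "a \<in> carrier (interval_alg K)" shows "coef K a R S x \<in> carrier K"
  using alg_carrier[OF assms unit_vec_carrier[of x R]] by (auto simp: coef_def gen_rep_carrier)

lemma coef_apply_unit_vec:
  assumes "a \<in> carrier (interval_alg K)" "R \<in> poset_intervals" "S \<in> poset_intervals"
  shows "a x (unit_vec K x R) S = coef K a R S x"
proof (cases "x \<in> R")
  case True
  then show ?thesis
    using assms alg_carrier[OF assms(1) unit_vec_carrier[of x R]]
    by (auto simp: coef_def gen_rep_carrier split: if_splits)
next
  case False
  then have "unit_vec K x R = \<zero>\<^bsub>rep_space (gen_rep K) x\<^esub>" by (auto simp: unit_vec_def gen_rep_ops)
  moreover have "a x \<zero>\<^bsub>rep_space (gen_rep K) x\<^esub> = \<zero>\<^bsub>rep_space (gen_rep K) x\<^esub>"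
    using lm_hom_zero[OF gen_rep_module gen_rep_module rep_homD(1)] assms(1)
    by (metis interval_alg_simps(1))
  ultimately show ?thesis using False assms by (simp add: coef_def gen_rep_ops)
qed

lemma coef_apply:
  fixes a :: "('p::{finite, order}, 'k) alg_elem"
  assumes a: "a \<in> carrier (interval_alg K)" and v: "v \<in> carrier (rep_space (gen_rep K) x)"
    and S: "S \<in> poset_intervals"
  shows "a x v S = (\<Oplus>R\<in>poset_intervals. v R \<otimes> coef K a R S x)"
proof -
  \<comment> \<open>\<open>w F\<close> keeps the coordinates of \<open>v\<close> in \<open>F\<close>
    only. The induction on \<open>F\<close> adds one multiple of a unit vector at a time until
    \<open>v\<close> is reached.\<close>
  define w where "w F = (\<lambda>Q\<in>poset_intervals. if Q \<in> F then v Q else \<zero>)" for F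
  have vK: "v R \<in> carrier K" if "R \<in> poset_intervals" for R
    using gen_rep_carrierD(1)[OF v that] .
  have w: "w F \<in> carrier (rep_space (gen_rep K) x)" for F
    using v by (auto simp: gen_rep_carrier w_def)
  have hom: "a x \<in> lm_hom K (rep_space (gen_rep K) x) (rep_space (gen_rep K) x)"
    using rep_homD(1) a by (metis interval_alg_simps(1))
  have "F \<subseteq> poset_intervals \<Longrightarrow> a x (w F) S = (\<Oplus>R\<in>F. v R \<otimes> coef K a R S x)" for F
  proof (induction F rule: infinite_finite_induct)
    case empty
    have "w {} = \<zero>\<^bsub>rep_space (gen_rep K) x\<^esub>" by (auto simp: w_def gen_rep_ops)
    then have "a x (w {}) = \<zero>\<^bsub>rep_space (gen_rep K) x\<^esub>"
      by (simp only: lm_hom_zero[OF gen_rep_module gen_rep_module hom])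
    then show ?case using S by (simp add: gen_rep_ops)
  next
    case (insert R F)
    have R: "R \<in> poset_intervals" using insert by auto
    have un: "v R \<odot>\<^bsub>rep_space (gen_rep K) x\<^esub> unit_vec K x R \<in> carrier (rep_space (gen_rep K) x)"
      by (intro left_module.smult_closed[OF gen_rep_module] vK[OF R] unit_vec_carrier)
    have "w (insert R F) = (v R \<odot>\<^bsub>rep_space (gen_rep K) x\<^esub> unit_vec K x R) \<oplus>\<^bsub>rep_space (gen_rep K) x\<^esub> w F"
      using insert(2) v R vK by (auto intro!: restrict_ext
        simp: w_def gen_rep_ops unit_vec_def gen_rep_carrier split: if_splits)
    then have "a x (w (insert R F)) S = v R \<otimes> a x (unit_vec K x R) S \<oplus> a x (w F) S"
      using lm_homD(2)[OF hom un w] lm_homD(3)[OF hom vK[OF R] unit_vec_carrier] S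
      by (simp add: gen_rep_ops)
    also have "\<dots> = (\<Oplus>R\<in>insert R F. v R \<otimes> coef K a R S x)"
      using insert R vK a S by (subst finsum_insert) (auto simp: coef_apply_unit_vec)
    finally show ?case .
  qed simp
  moreover have "w poset_intervals = v"
    using v by (auto simp: w_def gen_rep_carrier intro!: extensionalityI[of _ poset_intervals])
  ultimately show ?thesis by auto
qed

lemma alg_eqI:
  fixes a b :: "('p::{finite, order}, 'k) alg_elem"
  assumes "a \<in> carrier (interval_alg K)" "b \<in> carrier (interval_alg K)"
    and "\<And>R S x. R \<in> poset_intervals \<Longrightarrow> S \<in> poset_intervals \<Longrightarrow> x \<in> R \<Longrightarrow> x \<in> S \<Longrightarrow>
      coef K a R S x = coef K b R S x"
  shows "a = b"
proof (rule rep_hom_eqI)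
  show "a \<in> rep_hom K (gen_rep K) (gen_rep K)" "b \<in> rep_hom K (gen_rep K) (gen_rep K)"
    using assms(1,2) by (auto simp: interval_alg_simps)
  fix x :: 'p and v assume v: "v \<in> carrier (rep_space (gen_rep K) x)"
  have eq: "coef K a R S x = coef K b R S x" for R S using assms(3) by (auto simp: coef_def)
  show "a x v = b x v"
    by (rule extensionalityI[of _ poset_intervals])
      (use alg_carrier[OF assms(1) v] alg_carrier[OF assms(2) v] in
        \<open>auto simp: gen_rep_carrier coef_apply[OF _ v] assms eq\<close>)
qed

lemma hom_fun_coef:
  fixes a :: "('p::{finite, order}, 'k) alg_elem"
  assumes "a \<in> carrier (interval_alg K)"
  shows "hom_fun K R S (coef K a R S)"
  unfolding hom_fun_def
proof (intro conjI allI impI)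
  fix x y :: 'p assume xy: "x \<le> y \<and> x \<in> R \<and> y \<in> S"
  show "coef K a R S x = coef K a R S y"
  proof (cases "R \<in> poset_intervals \<and> S \<in> poset_intervals")
    case True
    have a: "a \<in> rep_hom K (gen_rep K) (gen_rep K)" using assms by (simp add: interval_alg_simps)
    \<comment> \<open>For \<open>y\<close> outside \<open>R\<close> both sides are zero. This is why
      naturality also forces a scalar at \<open>x\<close> to vanish when a larger point of
      \<open>S\<close> lies outside \<open>R\<close>.\<close>
    have "rep_map (gen_rep K) x y (unit_vec K x R) = unit_vec K y R"
      using xy by (auto simp: gen_rep_simps(2) unit_vec_def intro!: ext)
    then have "a y (unit_vec K y R) S = rep_map (gen_rep K) x y (a x (unit_vec K x R)) S"
      using rep_homD(3)[OF a, of x y "unit_vec K x R"] xy unit_vec_carrier[of x R] by simp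
    then show ?thesis
      using True xy alg_carrier[OF assms unit_vec_carrier[of x R]]
      by (auto simp: coef_apply_unit_vec[OF assms] gen_rep_simps(2)) (simp add: coef_def)
  qed (auto simp: coef_def)
next
  show "coef K a R S x = \<zero>" if "x \<notin> R \<inter> S" for x using that by (auto simp: coef_def)
qed (rule coef_closed[OF assms])

lemma matrix_funD:
  assumes "matrix_fun K c"
  shows "c R S x \<in> carrier K" "x \<notin> R \<or> x \<notin> S \<Longrightarrow> c R S x = \<zero>"
    "x \<le> y \<Longrightarrow> x \<in> R \<Longrightarrow> y \<in> S \<Longrightarrow> c R S x = c R S y"
    "R \<notin> poset_intervals \<Longrightarrow> c R S x = \<zero>" "S \<notin> poset_intervals \<Longrightarrow> c R S x = \<zero>"
proof -
  have "hom_fun K R S (c R S)" using assms by (simp add: matrix_fun_def)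
  then show "c R S x \<in> carrier K" "x \<notin> R \<or> x \<notin> S \<Longrightarrow> c R S x = \<zero>"
    "x \<le> y \<Longrightarrow> x \<in> R \<Longrightarrow> y \<in> S \<Longrightarrow> c R S x = c R S y"
    by (auto simp: hom_fun_def)
qed (use assms in \<open>auto simp: matrix_fun_def\<close>)

lemma alg_of_closed:
  fixes c :: "'p::{finite, order} set \<Rightarrow> 'p set \<Rightarrow> 'p \<Rightarrow> 'k"
  assumes "matrix_fun K c"
  shows "alg_of K c \<in> carrier (interval_alg K)"
proof -
  note c = matrix_funD[OF assms]
  have vK: "v R \<in> carrier K" "x \<notin> R \<Longrightarrow> v R = \<zero>"
    if "v \<in> carrier (rep_space (gen_rep K) x)" "R \<in> poset_intervals" for R v and x :: 'p
    using gen_rep_carrierD[OF that] .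
  have fs: "(\<Oplus>R\<in>poset_intervals. v R \<otimes> c R S x) \<in> carrier K"
    if "v \<in> carrier (rep_space (gen_rep K) x)" for v S and x y :: 'p
    using c(1) vK[OF that] by (intro finsum_closed) auto
  have z: "(\<Oplus>R\<in>poset_intervals. v R \<otimes> c R S x) = \<zero>"
    if "v \<in> carrier (rep_space (gen_rep K) y)" "x \<notin> S" for v S and x y :: 'p
    using vK[OF that(1)] c(2)[of x _ S] that(2) by (intro add.finprod_one_eqI) auto
  have "alg_of K c x \<in> lm_hom K (rep_space (gen_rep K) x) (rep_space (gen_rep K) x)" for x
  proof (rule lm_homI)
    fix v assume v: "v \<in> carrier (rep_space (gen_rep K) x)"
    show "alg_of K c x v \<in> carrier (rep_space (gen_rep K) x)"
      using v fs[OF v] z[OF v] by (auto simp: alg_of_def gen_rep_carrier)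
    show "alg_of K c x (a \<odot>\<^bsub>rep_space (gen_rep K) x\<^esub> v) = a \<odot>\<^bsub>rep_space (gen_rep K) x\<^esub> alg_of K c x v"
      if a: "a \<in> carrier K" for a
    proof -
      have "(\<Oplus>R\<in>poset_intervals. (a \<otimes> v R) \<otimes> c R S x) = a \<otimes> (\<Oplus>R\<in>poset_intervals. v R \<otimes> c R S x)" for S
      proof (subst finsum_rdistr)
        show "(\<Oplus>R\<in>poset_intervals. a \<otimes> v R \<otimes> c R S x) = (\<Oplus>i\<in>poset_intervals. a \<otimes> (v i \<otimes> c i S x))"
          by (rule finsum_cong') (use a c vK[OF v] in \<open>auto simp: m_assoc\<close>)
      qed (use a c vK[OF v] in auto)
      moreover have "(\<Oplus>R\<in>poset_intervals. (\<lambda>S\<in>poset_intervals. a \<otimes> v S) R \<otimes> c R S x) =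
          (\<Oplus>R\<in>poset_intervals. (a \<otimes> v R) \<otimes> c R S x)" for S
        by (rule finsum_cong') (use a c vK[OF v] in auto)
      moreover have "(\<lambda>S\<in>poset_intervals. a \<otimes> v S) \<in> carrier (rep_space (gen_rep K) x)"
        using left_module.smult_closed[OF gen_rep_module a v] by (simp add: gen_rep_ops)
      ultimately show ?thesis
        using v by (auto intro!: restrict_ext simp: gen_rep_ops alg_of_def)
    qed
    fix w assume w: "w \<in> carrier (rep_space (gen_rep K) x)"
    show "alg_of K c x (v \<oplus>\<^bsub>rep_space (gen_rep K) x\<^esub> w) =
       alg_of K c x v \<oplus>\<^bsub>rep_space (gen_rep K) x\<^esub> alg_of K c x w"
    proof -
      have "(\<Oplus>R\<in>poset_intervals. (\<lambda>S\<in>poset_intervals. v S \<oplus> w S) R \<otimes> c R S x) =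
          (\<Oplus>R\<in>poset_intervals. v R \<otimes> c R S x \<oplus> w R \<otimes> c R S x)" for S
        by (rule finsum_cong') (use c vK[OF v] vK[OF w] in \<open>auto simp: l_distr\<close>)
      also have "\<dots> S = (\<Oplus>R\<in>poset_intervals. v R \<otimes> c R S x) \<oplus> (\<Oplus>R\<in>poset_intervals. w R \<otimes> c R S x)" for S
        by (rule finsum_addf) (use c vK[OF v] vK[OF w] in auto)
      finally have "(\<Oplus>R\<in>poset_intervals. (\<lambda>S\<in>poset_intervals. v S \<oplus> w S) R \<otimes> c R S x) =
        (\<Oplus>R\<in>poset_intervals. v R \<otimes> c R S x) \<oplus> (\<Oplus>R\<in>poset_intervals. w R \<otimes> c R S x)" for S .
      moreover have "(\<lambda>S\<in>poset_intervals. v S \<oplus> w S) \<in> carrier (rep_space (gen_rep K) x)"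
        using abelian_monoid.a_closed[OF _ v w] left_module.axioms(2)[OF gen_rep_module[of x]]
        by (simp add: gen_rep_ops abelian_group_def)
      ultimately show ?thesis
        using v w by (auto intro!: restrict_ext simp: gen_rep_ops alg_of_def)
    qed
  qed
  \<comment> \<open>For \<open>y\<close> in \<open>S\<close> the third clause of
    \<open>hom_fun\<close> replaces \<open>c R S y\<close> by \<open>c R S x\<close> when
    \<open>x\<close> lies in \<open>R\<close>; for other \<open>R\<close> the coordinate
    \<open>v R\<close> is zero. If \<open>y\<close> lies outside \<open>R\<close>, both scalars are
    zero. For \<open>y\<close> outside \<open>S\<close> every entry at \<open>y\<close>
    vanishes.\<close>
  moreover have "alg_of K c y (rep_map (gen_rep K) x y v) = rep_map (gen_rep K) x y (alg_of K c x v)"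
    if xy: "x \<le> y" and v: "v \<in> carrier (rep_space (gen_rep K) x)" for x y v
  proof -
    have "(\<Oplus>R\<in>poset_intervals. (\<lambda>S\<in>poset_intervals. if x \<in> S \<and> y \<in> S then v S else \<zero>) R \<otimes> c R S y) =
      (if x \<in> S \<and> y \<in> S then \<Oplus>R\<in>poset_intervals. v R \<otimes> c R S x else \<zero>)" for S
    proof (cases "y \<in> S")
      case True
      have "(\<Oplus>R\<in>poset_intervals. (\<lambda>S\<in>poset_intervals. if x \<in> S \<and> y \<in> S then v S else \<zero>) R \<otimes> c R S y) =
        (\<Oplus>R\<in>poset_intervals. v R \<otimes> c R S x)"
      proof (rule finsum_cong')
        fix R :: "'p set" assume R: "R \<in> poset_intervals"
        show "(\<lambda>S\<in>poset_intervals. if x \<in> S \<and> y \<in> S then v S else \<zero>) R \<otimes> c R S y = v R \<otimes> c R S x"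
        proof (cases "x \<in> R")
          case T: True
          then have "c R S x = c R S y" using xy True by (intro c(3))
          then show ?thesis using R T c(1) c(2)[of y R S] vK[OF v R] by auto
        qed (use R c(1) vK[OF v R] in auto)
      qed (use c(1) vK[OF v] in auto)
      then show ?thesis using True z[OF v, of x S] by auto
    next
      case False
      then show ?thesis using c(2)[of y _ S] v by (auto intro!: add.finprod_one_eqI simp: vK[OF v])
    qed
    moreover have "(\<lambda>S\<in>poset_intervals. if x \<in> S \<and> y \<in> S then v S else \<zero>) \<in> carrier (rep_space (gen_rep K) y)"
      using v by (auto simp: gen_rep_carrier)
    ultimately show ?thesis
      using v by (auto intro!: restrict_ext simp: gen_rep_simps(2) alg_of_def)
  qed
  ultimately show ?thesis
    unfolding interval_alg_simps rep_hom_def by (auto simp: alg_of_def)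
qed

lemma coef_alg_of:
  fixes c :: "'p::{finite, order} set \<Rightarrow> 'p set \<Rightarrow> 'p \<Rightarrow> 'k"
  assumes "matrix_fun K c"
  shows "coef K (alg_of K c) R S x = c R S x"
proof (cases "R \<in> poset_intervals \<and> S \<in> poset_intervals \<and> x \<in> R \<and> x \<in> S")
  case True
  note c = matrix_funD[OF assms]
  have "alg_of K c x (unit_vec K x R) S = (\<Oplus>Q\<in>poset_intervals. unit_vec K x R Q \<otimes> c Q S x)"
    using True unit_vec_carrier[of x R] by (simp add: alg_of_def)
  also have "\<dots> = (\<Oplus>Q\<in>poset_intervals. if Q = R then c Q S x else \<zero>)"
    by (rule finsum_cong') (use True c(1) in \<open>auto simp: unit_vec_def\<close>)
  also have "\<dots> = c R S x" using True c(1) by (subst finsum_delta) auto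
  finally show ?thesis using True by (simp add: coef_def)
next
  case False
  then show ?thesis using matrix_funD[OF assms] by (auto simp: coef_def)
qed

text \<open>Multiplication is that of the opposite ring, so \<open>a\<close> acts first and the
  product of scalars follows the path from \<open>R\<close> over \<open>Q\<close> to
  \<open>S\<close> from left to right.\<close>

lemma coef_mult:
  fixes a b :: "('p::{finite, order}, 'k) alg_elem"
  assumes "a \<in> carrier (interval_alg K)" "b \<in> carrier (interval_alg K)"
  shows "coef K (a \<otimes>\<^bsub>interval_alg K\<^esub> b) R S x = (\<Oplus>Q\<in>poset_intervals. coef K a R Q x \<otimes> coef K b Q S x)"
proof (cases "R \<in> poset_intervals \<and> S \<in> poset_intervals \<and> x \<in> R \<and> x \<in> S")
  case True
  have "coef K (a \<otimes>\<^bsub>interval_alg K\<^esub> b) R S x = b x (a x (unit_vec K x R)) S"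
    using True unit_vec_carrier[of x R]
    by (simp add: coef_def interval_alg_simps rep_comp_def compose_def)
  also have "\<dots> = (\<Oplus>Q\<in>poset_intervals. a x (unit_vec K x R) Q \<otimes> coef K b Q S x)"
    by (rule coef_apply[OF assms(2) alg_carrier[OF assms(1) unit_vec_carrier]]) (use True in auto)
  also have "\<dots> = (\<Oplus>Q\<in>poset_intervals. coef K a R Q x \<otimes> coef K b Q S x)"
    by (rule finsum_cong') (use True assms in \<open>auto simp: coef_apply_unit_vec\<close>)
  finally show ?thesis .
next
  case False
  then have *: "coef K a R Q x \<otimes> coef K b Q S x = \<zero>" for Q
    using assms coef_closed[OF assms(1), of R Q x] coef_closed[OF assms(2), of Q S x]
    by (cases "R \<in> poset_intervals \<and> x \<in> R") (auto simp: coef_def[of K a R Q x] coef_def[of K b Q S x]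
      simp del: coef_closed)
  then show ?thesis using False by (auto simp: coef_def[of K "a \<otimes>\<^bsub>interval_alg K\<^esub> b"] *)
qed

lemma coef_add:
  fixes a b :: "('p::{finite, order}, 'k) alg_elem"
  assumes "a \<in> carrier (interval_alg K)" "b \<in> carrier (interval_alg K)"
  shows "coef K (a \<oplus>\<^bsub>interval_alg K\<^esub> b) R S x = coef K a R S x \<oplus> coef K b R S x"
  using unit_vec_carrier[of x R] by (auto simp: coef_def interval_alg_simps)

lemma coef_zero [simp]: "coef K \<zero>\<^bsub>interval_alg K\<^esub> R S x = \<zero>"
  using unit_vec_carrier[of x R] by (auto simp: coef_def interval_alg_simps)

lemma coef_finsum:
  fixes f :: "'i \<Rightarrow> ('p::{finite, order}, 'k) alg_elem"
  assumes "f \<in> A \<rightarrow> carrier (interval_alg K)"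
  shows "coef K (finsum (interval_alg K) f A) R S x = (\<Oplus>a\<in>A. coef K (f a) R S x)"
proof -
  interpret L: ring "interval_alg K" by (rule ring_interval_alg)
  show ?thesis
    by (rule finsum_additive[OF L.is_abelian_group is_abelian_group]) (use assms in \<open>auto simp: coef_add\<close>)
qed

section \<open>Inclusions, idempotents and the projective modules\<close>

lemma incl_elem_eq:
  fixes C D :: "'p::{finite, order} set"
  assumes "C \<in> poset_intervals" "D \<in> poset_intervals" "C \<subseteq> D"
  shows "incl_elem K C D = alg_of K (\<lambda>R S x. if R = C \<and> S = D \<and> x \<in> C then \<one> else \<zero>)"
proof
  fix x
  let ?c = "\<lambda>R S x. if R = C \<and> S = D \<and> x \<in> C then \<one> else \<zero>"
  have "incl_elem K C D x v = (\<lambda>S\<in>poset_intervals. \<Oplus>R\<in>poset_intervals. v R \<otimes> ?c R S x)"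
    if v: "v \<in> carrier (rep_space (gen_rep K) x)" for v
  proof -
    have vK: "v R \<in> carrier K" "x \<notin> R \<Longrightarrow> v R = \<zero>" if "R \<in> poset_intervals" for R
      using gen_rep_carrierD[OF v that] .
    have "(\<Oplus>R\<in>poset_intervals. v R \<otimes> ?c R S x) = (if S = D \<and> x \<in> C then v C else \<zero>)" for S
    proof (cases "S = D \<and> x \<in> C")
      case True
      have "(\<Oplus>R\<in>poset_intervals. v R \<otimes> ?c R S x) = (\<Oplus>R\<in>poset_intervals. if R = C then v R else \<zero>)"
        by (rule finsum_cong') (use vK True in auto)
      also have "\<dots> = v C" using vK assms by (subst finsum_delta) auto
      finally show ?thesis using True by simp
    next
      case False
      then show ?thesis using vK by (auto intro!: add.finprod_one_eqI)
    qed
    moreover have "v \<in> carrier (rep_space (rep_dsum poset_intervals (interval_rep K)) x)"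
      using v by (simp add: gen_rep_def)
    ultimately show ?thesis
      using v assms vK(1)[OF assms(1)] vK(2)[OF assms(1)]
      by (auto intro!: restrict_ext simp: alg_elem_of_def rep_comp_def compose_def interval_incl_def
        rep_proj_def rep_incl_def lm_incl_def interval_space_simps)
  qed
  then show "incl_elem K C D x = alg_of K ?c x"
    by (auto intro!: extensionalityI[of _ "carrier (rep_space (gen_rep K) x)"]
      simp: alg_of_def alg_elem_of_def rep_comp_def)
qed

lemma matrix_fun_incl:
  assumes "C \<in> poset_intervals" "D \<in> poset_intervals" "relative_upset C D"
  shows "matrix_fun K (\<lambda>R S x. if R = C \<and> S = D \<and> x \<in> C then \<one> else \<zero>)"
  using assms unfolding matrix_fun_def hom_fun_def relative_upset_def by auto

lemma incl_elem_closed: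
  fixes C D :: "'p::{finite, order} set"
  assumes "C \<in> upset_intervals D" "D \<in> poset_intervals"
  shows "incl_elem K C D \<in> carrier (interval_alg K)"
    "coef K (incl_elem K C D) R S x = (if R = C \<and> S = D \<and> x \<in> C then \<one> else \<zero>)"
  using assms incl_elem_eq[of C D] matrix_fun_incl[of C D]
  by (auto simp: upset_intervals_def relative_upset_def alg_of_closed coef_alg_of)

lemma self_upset_interval: "C \<in> poset_intervals \<Longrightarrow> C \<in> upset_intervals C"
  by (auto simp: upset_intervals_def relative_upset_def)

text \<open>Idempotents become a special case of inclusions, so the multiplication rules below cover
  both.\<close>

lemma alg_idem_eq: "alg_idem K C = incl_elem K C C"
proof -
  have "rep_id (interval_rep K C) = interval_incl K C C"
    by (auto simp: rep_id_def interval_incl_def interval_space_simps intro!: ext)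
  then show ?thesis by (simp add: alg_idem_def)
qed

text \<open>Right multiplication is post-composition: the target \<open>C\<close> is renamed to
  \<open>D\<close> and the scalars are kept. The rule for left multiplication is dual and restricts
  the source from \<open>D\<close> to \<open>C\<close>.\<close>

lemma coef_mult_incl:
  fixes a :: "('p::{finite, order}, 'k) alg_elem"
  assumes "a \<in> carrier (interval_alg K)" "C \<in> upset_intervals D" "D \<in> poset_intervals"
  shows "coef K (a \<otimes>\<^bsub>interval_alg K\<^esub> incl_elem K C D) R S x = (if S = D \<and> x \<in> C then coef K a R C x else \<zero>)"
proof -
  have C: "C \<in> poset_intervals" using assms by (auto simp: upset_intervals_def)
  have "coef K (a \<otimes>\<^bsub>interval_alg K\<^esub> incl_elem K C D) R S x =
    (\<Oplus>Q\<in>poset_intervals. if Q = C then if S = D \<and> x \<in> C then coef K a R Q x else \<zero> else \<zero>)"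
    unfolding coef_mult[OF assms(1) incl_elem_closed(1)[OF assms(2,3)]]
    by (rule finsum_cong') (use assms in \<open>auto simp: incl_elem_closed(2)\<close>)
  also have "\<dots> = (if S = D \<and> x \<in> C then coef K a R C x else \<zero>)"
    using C assms by (subst finsum_delta) auto
  finally show ?thesis .
qed

lemma coef_incl_mult:
  fixes a :: "('p::{finite, order}, 'k) alg_elem"
  assumes "a \<in> carrier (interval_alg K)" "C \<in> upset_intervals D" "D \<in> poset_intervals"
  shows "coef K (incl_elem K C D \<otimes>\<^bsub>interval_alg K\<^esub> a) R S x = (if R = C \<and> x \<in> C then coef K a D S x else \<zero>)"
proof -
  have "coef K (incl_elem K C D \<otimes>\<^bsub>interval_alg K\<^esub> a) R S x =
    (\<Oplus>Q\<in>poset_intervals. if Q = D then if R = C \<and> x \<in> C then coef K a Q S x else \<zero> else \<zero>)"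
    unfolding coef_mult[OF incl_elem_closed(1)[OF assms(2,3)] assms(1)]
    by (rule finsum_cong') (use assms in \<open>auto simp: incl_elem_closed(2)\<close>)
  also have "\<dots> = (if R = C \<and> x \<in> C then coef K a D S x else \<zero>)"
    using assms by (subst finsum_delta) auto
  finally show ?thesis .
qed

lemma alg_idem:
  fixes C :: "'p::{finite, order} set"
  assumes "C \<in> poset_intervals"
  shows "alg_idem K C \<in> carrier (interval_alg K)"
    "alg_idem K C \<otimes>\<^bsub>interval_alg K\<^esub> alg_idem K C = alg_idem K C"
proof -
  interpret L: ring "interval_alg K" by (rule ring_interval_alg)
  note up = self_upset_interval[OF assms]
  show 1: "alg_idem K C \<in> carrier (interval_alg K)"
    using incl_elem_closed(1)[OF up assms] by (simp add: alg_idem_eq)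
  show "alg_idem K C \<otimes>\<^bsub>interval_alg K\<^esub> alg_idem K C = alg_idem K C"
    by (rule alg_eqI) (use 1 in \<open>auto simp: alg_idem_eq coef_mult_incl[OF _ up assms]
       incl_elem_closed(2)[OF up assms]\<close>)
qed

lemma proj_mod_simps [simp]:
  "add (proj_mod K S) = add (interval_alg K)" "zero (proj_mod K S) = zero (interval_alg K)"
  "smult (proj_mod K S) = mult (interval_alg K)"
  by (simp_all add: proj_mod_def)

text \<open>Right multiplication by \<open>alg_idem K C\<close> erases all entries whose target
  differs from \<open>C\<close> and leaves the others unchanged.\<close>

lemma proj_mod_carrier:
  fixes C :: "'p::{finite, order} set"
  assumes "C \<in> poset_intervals"
  shows "a \<in> carrier (proj_mod K C) \<longleftrightarrow>
    a \<in> carrier (interval_alg K) \<and> (\<forall>R S x. S \<noteq> C \<longrightarrow> coef K a R S x = \<zero>)"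
proof -
  interpret L: ring "interval_alg K" by (rule ring_interval_alg)
  note up = self_upset_interval[OF assms]
  have "a = a \<otimes>\<^bsub>interval_alg K\<^esub> alg_idem K C"
    if "a \<in> carrier (interval_alg K)" "\<forall>R S x. S \<noteq> C \<longrightarrow> coef K a R S x = \<zero>"
    by (rule alg_eqI) (use that alg_idem[OF assms] in \<open>auto simp: alg_idem_eq coef_mult_incl[OF _ up assms]\<close>)
  moreover have "coef K (b \<otimes>\<^bsub>interval_alg K\<^esub> alg_idem K C) R S x = \<zero>"
    if "S \<noteq> C" "b \<in> carrier (interval_alg K)" for R S x b
    using that by (simp add: alg_idem_eq coef_mult_incl[OF _ up assms])
  ultimately show ?thesis
    using alg_idem[OF assms] unfolding proj_mod_def lm_restrict_simps mem_Collect_eq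
    by (metis L.m_closed)
qed

lemma left_module_proj_mod:
  fixes C :: "'p::{finite, order} set"
  assumes "C \<in> poset_intervals"
  shows "left_module (interval_alg K) (proj_mod K C)"
  unfolding proj_mod_def
  by (rule ring.left_module_principal[OF ring_interval_alg alg_idem(1)[OF assms]])

lemma proj_push_eq: "proj_push K C D (interval_incl K C D) y = y \<otimes>\<^bsub>interval_alg K\<^esub> incl_elem K C D"
  by (simp add: proj_push_def interval_alg_simps)

lemma proj_push_hom:
  fixes C D :: "'p::{finite, order} set"
  assumes "C \<in> upset_intervals D" "D \<in> poset_intervals"
  shows "proj_push K C D (interval_incl K C D) \<in> lm_hom (interval_alg K) (proj_mod K C) (proj_mod K D)"
proof -
  interpret L: ring "interval_alg K" by (rule ring_interval_alg)
  have C: "C \<in> poset_intervals" using assms by (auto simp: upset_intervals_def)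
  show ?thesis
    by (rule lm_homI) (use incl_elem_closed(1)[OF assms] in \<open>auto simp: proj_push_eq proj_mod_carrier[OF C]
      proj_mod_carrier[OF assms(2)] coef_mult_incl[OF _ assms] L.l_distr L.m_assoc\<close>)
qed

end

section \<open>Simple modules and the kernel of the standard projection\<close>

lemma poset_connected_closed:
  assumes "poset_connected S" "A \<subseteq> S" "x \<in> A"
    and "\<And>y z. y \<in> A \<Longrightarrow> z \<in> S \<Longrightarrow> y \<le> z \<or> z \<le> y \<Longrightarrow> z \<in> A"
  shows "A = S"
proof -
  have "z \<in> A" if "z \<in> S" for z
  proof -
    have "(x, z) \<in> (comparability S)\<^sup>*" using assms that by (auto simp: poset_connected_def)
    then show "z \<in> A"
    proof (induction rule: rtrancl_induct)
      case (step y z)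
      then show ?case using assms(4)[of y z] by (auto simp: comparability_def)
    qed (rule assms(3))
  qed
  then show ?thesis using assms(2) by blast
qed

text \<open>Acts on the summand of \<open>R\<close> as the scalar \<open>c R\<close>. A constant
  family recovers the action of \<open>K\<close>; a family supported on one interval is a multiple
  of its idempotent.\<close>

definition diag_elem ::
  "('k, 'r) ring_scheme \<Rightarrow> ('p::order set \<Rightarrow> 'k) \<Rightarrow> ('p, 'k) alg_elem" where
  "diag_elem K c = alg_of K (\<lambda>R S x. if R = S \<and> R \<in> poset_intervals \<and> x \<in> R then c R else \<zero>\<^bsub>K\<^esub>)"

text \<open>All endomorphisms of an interval representation are scalars, so these are the elements
  whose component from \<open>S\<close> to \<open>S\<close> is not invertible.\<close>

definition proj_rad :: "('k, 'r) ring_scheme \<Rightarrow> 'p::order set \<Rightarrow> ('p, 'k) alg_elem set" where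
  "proj_rad K S = {a \<in> carrier (proj_mod K S). \<forall>x. coef K a S S x = \<zero>\<^bsub>K\<^esub>}"

text \<open>These are the \<open>R\<close> for which the constant scalar one on \<open>T\<close> is
  a morphism, that is, whose representation maps onto that of \<open>T\<close>.\<close>

definition contains_as_downset :: "'p::order set \<Rightarrow> 'p set \<Rightarrow> bool" where
  "contains_as_downset R T \<longleftrightarrow> T \<subseteq> R \<and> (\<forall>t\<in>T. \<forall>y\<in>R. y \<le> t \<longrightarrow> y \<in> T)"

text \<open>An explicit candidate for \<open>standard_kernel\<close>, in terms of the scalars
  alone.\<close>

definition standard_sub :: "('k, 'r) ring_scheme \<Rightarrow> 'p::order set \<Rightarrow> ('p, 'k) alg_elem set" where
  "standard_sub K T = {a \<in> carrier (proj_mod K T).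
     \<forall>R. contains_as_downset R T \<longrightarrow> (\<forall>x. coef K a R T x = \<zero>\<^bsub>K\<^esub>)}"

section \<open>Supports of morphisms and of their composites\<close>

context interval_field
begin

lemma hom_funD:
  assumes "hom_fun K R S \<phi>"
  shows "\<phi> x \<in> carrier K" "\<phi> x \<noteq> \<zero> \<Longrightarrow> x \<in> R" "\<phi> x \<noteq> \<zero> \<Longrightarrow> x \<in> S"
    "x \<le> y \<Longrightarrow> x \<in> R \<Longrightarrow> y \<in> S \<Longrightarrow> \<phi> x = \<phi> y"
  using assms by (auto simp: hom_fun_def)

lemma hom_fun_self_const:
  assumes "hom_fun K S S \<phi>" "poset_connected S" "x \<in> S" "y \<in> S"
  shows "\<phi> x = \<phi> y"
proof -
  have "{z \<in> S. \<phi> z = \<phi> x} = S"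
    by (rule poset_connected_closed[of _ _ x]) (use assms hom_funD(4)[OF assms(1)] in auto)
  then have "y \<in> {z \<in> S. \<phi> z = \<phi> x}" using assms(4) by simp
  then show ?thesis by simp
qed

text \<open>The set where both scalars are non-zero is closed under comparable points of
  \<open>S\<close>. Going up, the scalar of the second map persists first, which puts the new point
  in \<open>Q\<close>, and then that of the first map persists. Going down, the order is reversed,
  and \<open>S \<subseteq> R\<close> places the new point in \<open>R\<close>. Connectedness of
  \<open>S\<close> finishes the argument.\<close>

lemma hom_fun_comp_nonzero:
  assumes "hom_fun K R Q \<phi>" "hom_fun K Q S \<psi>" "poset_connected S" "S \<subseteq> R"
    and "\<phi> x \<noteq> \<zero>" "\<psi> x \<noteq> \<zero>" "y \<in> S"
  shows "\<phi> y \<noteq> \<zero>" "\<psi> y \<noteq> \<zero>"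
proof -
  note h = hom_funD[OF assms(1)] hom_funD[OF assms(2)]
  define N where "N = {y. \<phi> y \<noteq> \<zero> \<and> \<psi> y \<noteq> \<zero>}"
  have N: "N \<subseteq> R" "N \<subseteq> Q" "N \<subseteq> S" using h by (auto simp: N_def)
  have "N = S"
  proof (rule poset_connected_closed[of _ _ x])
    fix y z assume *: "y \<in> N" "z \<in> S" "y \<le> z \<or> z \<le> y"
    then have y: "y \<in> R" "y \<in> Q" "y \<in> S" "z \<in> R" using N assms(4) by auto
    show "z \<in> N"
    proof (cases "y \<le> z")
      case True
      then have "\<psi> z \<noteq> \<zero>" using h(8)[of y z] * y by (auto simp: N_def)
      then show ?thesis using h(6)[of z] h(4)[of y z] True y * by (auto simp: N_def)
    next
      case False
      then have z: "z \<le> y" using * by auto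
      then have "\<phi> z \<noteq> \<zero>" using h(4)[of z y] * y by (auto simp: N_def)
      then show ?thesis using h(3)[of z] h(8)[of z y] z y * by (auto simp: N_def)
    qed
  qed (use N assms in \<open>auto simp: N_def\<close>)
  then show "\<phi> y \<noteq> \<zero>" "\<psi> y \<noteq> \<zero>" using assms(7) by (auto simp: N_def)
qed

text \<open>Both composites are non-zero at \<open>x\<close>, hence on all of \<open>S\<close> and
  on all of \<open>Q\<close>, so each interval contains the other.\<close>

lemma hom_fun_iso:
  assumes \<phi>: "hom_fun K S Q \<phi>" and \<psi>: "hom_fun K Q S \<psi>" and "poset_connected S" "poset_connected Q"
    and "\<phi> x \<noteq> \<zero>" "\<psi> x \<noteq> \<zero>"
  shows "S = Q"
  using hom_fun_comp_nonzero(1)[OF \<phi> \<psi>] hom_fun_comp_nonzero(1)[OF \<psi> \<phi>]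
    hom_funD(3)[OF \<phi>] hom_funD(3)[OF \<psi>] assms by blast

lemma poset_intervalsD:
  assumes "S \<in> poset_intervals" shows "S \<noteq> {}" "poset_connected S" "poset_convex S"
  using assms by (auto simp: poset_intervals_def)

lemma diag_elem:
  fixes c :: "'p::{finite, order} set \<Rightarrow> 'k" and a :: "('p, 'k) alg_elem"
  assumes c: "\<And>R. c R \<in> carrier K"
  shows "diag_elem K c \<in> carrier (interval_alg K)"
    "coef K (diag_elem K c) R S x = (if R = S \<and> R \<in> poset_intervals \<and> x \<in> R then c R else \<zero>)"
    "a \<in> carrier (interval_alg K) \<Longrightarrow>
       coef K (diag_elem K c \<otimes>\<^bsub>interval_alg K\<^esub> a) R S x = c R \<otimes> coef K a R S x"
proof -
  have m: "matrix_fun K (\<lambda>R S x. if R = S \<and> R \<in> poset_intervals \<and> x \<in> R then c R else \<zero>)"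
    using c by (auto simp: matrix_fun_def hom_fun_def)
  show 1: "diag_elem K c \<in> carrier (interval_alg K)"
    unfolding diag_elem_def by (rule alg_of_closed[OF m])
  show 2: "coef K (diag_elem K c) R S x = (if R = S \<and> R \<in> poset_intervals \<and> x \<in> R then c R else \<zero>)" for S
    unfolding diag_elem_def by (rule coef_alg_of[OF m])
  assume a: "a \<in> carrier (interval_alg K)"
  show "coef K (diag_elem K c \<otimes>\<^bsub>interval_alg K\<^esub> a) R S x = c R \<otimes> coef K a R S x"
  proof (cases "R \<in> poset_intervals \<and> x \<in> R")
    case True
    have "coef K (diag_elem K c \<otimes>\<^bsub>interval_alg K\<^esub> a) R S x =
      (\<Oplus>Q\<in>poset_intervals. if Q = R then c Q \<otimes> coef K a Q S x else \<zero>)"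
      unfolding coef_mult[OF 1 a] by (rule finsum_cong') (use True c a 2 in auto)
    also have "\<dots> = c R \<otimes> coef K a R S x"
      using True c a by (subst finsum_delta) auto
    finally show ?thesis .
  next
    case False
    then show ?thesis using c by (auto simp: coef_def)
  qed
qed

section \<open>Locality of the projective modules and recognition of simple modules\<close>

lemma proj_carrierD:
  fixes S :: "'p::{finite, order} set"
  assumes "a \<in> carrier (proj_mod K S)" "S \<in> poset_intervals"
  shows "a \<in> carrier (interval_alg K)"
  using assms proj_mod_carrier by blast

lemma proj_eqI:
  fixes S :: "'p::{finite, order} set"
  assumes S: "S \<in> poset_intervals" and a: "a \<in> carrier (proj_mod K S)" and b: "b \<in> carrier (proj_mod K S)"
    and eq: "\<And>R x. coef K a R S x = coef K b R S x"
  shows "a = b"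
proof (rule alg_eqI)
  show "a \<in> carrier (interval_alg K)" "b \<in> carrier (interval_alg K)"
    using a b S by (auto simp: proj_carrierD)
  show "coef K a R Q x = coef K b R Q x" for R Q x
    using a b eq by (cases "Q = S") (auto simp: proj_mod_carrier[OF S])
qed

lemma proj_mult_idem:
  fixes S :: "'p::{finite, order} set"
  assumes S: "S \<in> poset_intervals" and a: "a \<in> carrier (proj_mod K S)"
  shows "a \<otimes>\<^bsub>interval_alg K\<^esub> alg_idem K S = a"
proof -
  interpret L: ring "interval_alg K" by (rule ring_interval_alg)
  show ?thesis
    using a alg_idem[OF S] by (auto simp: proj_mod_def L.m_assoc)
qed

lemma alg_idem_proj:
  fixes S :: "'p::{finite, order} set"
  assumes S: "S \<in> poset_intervals" shows "alg_idem K S \<in> carrier (proj_mod K S)"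
  using alg_idem[OF S] by (force simp: proj_mod_def)

text \<open>In the entry of a product from \<open>S\<close> to \<open>S\<close>, a non-zero term
  through \<open>Q\<close> forces \<open>Q = S\<close> by \<open>hom_fun_iso\<close>; but the second
  factor then has a vanishing entry.\<close>

lemma proj_rad_submodule:
  fixes S :: "'p::{finite, order} set"
  assumes S: "S \<in> poset_intervals"
  shows "submodule (proj_rad K S) (interval_alg K) (proj_mod K S)"
proof -
  interpret P: left_module "interval_alg K" "proj_mod K S" by (rule left_module_proj_mod[OF S])
  show ?thesis
  proof (rule P.submoduleI')
    show "\<zero>\<^bsub>proj_mod K S\<^esub> \<in> proj_rad K S"
      using P.M.zero_closed by (auto simp: proj_rad_def simp del: P.M.zero_closed)
    show "a \<oplus>\<^bsub>proj_mod K S\<^esub> b \<in> proj_rad K S" if "a \<in> proj_rad K S" "b \<in> proj_rad K S" for a b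
      using that P.M.a_closed[of a b] S by (auto simp: proj_rad_def coef_add proj_carrierD)
    show "b \<odot>\<^bsub>proj_mod K S\<^esub> a \<in> proj_rad K S" if b: "b \<in> carrier (interval_alg K)" and a: "a \<in> proj_rad K S" for a b
    proof -
      have a': "a \<in> carrier (proj_mod K S)" "a \<in> carrier (interval_alg K)" "\<And>x. coef K a S S x = \<zero>"
        using a S by (auto simp: proj_rad_def proj_carrierD)
      have "coef K b S Q x \<otimes> coef K a Q S x = \<zero>" if Q: "Q \<in> poset_intervals" for Q x
      proof (rule ccontr)
        assume "coef K b S Q x \<otimes> coef K a Q S x \<noteq> \<zero>"
        then have "coef K b S Q x \<noteq> \<zero>" "coef K a Q S x \<noteq> \<zero>" using a' b by auto
        then have "S = Q"
          using hom_fun_iso[OF hom_fun_coef[OF b] hom_fun_coef[OF a'(2)]] poset_intervalsD S Q by blast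
        then show False using a'(3) \<open>coef K a Q S x \<noteq> \<zero>\<close> by simp
      qed
      then have "coef K (b \<otimes>\<^bsub>interval_alg K\<^esub> a) S S x = \<zero>" for x
        unfolding coef_mult[OF b a'(2)] by (intro add.finprod_one_eqI) auto
      then show ?thesis using P.smult_closed[OF b a'(1)] by (simp add: proj_rad_def)
    qed
  qed (auto simp: proj_rad_def)
qed

lemma proj_rad_proper:
  fixes S :: "'p::{finite, order} set"
  assumes S: "S \<in> poset_intervals" shows "proj_rad K S \<noteq> carrier (proj_mod K S)"
proof -
  obtain x where x: "x \<in> S" using poset_intervalsD(1)[OF S] by auto
  have "coef K (alg_idem K S) S S x = \<one>"
    using x by (simp add: alg_idem_eq incl_elem_closed(2)[OF self_upset_interval[OF S] S])
  then have "alg_idem K S \<notin> proj_rad K S" by (auto simp: proj_rad_def intro!: exI[of _ x])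
  then show ?thesis using alg_idem_proj[OF S] by auto
qed

text \<open>An element outside \<open>proj_rad K S\<close> has a constant non-zero scalar
  \<open>k\<close> as its component from \<open>S\<close> to \<open>S\<close>. Rescaling this
  component by \<open>inv k\<close> and erasing all other sources yields
  \<open>alg_idem K S\<close>, which generates the module.\<close>

lemma proj_rad_local:
  fixes S :: "'p::{finite, order} set"
  assumes S: "S \<in> poset_intervals" and L: "submodule L (interval_alg K) (proj_mod K S)"
    and ne: "L \<noteq> carrier (proj_mod K S)"
  shows "L \<subseteq> proj_rad K S"
proof (rule ccontr)
  interpret A: ring "interval_alg K" by (rule ring_interval_alg)
  interpret P: left_module "interval_alg K" "proj_mod K S" by (rule left_module_proj_mod[OF S])
  note L' = P.submoduleD[OF L]
  assume "\<not> L \<subseteq> proj_rad K S"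
  then obtain a x where a: "a \<in> L" "coef K a S S x \<noteq> \<zero>" using L' by (auto simp: proj_rad_def)
  then have aP: "a \<in> carrier (proj_mod K S)" "a \<in> carrier (interval_alg K)"
    using L' S by (auto simp: proj_carrierD)
  define k where "k = coef K a S S x"
  have h: "hom_fun K S S (coef K a S S)" by (rule hom_fun_coef[OF aP(2)])
  have x: "x \<in> S" using hom_funD(2)[OF h a(2)] .
  have k: "k \<in> carrier K" "k \<noteq> \<zero>" using a aP by (auto simp: k_def)
  then have ik: "inv k \<in> carrier K" "inv k \<otimes> k = \<one>" by (auto simp: field_Units)
  have kk: "coef K a S S y = k" if "y \<in> S" for y
    unfolding k_def by (rule hom_fun_self_const[OF h poset_intervalsD(2)[OF S] that x])
  let ?c = "\<lambda>R. if R = S then inv k else \<zero>"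
  have c: "?c R \<in> carrier K" for R using ik by auto
  note d = diag_elem[where c = ?c, OF c]
  have "diag_elem K ?c \<otimes>\<^bsub>interval_alg K\<^esub> a = alg_idem K S"
  proof (rule alg_eqI)
    show "diag_elem K ?c \<otimes>\<^bsub>interval_alg K\<^esub> a \<in> carrier (interval_alg K)"
      using d(1) aP by simp
    show "alg_idem K S \<in> carrier (interval_alg K)" using alg_idem[OF S] by simp
    fix R Q y
    show "coef K (diag_elem K ?c \<otimes>\<^bsub>interval_alg K\<^esub> a) R Q y = coef K (alg_idem K S) R Q y"
    proof (cases "R = S \<and> Q = S")
      case True
      then show ?thesis using kk[of y] ik hom_funD(2)[OF h, of y]
        by (cases "coef K a S S y = \<zero>")
          (auto simp: d(3)[OF aP(2)] alg_idem_eq incl_elem_closed(2)[OF self_upset_interval[OF S] S])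
    next
      case False
      then have "Q \<noteq> S \<Longrightarrow> coef K a R Q y = \<zero>" using aP(1) by (auto simp: proj_mod_carrier[OF S])
      then show ?thesis using False ik aP(2)
        by (cases "Q = S") (auto simp: d(3)[OF aP(2)] alg_idem_eq incl_elem_closed(2)[OF self_upset_interval[OF S] S])
    qed
  qed
  then have e: "alg_idem K S \<in> L"
    using L'(4)[OF d(1) a(1)] by simp
  have "p \<in> L" if "p \<in> carrier (proj_mod K S)" for p
    using L'(4)[OF _ e, of p] proj_mult_idem[OF S that] proj_carrierD[OF that S] by simp
  then show False using ne L'(1) by blast
qed

lemma lm_rad_proj:
  fixes S :: "'p::{finite, order} set"
  assumes S: "S \<in> poset_intervals"
  shows "lm_rad (interval_alg K) (proj_mod K S) = proj_rad K S"
  by (rule lm_rad_local[OF proj_rad_submodule[OF S] proj_rad_proper[OF S] proj_rad_local[OF S]])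
    (auto simp: proj_rad_def)

text \<open>Acting on \<open>x\<close> gives a homomorphism out of \<open>proj_mod K R\<close> that
  is non-zero at the idempotent, and the projective is local.\<close>

lemma simple_iso_simple_mod:
  fixes R :: "'p::{finite, order} set"
  assumes X: "simple_lm (interval_alg K) X" and R: "R \<in> poset_intervals"
    and x: "x \<in> carrier X" "alg_idem K R \<odot>\<^bsub>X\<^esub> x \<noteq> \<zero>\<^bsub>X\<^esub>"
  shows "lm_isomorphic (interval_alg K) X (simple_mod K R)"
proof -
  interpret X: left_module "interval_alg K" X using X by (simp add: simple_lm_def)
  define g where "g a = a \<odot>\<^bsub>X\<^esub> x" for a
  have g: "g \<in> lm_hom (interval_alg K) (proj_mod K R) X"
    by (rule lm_homI)
      (use x proj_carrierD[OF _ R] in \<open>auto simp: g_def X.smult_l_distr X.smult_assoc1\<close>)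
  have "g (alg_idem K R) \<noteq> \<zero>\<^bsub>X\<^esub>" using x(2) by (simp add: g_def)
  then have "lm_isomorphic (interval_alg K) X (lm_quot (proj_mod K R) (proj_rad K R))"
    by (intro simple_lm_isomorphic[OF left_module_proj_mod[OF R] X g alg_idem_proj[OF R]]
      proj_rad_submodule[OF R] proj_rad_proper[OF R] proj_rad_local[OF R])
  then show ?thesis by (simp add: simple_mod_def lm_rad_proj[OF R])
qed

lemma one_eq_sum_idem:
  "\<one>\<^bsub>interval_alg K\<^esub> = (\<Oplus>\<^bsub>interval_alg K\<^esub>R\<in>(poset_intervals :: 'p::{finite, order} set set). alg_idem K R)"
proof -
  interpret A: ring "interval_alg K :: ('p, 'k) alg_elem ring" by (rule ring_interval_alg)
  have e: "(alg_idem K :: 'p set \<Rightarrow> _) \<in> poset_intervals \<rightarrow> carrier (interval_alg K)" using alg_idem(1) by auto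
  have "(\<Oplus>\<^bsub>interval_alg K\<^esub>R\<in>(poset_intervals :: 'p set set). alg_idem K R) = diag_elem K (\<lambda>R. \<one>)"
  proof (rule alg_eqI)
    show "(\<Oplus>\<^bsub>interval_alg K\<^esub>R\<in>(poset_intervals :: 'p set set). alg_idem K R) \<in> carrier (interval_alg K)"
      using e by (rule A.finsum_closed)
    fix R S :: "'p set" and x assume *: "R \<in> poset_intervals" "x \<in> R"
    have "coef K (\<Oplus>\<^bsub>interval_alg K\<^esub>R\<in>(poset_intervals :: 'p set set). alg_idem K R) R S x =
      (\<Oplus>Q\<in>(poset_intervals :: 'p set set). if Q = R then if Q = S then \<one> else \<zero> else \<zero>)"
      unfolding coef_finsum[OF e]
      by (rule finsum_cong')
        (use * in \<open>auto simp: alg_idem_eq incl_elem_closed(2)[OF self_upset_interval]\<close>)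
    then show "coef K (\<Oplus>\<^bsub>interval_alg K\<^esub>R\<in>(poset_intervals :: 'p set set). alg_idem K R) R S x =
      coef K (diag_elem K (\<lambda>R. \<one>)) R S x"
      using * by (simp add: finsum_delta diag_elem(2))
  qed (simp add: diag_elem(1))
  also have "\<dots> = \<one>\<^bsub>interval_alg K\<^esub>"
  proof -
    have d: "diag_elem K (\<lambda>R. \<one>) \<in> carrier (interval_alg K :: ('p, 'k) alg_elem ring)"
      by (rule diag_elem(1)) auto
    \<comment> \<open>The coefficients of the identity need not be computed: a left multiplication
      that fixes the identity can only be by the identity.\<close>
    have "diag_elem K (\<lambda>R. \<one>) \<otimes>\<^bsub>interval_alg K\<^esub> \<one>\<^bsub>interval_alg K\<^esub> = (\<one>\<^bsub>interval_alg K\<^esub> :: ('p, 'k) alg_elem)"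
    proof (rule alg_eqI)
      show "coef K (diag_elem K (\<lambda>R. \<one>) \<otimes>\<^bsub>interval_alg K\<^esub> \<one>\<^bsub>interval_alg K\<^esub>) R S x =
        coef K (\<one>\<^bsub>interval_alg K\<^esub> :: ('p, 'k) alg_elem) R S x" for R S :: "'p set" and x
        by (subst diag_elem(3)) auto
    qed (use d in auto)
    then show ?thesis using d by simp
  qed
  finally show ?thesis by simp
qed

text \<open>The identity is the sum of the idempotents, so they cannot all annihilate a non-zero
  \<open>x\<close>.\<close>

lemma simple_iso_some:
  fixes X :: "(('p::{finite, order}, 'k) alg_elem, 'b) module"
  assumes X: "simple_lm (interval_alg K) X"
  obtains R x where "R \<in> poset_intervals" "x \<in> carrier X" "alg_idem K R \<odot>\<^bsub>X\<^esub> x \<noteq> \<zero>\<^bsub>X\<^esub>"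
    "lm_isomorphic (interval_alg K) X (simple_mod K R)"
proof -
  interpret X: left_module "interval_alg K" X using X by (simp add: simple_lm_def)
  obtain x where x: "x \<in> carrier X" "x \<noteq> \<zero>\<^bsub>X\<^esub>"
    using X X.M.zero_closed by (auto simp: simple_lm_def simp del: X.M.zero_closed)
  have "\<exists>R\<in>poset_intervals. alg_idem K R \<odot>\<^bsub>X\<^esub> x \<noteq> \<zero>\<^bsub>X\<^esub>"
  proof (rule ccontr)
    assume *: "\<not> ?thesis"
    have "x = (\<Oplus>\<^bsub>interval_alg K\<^esub>R\<in>poset_intervals. alg_idem K R) \<odot>\<^bsub>X\<^esub> x"
      using x X.smult_one by (simp add: one_eq_sum_idem)
    also have "\<dots> = (\<Oplus>\<^bsub>X\<^esub>R\<in>poset_intervals. alg_idem K R \<odot>\<^bsub>X\<^esub> x)"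
      by (rule finsum_additive[where h = "\<lambda>a. a \<odot>\<^bsub>X\<^esub> x"])
        (use x alg_idem(1) X.R.is_abelian_group X.M.abelian_group_axioms in \<open>auto simp: X.smult_l_distr\<close>)
    also have "\<dots> = \<zero>\<^bsub>X\<^esub>" using * by (intro X.M.add.finprod_one_eqI) auto
    finally show False using x by simp
  qed
  then show ?thesis using x simple_iso_simple_mod[OF X] that by blast
qed

text \<open>Multiplying by \<open>alg_idem K S\<close> leaves only entries with source
  \<open>S\<close>. The entry from \<open>R\<close> to \<open>R\<close> therefore vanishes, and the
  product lies in \<open>proj_rad K R\<close>.\<close>

lemma idem_simple_mod_zero:
  fixes R :: "'p::{finite, order} set"
  assumes X: "left_module (interval_alg K) X" "lm_isomorphic (interval_alg K) X (simple_mod K R)"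
    and R: "R \<in> poset_intervals" "S \<in> poset_intervals" "R \<noteq> S" and x: "x \<in> carrier X"
  shows "alg_idem K S \<odot>\<^bsub>X\<^esub> x = \<zero>\<^bsub>X\<^esub>"
proof -
  interpret X: left_module "interval_alg K" X by fact
  interpret A: ring "interval_alg K :: ('p, 'k) alg_elem ring" by (rule ring_interval_alg)
  have sm: "simple_mod K R = lm_quot (proj_mod K R) (proj_rad K R)"
    by (simp add: simple_mod_def lm_rad_proj[OF R(1)])
  note pm = left_module_proj_mod[OF R(1)] and rs = proj_rad_submodule[OF R(1)]
  have lm: "left_module (interval_alg K) (simple_mod K R)"
    unfolding sm by (rule left_module_quot[OF pm rs])
  interpret P: left_module "interval_alg K" "proj_mod K R" by fact
  note e = alg_idem(1)[OF R(2)] and up = self_upset_interval[OF R(2)]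
  have kill: "alg_idem K S \<odot>\<^bsub>simple_mod K R\<^esub> y = \<zero>\<^bsub>simple_mod K R\<^esub>" if y: "y \<in> carrier (simple_mod K R)" for y
  proof -
    obtain p where p: "p \<in> carrier (proj_mod K R)" "y = lm_quot_proj (proj_mod K R) (proj_rad K R) p"
      using y quot_proj_hom(2)[OF pm rs] unfolding sm by auto
    have pA: "p \<in> carrier (interval_alg K)" by (rule proj_carrierD[OF p(1) R(1)])
    have ep: "alg_idem K S \<odot>\<^bsub>proj_mod K R\<^esub> p \<in> carrier (proj_mod K R)"
      by (rule P.smult_closed[OF e p(1)])
    then have "alg_idem K S \<odot>\<^bsub>proj_mod K R\<^esub> p \<in> proj_rad K R"
      using R(3) by (auto simp: proj_rad_def alg_idem_eq coef_incl_mult[OF pA up R(2)])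
    then show ?thesis
      using quot_proj_hom(3)[OF pm rs ep] lm_homD(3)[OF quot_proj_hom(1)[OF pm rs] e p(1)] p(2)
      by (simp add: sm)
  qed
  obtain f where f: "f \<in> lm_hom (interval_alg K) X (simple_mod K R)" "inj_on f (carrier X)"
    using X(2) by (auto simp: lm_isomorphic_def lm_iso_def bij_betw_def)
  have "f (alg_idem K S \<odot>\<^bsub>X\<^esub> x) = f \<zero>\<^bsub>X\<^esub>"
    using lm_homD[OF f(1)] kill e x lm_hom_zero[OF X(1) lm f(1)] by simp
  then show ?thesis using inj_onD[OF f(2)] e x by auto
qed

text \<open>Suppose a term of the product from \<open>R\<close> through \<open>Q\<close> to
  \<open>T\<close> is non-zero and \<open>R\<close> contains \<open>T\<close> as a downset. Then the
  second factor is non-zero on all of \<open>T\<close>, which makes \<open>T\<close> a downset of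
  \<open>Q\<close>; but for such \<open>Q\<close> the second factor is zero.\<close>

lemma standard_sub_submodule:
  fixes T :: "'p::{finite, order} set"
  assumes T: "T \<in> poset_intervals"
  shows "submodule (standard_sub K T) (interval_alg K) (proj_mod K T)"
proof -
  interpret P: left_module "interval_alg K" "proj_mod K T" by (rule left_module_proj_mod[OF T])
  show ?thesis
  proof (rule P.submoduleI')
    show "\<zero>\<^bsub>proj_mod K T\<^esub> \<in> standard_sub K T"
      using P.M.zero_closed by (auto simp: standard_sub_def simp del: P.M.zero_closed)
    show "a \<oplus>\<^bsub>proj_mod K T\<^esub> b \<in> standard_sub K T" if "a \<in> standard_sub K T" "b \<in> standard_sub K T" for a b
      using that P.M.a_closed[of a b] T by (auto simp: standard_sub_def coef_add proj_carrierD)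
    show "b \<odot>\<^bsub>proj_mod K T\<^esub> a \<in> standard_sub K T"
      if b: "b \<in> carrier (interval_alg K)" and a: "a \<in> standard_sub K T" for a b
    proof -
      have a': "a \<in> carrier (proj_mod K T)" "a \<in> carrier (interval_alg K)"
        "\<And>R x. contains_as_downset R T \<Longrightarrow> coef K a R T x = \<zero>"
        using a T by (auto simp: standard_sub_def proj_carrierD)
      have "coef K b R Q x \<otimes> coef K a Q T x = \<zero>" if R: "contains_as_downset R T" for R Q x
      proof (rule ccontr)
        assume "coef K b R Q x \<otimes> coef K a Q T x \<noteq> \<zero>"
        then have x: "coef K b R Q x \<noteq> \<zero>" "coef K a Q T x \<noteq> \<zero>" using a' b by auto
        note hb = hom_fun_coef[OF b, of R Q] and ha = hom_fun_coef[OF a'(2), of Q T]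
        have nz: "coef K a Q T t \<noteq> \<zero>" if "t \<in> T" for t
          using hom_fun_comp_nonzero(2)[OF hb ha poset_intervalsD(2)[OF T] _ x that] R
          by (simp add: contains_as_downset_def)
        have "contains_as_downset Q T"
          using nz hom_funD(2,3,4)[OF ha] unfolding contains_as_downset_def by (metis subsetI)
        then show False using a'(3) x(2) by auto
      qed
      then have "coef K (b \<otimes>\<^bsub>interval_alg K\<^esub> a) R T x = \<zero>" if "contains_as_downset R T" for R x
        unfolding coef_mult[OF b a'(2)] using that by (intro add.finprod_one_eqI) auto
      then show ?thesis using P.smult_closed[OF b a'(1)] by (simp add: standard_sub_def)
    qed
  qed (auto simp: standard_sub_def)
qed

section \<open>Composition factors of quotients and the least admissible submodule\<close>

lemma factor_annihilated:
  fixes N :: "'b set"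
  assumes M: "left_module A M" and L: "submodule L A M" and N: "submodule N A M" "N \<subseteq> L"
    and e: "e \<in> carrier A" "\<And>z. z \<in> carrier M \<Longrightarrow> e \<odot>\<^bsub>M\<^esub> z = \<zero>\<^bsub>M\<^esub>"
    and x: "x \<in> carrier (lm_quot (lm_restrict M L) N)"
  shows "e \<odot>\<^bsub>lm_quot (lm_restrict M L) N\<^esub> x = \<zero>\<^bsub>lm_quot (lm_restrict M L) N\<^esub>"
proof -
  interpret M: left_module A M by fact
  have R: "left_module A (lm_restrict M L)" by (rule left_module_restrict[OF M L])
  have N': "submodule N A (lm_restrict M L)" using submodule_restrict_iff[OF M L] N by auto
  note p = quot_proj_hom[OF R N']
  obtain z where z: "z \<in> carrier (lm_restrict M L)" "x = lm_quot_proj (lm_restrict M L) N z" using p(2) x by auto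
  have "e \<odot>\<^bsub>lm_restrict M L\<^esub> z = \<zero>\<^bsub>M\<^esub>" using e(2)[of z] z M.submoduleD(1)[OF L] by auto
  then show ?thesis
    using lm_homD(3)[OF p(1) e(1) z(1)] lm_hom_zero[OF R left_module_quot[OF R N'] p(1)] z(2) by simp
qed

lemma factor_simple:
  assumes "X \<in> composition_factors A M"
  obtains L N where "submodule L A M" "submodule N A M" "N \<subseteq> L" "X = lm_quot (lm_restrict M L) N"
    "simple_lm A X"
proof -
  obtain Ns i where Ns: "composition_series A M Ns" "Suc i < length Ns"
    "X = lm_quot (lm_restrict M (Ns ! Suc i)) (Ns ! i)"
    using assms by (auto simp: composition_factors_def)
  then have "submodule (Ns ! Suc i) A M" "submodule (Ns ! i) A M" "Ns ! i \<subseteq> Ns ! Suc i" "simple_lm A X"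
    by (auto simp: composition_series_def)
  then show ?thesis using Ns that by blast
qed

text \<open>A simple factor is \<open>simple_mod K R\<close> for some \<open>R\<close> whose
  idempotent does not annihilate it. If \<open>R\<close> were not permitted, every multiple of this
  idempotent would lie in \<open>standard_sub K T\<close>, so the idempotent would annihilate the
  whole quotient.\<close>

lemma standard_sub_factors:
  fixes T :: "'p::{finite, order} set"
  assumes T: "T \<in> poset_intervals"
    and X: "X \<in> composition_factors (interval_alg K) (lm_quot (proj_mod K T) (standard_sub K T))"
  shows "\<exists>R\<in>poset_intervals. interval_le R T \<and> lm_isomorphic (interval_alg K) X (simple_mod K R)"
proof -
  let ?Q = "lm_quot (proj_mod K T) (standard_sub K T)"
  note pm = left_module_proj_mod[OF T] and sub = standard_sub_submodule[OF T]
  note Q = left_module_quot[OF pm sub] and p = quot_proj_hom[OF pm sub]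
  interpret P: left_module "interval_alg K" "proj_mod K T" by fact
  obtain L N where X': "submodule L (interval_alg K) ?Q" "submodule N (interval_alg K) ?Q" "N \<subseteq> L"
    "X = lm_quot (lm_restrict ?Q L) N" "simple_lm (interval_alg K) X"
    using factor_simple[OF X] .
  obtain R x where R: "R \<in> poset_intervals" "x \<in> carrier X" "alg_idem K R \<odot>\<^bsub>X\<^esub> x \<noteq> \<zero>\<^bsub>X\<^esub>"
    "lm_isomorphic (interval_alg K) X (simple_mod K R)"
    using simple_iso_some[OF X'(5)] .
  have "interval_le R T"
  proof (rule ccontr)
    assume nle: "\<not> interval_le R T"
    \<comment> \<open>A set containing \<open>T\<close> either equals \<open>T\<close> or has more
      elements, and both cases are permitted by \<open>interval_le\<close>.\<close>
    have nd: "\<not> contains_as_downset R T"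
    proof
      assume "contains_as_downset R T"
      then have "T \<subseteq> R" by (simp add: contains_as_downset_def)
      moreover have "R \<noteq> T" "card R \<le> card T" using nle by (auto simp: interval_le_def)
      ultimately show False by (metis card_seteq finite)
    qed
    have "alg_idem K R \<odot>\<^bsub>?Q\<^esub> z = \<zero>\<^bsub>?Q\<^esub>" if z: "z \<in> carrier ?Q" for z
    proof -
      obtain a where a: "a \<in> carrier (proj_mod K T)" "z = lm_quot_proj (proj_mod K T) (standard_sub K T) a"
        using p(2) z by auto
      note e = alg_idem(1)[OF R(1)] and aA = proj_carrierD[OF a(1) T]
      have ea: "alg_idem K R \<odot>\<^bsub>proj_mod K T\<^esub> a \<in> carrier (proj_mod K T)" by (rule P.smult_closed[OF e a(1)])
      have "alg_idem K R \<odot>\<^bsub>proj_mod K T\<^esub> a \<in> standard_sub K T"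
        using ea nd by (auto simp: standard_sub_def alg_idem_eq coef_incl_mult[OF aA self_upset_interval[OF R(1)] R(1)])
      then show ?thesis using p(3)[OF ea] lm_homD(3)[OF p(1) e a(1)] a(2) by simp
    qed
    then have "alg_idem K R \<odot>\<^bsub>X\<^esub> x = \<zero>\<^bsub>X\<^esub>"
      using factor_annihilated[OF Q X'(1,2,3) alg_idem(1)[OF R(1)]] R(2) unfolding X'(4) by blast
    then show False using R(3) by simp
  qed
  then show ?thesis using R by blast
qed

text \<open>
  The number of pivot positions of a submodule plays the role of its dimension over \<^term>\<open>K\<close>.
\<close>

lemma proj_submodule_len:
  fixes T :: "'p::{finite, order} set"
  assumes T: "T \<in> poset_intervals"
  shows "\<exists>len :: ('p, 'k) alg_elem set \<Rightarrow> nat. \<forall>L L'. submodule L (interval_alg K) (proj_mod K T) \<and>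
    submodule L' (interval_alg K) (proj_mod K T) \<and> L \<subset> L' \<longrightarrow> len L < len L'"
proof -
  interpret A: ring "interval_alg K :: ('p, 'k) alg_elem ring" by (rule ring_interval_alg)
  interpret P: left_module "interval_alg K" "proj_mod K T" by (rule left_module_proj_mod[OF T])
  obtain idx :: "'p set \<times> 'p \<Rightarrow> nat" and n where idx: "inj idx" "range idx = {i. i < n}"
    using finite_imp_inj_to_nat_seg[of "UNIV :: ('p set \<times> 'p) set"] by auto
  define cf where "cf a i = coef K a (fst i) T (snd i)" for a and i :: "'p set \<times> 'p"
  define lead where "lead a i \<longleftrightarrow> cf a i \<noteq> \<zero> \<and> (\<forall>j. idx j < idx i \<longrightarrow> cf a j = \<zero>)" for a i
  define piv where "piv L = {i. \<exists>a\<in>L. lead a i}" for L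
  have ex_lead: "\<exists>i. lead a i" if "a \<in> carrier (proj_mod K T)" "a \<noteq> \<zero>\<^bsub>proj_mod K T\<^esub>" for a
  proof -
    have "\<exists>i. cf a i \<noteq> \<zero>"
    proof (rule ccontr)
      assume "\<not> ?thesis"
      then have z: "coef K a R T x = \<zero>" for R x by (simp add: cf_def)
      have "a = \<zero>\<^bsub>proj_mod K T\<^esub>"
        by (rule proj_eqI[OF T that(1) P.M.zero_closed]) (simp add: z)
      then show False using that by simp
    qed
    then obtain i where "cf a i \<noteq> \<zero>" "\<forall>j. cf a j \<noteq> \<zero> \<longrightarrow> idx i \<le> idx j"
      using exists_least_iff[of "\<lambda>n. \<exists>i. idx i = n \<and> cf a i \<noteq> \<zero>"] by (metis not_less)
    then show ?thesis unfolding lead_def by (metis not_less)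
  qed
  have "card (piv L) < card (piv L')"
    if L: "submodule L (interval_alg K) (proj_mod K T)"
      and L': "submodule L' (interval_alg K) (proj_mod K T)" and LL: "L \<subset> L'" for L L'
  proof (rule ccontr)
    note l = P.submoduleD[OF L] and l' = P.submoduleD[OF L']
    assume "\<not> card (piv L) < card (piv L')"
    moreover have "piv L \<subseteq> piv L'" using LL by (auto simp: piv_def)
    ultimately have eq: "piv L' = piv L"
      using psubset_card_mono[of "piv L'" "piv L"] by auto
    \<comment> \<open>Gaussian elimination: among the elements of \<open>L'\<close> outside
      \<open>L\<close>, take one whose leading position is last. Equality of the pivot sets gives an
      element of \<open>L\<close> with the same leading position, and subtracting a multiple of it
      moves the leading position further, a contradiction.\<close>
    let ?Q = "\<lambda>i. \<exists>a\<in>L' - L. lead a i"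
    obtain a0 where a0: "a0 \<in> L'" "a0 \<notin> L" using LL by auto
    then have "a0 \<noteq> \<zero>\<^bsub>proj_mod K T\<^esub>" using l(2) by metis
    then obtain i0 where "?Q i0" using ex_lead[of a0] a0 l'(1) by auto
    moreover have "\<forall>i. ?Q i \<longrightarrow> idx i < n" using idx by auto
    ultimately have "\<exists>i. ?Q i \<and> (\<forall>j. ?Q j \<longrightarrow> idx j \<le> idx i)"
      by (rule ex_has_greatest_nat)
    then obtain i a where i: "lead a i" "a \<in> L'" "a \<notin> L" and max: "\<And>j. ?Q j \<Longrightarrow> idx j \<le> idx i" by blast
    then have "i \<in> piv L" using eq by (auto simp: piv_def)
    then obtain b where b: "b \<in> L" "lead b i" by (auto simp: piv_def)
    have aA: "a \<in> carrier (interval_alg K)" "b \<in> carrier (interval_alg K)"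
      using i(2) b(1) l(1) l'(1) by (blast intro: proj_carrierD[OF _ T])+
    define k where "k = \<ominus> (cf a i \<otimes> inv (cf b i))"
    have bi: "cf b i \<in> carrier K" "cf b i \<noteq> \<zero>" "inv (cf b i) \<in> carrier K" "inv (cf b i) \<otimes> cf b i = \<one>"
    proof -
      show 1: "cf b i \<in> carrier K" "cf b i \<noteq> \<zero>" using b aA by (auto simp: cf_def lead_def)
      then have "cf b i \<in> Units K" by (simp add: field_Units)
      then show "inv (cf b i) \<in> carrier K" "inv (cf b i) \<otimes> cf b i = \<one>" by auto
    qed
    have ai: "cf a j \<in> carrier K" "cf b j \<in> carrier K" for j using aA by (auto simp: cf_def)
    have k: "k \<in> carrier K" using ai bi by (simp add: k_def)
    define s where "s = diag_elem K (\<lambda>R :: 'p set. k)"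
    have s: "s \<in> carrier (interval_alg K)" "coef K (s \<otimes>\<^bsub>interval_alg K\<^esub> b) R S x = k \<otimes> coef K b R S x" for R S x
      using diag_elem(1,3)[of "\<lambda>_. k"] k aA by (auto simp: s_def)
    define a' where "a' = a \<oplus>\<^bsub>proj_mod K T\<^esub> s \<odot>\<^bsub>proj_mod K T\<^esub> b"
    have sb: "s \<odot>\<^bsub>proj_mod K T\<^esub> b \<in> L" using s b l(4) by auto
    have a'L': "a' \<in> L'" unfolding a'_def using sb LL i l'(3) by auto
    have "a' \<notin> L"
    proof
      assume "a' \<in> L"
      then have "a' \<ominus>\<^bsub>proj_mod K T\<^esub> s \<odot>\<^bsub>proj_mod K T\<^esub> b \<in> L" using l(6) sb by auto
      moreover have "a' \<ominus>\<^bsub>proj_mod K T\<^esub> s \<odot>\<^bsub>proj_mod K T\<^esub> b = a"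
        using l(1) l'(1) sb i(2) unfolding a'_def
        by (auto simp: a_minus_def P.M.a_assoc P.M.r_neg subset_iff simp del: proj_mod_simps)
      ultimately show False using i by simp
    qed
    then have "a' \<noteq> \<zero>\<^bsub>proj_mod K T\<^esub>" using l(2) by metis
    then obtain j where j: "lead a' j" using ex_lead[of a'] a'L' l'(1) by auto
    have cf': "cf a' j = cf a j \<oplus> k \<otimes> cf b j" for j
      using aA s by (simp add: cf_def a'_def coef_add)
    have "cf a' i = \<zero>"
    proof -
      have "k \<otimes> cf b i = \<ominus> (cf a i \<otimes> (inv (cf b i) \<otimes> cf b i))"
        unfolding k_def using ai[of i] bi(1,3) by (simp add: l_minus m_assoc)
      then show ?thesis using cf' ai[of i] bi(4) by (simp add: r_neg)
    qed
    moreover have "cf a' j = \<zero>" if "idx j < idx i" for j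
    proof -
      have "cf a j = \<zero>" "cf b j = \<zero>" using that i(1) b(2) unfolding lead_def by blast+
      then show ?thesis using cf'[of j] k by simp
    qed
    ultimately have "idx i < idx j"
      using j idx(1) unfolding lead_def by (metis injD linorder_cases)
    moreover have "idx j \<le> idx i" using max[of j] j a'L' \<open>a' \<notin> L\<close> by blast
    ultimately show False by simp
  qed
  then show ?thesis by (intro exI[of _ "\<lambda>L. card (piv L)"]) simp
qed

text \<open>This makes the condition on composition factors effective. The length function on the
  quotient is that of the preimage, which is strictly monotone because the projection is
  onto.\<close>

lemma quot_composition_series:
  fixes T :: "'p::{finite, order} set"
  assumes T: "T \<in> poset_intervals" and N: "submodule N (interval_alg K) (proj_mod K T)"
  shows "\<exists>Ns. composition_series (interval_alg K) (lm_quot (proj_mod K T) N) Ns"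
proof -
  let ?Q = "lm_quot (proj_mod K T) N"
  note pm = left_module_proj_mod[OF T]
  note Q = left_module_quot[OF pm N] and p = quot_proj_hom[OF pm N]
  interpret Q: left_module "interval_alg K" ?Q by fact
  obtain len :: "('p, 'k) alg_elem set \<Rightarrow> nat" where
    len: "\<And>L L'. submodule L (interval_alg K) (proj_mod K T) \<Longrightarrow>
    submodule L' (interval_alg K) (proj_mod K T) \<Longrightarrow> L \<subset> L' \<Longrightarrow> len L < len L'"
    using proj_submodule_len[OF T] by blast
  define pre where "pre H = {x \<in> carrier (proj_mod K T). lm_quot_proj (proj_mod K T) N x \<in> H}" for H
  have pre: "submodule (pre H) (interval_alg K) (proj_mod K T)" if "submodule H (interval_alg K) ?Q" for H
    unfolding pre_def by (rule lm_hom_vimage_submodule[OF pm Q p(1) that])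
  have psub: "pre H \<subset> pre H'" if H: "H \<subset> H'" "submodule H' (interval_alg K) ?Q" for H H'
  proof -
    obtain y where y: "y \<in> H'" "y \<notin> H" using H by auto
    then have "y \<in> lm_quot_proj (proj_mod K T) N ` carrier (proj_mod K T)"
      using p(2) Q.submoduleD(1)[OF H(2)] by auto
    then obtain x where "x \<in> carrier (proj_mod K T)" "lm_quot_proj (proj_mod K T) N x = y" by auto
    then show ?thesis using y H(1) by (auto simp: pre_def)
  qed
  show ?thesis
    by (rule composition_series_exists[OF Q, of "\<lambda>H. len (pre H)"]) (rule len[OF pre pre psub])
qed

text \<open>The idempotent annihilates every permitted simple factor, so on a term of the
  composition series it maps into the previous term. There it is zero by induction, and idempotency
  turns two applications into one.\<close>

lemma standard_kernel_contains:
  fixes T :: "'p::{finite, order} set"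
  assumes T: "T \<in> poset_intervals" and N: "submodule N (interval_alg K) (proj_mod K T)"
    and fac: "\<And>X. X \<in> composition_factors (interval_alg K) (lm_quot (proj_mod K T) N) \<Longrightarrow>
        \<exists>R\<in>poset_intervals. interval_le R T \<and> lm_isomorphic (interval_alg K) X (simple_mod K R)"
    and R: "R \<in> poset_intervals" "\<not> interval_le R T" and a: "a \<in> carrier (proj_mod K T)"
  shows "alg_idem K R \<otimes>\<^bsub>interval_alg K\<^esub> a \<in> N"
proof -
  let ?Q = "lm_quot (proj_mod K T) N"
  note pm = left_module_proj_mod[OF T]
  note Q = left_module_quot[OF pm N] and p = quot_proj_hom[OF pm N]
  interpret A: ring "interval_alg K :: ('p, 'k) alg_elem ring" by (rule ring_interval_alg)
  interpret Q: left_module "interval_alg K" ?Q by fact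
  interpret P: left_module "interval_alg K" "proj_mod K T" by fact
  note e = alg_idem[OF R(1)]
  obtain Ns where Ns: "composition_series (interval_alg K) ?Q Ns"
    using quot_composition_series[OF T N] by blast
  have "\<forall>z\<in>Ns ! i. alg_idem K R \<odot>\<^bsub>?Q\<^esub> z = \<zero>\<^bsub>?Q\<^esub>" if "i < length Ns" for i
    using that
  proof (induction i)
    case 0
    have "Ns \<noteq> []" "hd Ns = {\<zero>\<^bsub>?Q\<^esub>}" using Ns unfolding composition_series_def by blast+
    then have "Ns ! 0 = {\<zero>\<^bsub>?Q\<^esub>}" by (simp add: hd_conv_nth)
    then show ?case using e by simp
  next
    case (Suc i)
    let ?L = "Ns ! Suc i" and ?M = "Ns ! i"
    let ?X = "lm_quot (lm_restrict ?Q ?L) ?M"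
    have L: "submodule ?L (interval_alg K) ?Q" "submodule ?M (interval_alg K) ?Q" "?M \<subseteq> ?L"
      using Ns Suc.prems by (auto simp: composition_series_def)
    have mod_L: "left_module (interval_alg K) (lm_restrict ?Q ?L)" by (rule left_module_restrict[OF Q L(1)])
    have sub_M: "submodule ?M (interval_alg K) (lm_restrict ?Q ?L)"
      using submodule_restrict_iff[OF Q L(1)] L by auto
    note X = left_module_quot[OF mod_L sub_M] and pX = quot_proj_hom[OF mod_L sub_M]
    have "?X \<in> composition_factors (interval_alg K) ?Q"
      using Ns Suc.prems by (auto simp: composition_factors_def)
    then obtain R' where R': "R' \<in> poset_intervals" "interval_le R' T" "lm_isomorphic (interval_alg K) ?X (simple_mod K R')"
      using fac by blast
    have ne: "R' \<noteq> R" using R' R by auto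
    show ?case
    proof
      fix z assume z: "z \<in> ?L"
      have zc: "z \<in> carrier (lm_restrict ?Q ?L)" using z by simp
      have zQ: "z \<in> carrier ?Q" using z Q.submoduleD(1)[OF L(1)] by auto
      have ez: "alg_idem K R \<odot>\<^bsub>?Q\<^esub> z \<in> ?L" using Q.submoduleD(4)[OF L(1) e(1) z] .
      have "alg_idem K R \<odot>\<^bsub>?X\<^esub> lm_quot_proj (lm_restrict ?Q ?L) ?M z = \<zero>\<^bsub>?X\<^esub>"
        by (rule idem_simple_mod_zero[OF X R'(3,1) R(1) ne lm_homD(1)[OF pX(1) zc]])
      then have "alg_idem K R \<odot>\<^bsub>?Q\<^esub> z \<in> ?M"
        using lm_homD(3)[OF pX(1) e(1) zc] pX(3)[of "alg_idem K R \<odot>\<^bsub>?Q\<^esub> z"] ez by simp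
      then have "alg_idem K R \<odot>\<^bsub>?Q\<^esub> (alg_idem K R \<odot>\<^bsub>?Q\<^esub> z) = \<zero>\<^bsub>?Q\<^esub>" using Suc by auto
      then show "alg_idem K R \<odot>\<^bsub>?Q\<^esub> z = \<zero>\<^bsub>?Q\<^esub>"
        using Q.smult_assoc1[OF e(1) e(1) zQ] e(2) by simp
    qed
  qed
  moreover have "carrier ?Q = Ns ! (length Ns - 1)" "length Ns - 1 < length Ns"
    using Ns by (auto simp: composition_series_def last_conv_nth)
  ultimately have "alg_idem K R \<odot>\<^bsub>?Q\<^esub> z = \<zero>\<^bsub>?Q\<^esub>" if "z \<in> carrier ?Q" for z using that by metis
  then have "lm_quot_proj (proj_mod K T) N (alg_idem K R \<odot>\<^bsub>proj_mod K T\<^esub> a) = \<zero>\<^bsub>?Q\<^esub>"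
    using lm_homD(3)[OF p(1) e(1) a] lm_homD(1)[OF p(1) a] by simp
  then show ?thesis using p(3)[of "alg_idem K R \<odot>\<^bsub>proj_mod K T\<^esub> a"] P.smult_closed[OF e(1) a] by simp
qed

text \<open>The inclusion of a proper upset interval \<open>C\<close> is fixed by left
  multiplication with \<open>alg_idem K C\<close>, and \<open>C\<close> is too small to be
  permitted; so every admissible \<open>N\<close> contains it. What remains is the hypothesis
  \<open>gen\<close>, a statement on generators that the first differential supplies later.\<close>

lemma standard_kernel_eq:
  fixes T :: "'p::{finite, order} set"
  assumes T: "T \<in> poset_intervals"
    and gen: "\<And>N. submodule N (interval_alg K) (proj_mod K T) \<Longrightarrow>
      (\<And>C. C \<in> upset_intervals T - {T} \<Longrightarrow> incl_elem K C T \<in> N) \<Longrightarrow> standard_sub K T \<subseteq> N"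
  shows "standard_kernel K T = standard_sub K T"
  unfolding standard_kernel_def
proof (rule Least_equality)
  show "submodule (standard_sub K T) (interval_alg K) (proj_mod K T) \<and>
    (\<forall>X\<in>composition_factors (interval_alg K) (lm_quot (proj_mod K T) (standard_sub K T)).
        \<exists>R\<in>poset_intervals. interval_le R T \<and> lm_isomorphic (interval_alg K) X (simple_mod K R))"
    using standard_sub_submodule[OF T] standard_sub_factors[OF T] by blast
  interpret A: ring "interval_alg K :: ('p, 'k) alg_elem ring" by (rule ring_interval_alg)
  fix N assume N: "submodule N (interval_alg K) (proj_mod K T) \<and>
    (\<forall>X\<in>composition_factors (interval_alg K) (lm_quot (proj_mod K T) N).
        \<exists>R\<in>poset_intervals. interval_le R T \<and> lm_isomorphic (interval_alg K) X (simple_mod K R))"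
  show "standard_sub K T \<subseteq> N"
  proof (rule gen[OF conjunct1[OF N]])
    fix C assume C: "C \<in> upset_intervals T - {T}"
    then have up: "C \<in> upset_intervals T" and Ci: "C \<in> poset_intervals" and CT: "C \<subset> T"
      by (auto simp: upset_intervals_def relative_upset_def)
    have nle: "\<not> interval_le C T"
      using psubset_card_mono[OF _ CT] CT by (auto simp: interval_le_def)
    note j = incl_elem_closed[OF up T]
    have jP: "incl_elem K C T \<in> carrier (proj_mod K T)"
      using j by (auto simp: proj_mod_carrier[OF T])
    have "alg_idem K C \<otimes>\<^bsub>interval_alg K\<^esub> incl_elem K C T \<in> N"
      using standard_kernel_contains[OF T conjunct1[OF N] _ Ci nle jP] N by blast
    moreover have "alg_idem K C \<otimes>\<^bsub>interval_alg K\<^esub> incl_elem K C T = incl_elem K C T"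
    proof (rule alg_eqI)
      show "alg_idem K C \<otimes>\<^bsub>interval_alg K\<^esub> incl_elem K C T \<in> carrier (interval_alg K)"
        using alg_idem(1)[OF Ci] j(1) by simp
    qed (simp_all add: j alg_idem_eq coef_incl_mult[OF j(1) self_upset_interval[OF Ci] Ci])
    ultimately show "incl_elem K C T \<in> N" by simp
  qed
qed

end

section \<open>The augmented chain complex of a simplex\<close>

text \<open>Encoded by parity so that the same sign is available in \<open>K\<close> and in the
  modules of the complex.\<close>

definition alt_sign :: "('a, 'b) ring_scheme \<Rightarrow> nat \<Rightarrow> 'a \<Rightarrow> 'a" where
  "alt_sign M n x = (if even n then x else \<ominus>\<^bsub>M\<^esub> x)"

text \<open>For \<open>j\<close> outside \<open>J\<close> this is the position, counted from zero,
  that \<open>j\<close> takes in the increasing enumeration of \<open>insert j J\<close>; hence the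
  exponent of its sign.\<close>

definition below :: "nat set \<Rightarrow> nat \<Rightarrow> nat" where
  "below J j = card {i \<in> J. i < j}"

text \<open>The boundary of the chain with coefficients \<open>f\<close>, read off at the face
  \<open>J\<close>: the simplices that have \<open>J\<close> as a face arise by adding one vertex.
  At \<open>J = {}\<close> this is the augmentation.\<close>

definition simplex_diff :: "('a, 'b) ring_scheme \<Rightarrow> nat \<Rightarrow> (nat set \<Rightarrow> 'a) \<Rightarrow> nat set \<Rightarrow> 'a" where
  "simplex_diff M m f J = (\<Oplus>\<^bsub>M\<^esub>j\<in>{1..m} - J. alt_sign M (below J j) (f (insert j J)))"

lemma below_insert:
  assumes "finite J" "k \<notin> J"
  shows "below (insert k J) j = (if k < j then Suc (below J j) else below J j)"
proof -
  have "{i \<in> insert k J. i < j} = (if k < j then insert k {i \<in> J. i < j} else {i \<in> J. i < j})" by auto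
  then show ?thesis using assms by (auto simp: below_def)
qed

lemma below_nth:
  assumes "finite J" "r < card J"
  shows "below J (sorted_list_of_set J ! r) = r"
proof -
  let ?s = "sorted_list_of_set J"
  have len: "length ?s = card J" and set: "set ?s = J" and dist: "distinct ?s" using assms by auto
  have less: "?s ! k < ?s ! l \<longleftrightarrow> k < l" if "k < card J" "l < card J" for k l
    using that len strict_sorted_list_of_set[of J] sorted_wrt_nth_less[of "(<)" ?s]
    by (metis linorder_neqE_nat order_less_asym' order_less_irrefl)
  have "{i \<in> J. i < ?s ! r} = (\<lambda>k. ?s ! k) ` {..<r}"
  proof safe
    fix i assume "i \<in> J" "i < ?s ! r"
    then obtain k where "k < card J" "i = ?s ! k" using set len by (metis in_set_conv_nth)
    then show "i \<in> (\<lambda>k. ?s ! k) ` {..<r}" using less[of k r] \<open>i < ?s ! r\<close> assms by auto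
  next
    fix k assume k: "k < r"
    show "?s ! k \<in> J" using k assms set len nth_mem[of k ?s] by simp
    show "?s ! k < ?s ! r" using k assms less by simp
  qed
  moreover have "inj_on (\<lambda>k. ?s ! k) {..<r}"
    using dist len assms by (intro inj_onI) (auto simp: nth_eq_iff_index_eq)
  ultimately show ?thesis by (simp add: below_def card_image)
qed

text \<open>Translates the omission of the vertex in position \<open>r\<close> into the addition of
  a vertex \<open>j\<close> with \<open>r = below J' j\<close>. The differential is given in the
  first form, \<open>simplex_diff\<close> in the second.\<close>

lemma face_eq_iff:
  assumes "finite J" "r < card J"
  shows "face J r = J' \<longleftrightarrow> (\<exists>j. j \<notin> J' \<and> J = insert j J' \<and> r = below J' j)"
proof -
  let ?s = "sorted_list_of_set J"
  have sr: "?s ! r \<in> J" using assms by (metis nth_mem sorted_list_of_set.length_sorted_key_list_of_set sorted_list_of_set.set_sorted_key_list_of_set)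
  have bel: "below J (?s ! r) = r" by (rule below_nth) fact+
  have rem: "below (J - {j}) j = below J j" for j
    unfolding below_def by (rule arg_cong[of _ _ card]) auto
  show ?thesis
  proof
    assume J': "face J r = J'"
    then show "\<exists>j. j \<notin> J' \<and> J = insert j J' \<and> r = below J' j"
      using sr bel rem by (intro exI[of _ "?s ! r"]) (auto simp: face_def)
  next
    assume "\<exists>j. j \<notin> J' \<and> J = insert j J' \<and> r = below J' j"
    then obtain j where j: "j \<notin> J'" "J = insert j J'" "r = below J' j" by blast
    have "j \<in> set ?s" using j(2) set_sorted_list_of_set[OF assms(1)] by blast
    then obtain k where "k < length ?s" "?s ! k = j" by (blast dest: in_set_conv_nth[THEN iffD1])
    then have k: "k < card J" "j = ?s ! k" using sorted_list_of_set.length_sorted_key_list_of_set[of J] by auto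
    have "below J' j = below J j" using rem[of j] j(1) unfolding j(2) by simp
    then have "k = r" using below_nth[OF assms(1) k(1)] j(3) unfolding k(2)[symmetric] by simp
    then have "face J r = J - {j}" using k(2) by (simp add: face_def)
    then show "face J r = J'" using j(1,2) by auto
  qed
qed

context abelian_group
begin

lemma alt_sign_closed [simp]: "x \<in> carrier G \<Longrightarrow> alt_sign G n x \<in> carrier G"
  by (simp add: alt_sign_def)

lemma alt_sign_zero [simp]: "alt_sign G n \<zero> = \<zero>"
  using minus_equality[of \<zero> \<zero>] by (simp add: alt_sign_def)

lemma alt_sign_Suc: "x \<in> carrier G \<Longrightarrow> alt_sign G (Suc n) x = \<ominus> alt_sign G n x"
  by (simp add: alt_sign_def)

lemma alt_sign_minus: "x \<in> carrier G \<Longrightarrow> alt_sign G n (\<ominus> x) = \<ominus> alt_sign G n x"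
  by (simp add: alt_sign_def)

lemma alt_sign_commute: "x \<in> carrier G \<Longrightarrow> alt_sign G n (alt_sign G k x) = alt_sign G k (alt_sign G n x)"
  by (simp add: alt_sign_def)

lemma alt_sign_add:
  "x \<in> carrier G \<Longrightarrow> y \<in> carrier G \<Longrightarrow> alt_sign G n (x \<oplus> y) = alt_sign G n x \<oplus> alt_sign G n y"
  by (simp add: alt_sign_def minus_add)

lemma alt_sign_finsum:
  assumes "f \<in> A \<rightarrow> carrier G"
  shows "alt_sign G n (finsum G f A) = (\<Oplus>a\<in>A. alt_sign G n (f a))"
  by (rule finsum_additive[OF abelian_group_axioms abelian_group_axioms _ _ assms])
    (auto simp: alt_sign_add)

lemma add_pow_alt_sign: "x \<in> carrier G \<Longrightarrow> [((-1) ^ n :: int)] \<cdot> x = alt_sign G n x"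
  by (cases "even n") (auto simp: alt_sign_def add.int_pow_neg)

lemma finsum_Sigma:
  assumes "finite A" "\<And>a. a \<in> A \<Longrightarrow> finite (B a)"
    and "\<And>a b. a \<in> A \<Longrightarrow> b \<in> B a \<Longrightarrow> f (a, b) \<in> carrier G"
  shows "finsum G f (Sigma A B) = (\<Oplus>a\<in>A. \<Oplus>b\<in>B a. f (a, b))"
  using assms
proof (induction A)
  case (insert x F)
  have "Sigma (insert x F) B = Pair x ` B x \<union> Sigma F B" by auto
  moreover have "finsum G f (Pair x ` B x) = (\<Oplus>b\<in>B x. f (x, b))"
    using insert by (subst finsum_reindex) (auto simp: inj_on_def Pi_iff)
  moreover have "finsum G f (Pair x ` B x \<union> Sigma F B) = finsum G f (Pair x ` B x) \<oplus> finsum G f (Sigma F B)"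
    using insert by (intro finsum_Un_disjoint) (auto intro!: finite_SigmaI simp: Pi_iff)
  moreover have "(\<Oplus>a\<in>insert x F. \<Oplus>b\<in>B a. f (a, b)) = (\<Oplus>b\<in>B x. f (x, b)) \<oplus> (\<Oplus>a\<in>F. \<Oplus>b\<in>B a. f (a, b))"
    using insert by (subst finsum_insert) (auto simp: Pi_iff intro!: finsum_closed)
  ultimately show ?case using insert by simp
qed simp

lemma simplex_diff_closed:
  assumes "\<And>j. f (insert j J) \<in> carrier G" shows "simplex_diff G m f J \<in> carrier G"
  unfolding simplex_diff_def using assms by (intro finsum_closed) auto

text \<open>The faces omitting two vertices occur twice, with opposite signs.\<close>

lemma simplex_diff_diff:
  assumes f: "\<And>J. f J \<in> carrier G" and J: "finite J"
  shows "simplex_diff G m (simplex_diff G m f) J = \<zero>"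
proof -
  let ?W = "{1..m} - J"
  define t where "t j i = alt_sign G (below J j) (alt_sign G (below (insert j J) i) (f (insert i (insert j J))))" for j i
  have t: "t j i \<in> carrier G" for i j using f by (simp add: t_def)
  \<comment> \<open>Adding the smaller vertex \<open>i\<close> first raises the position of
    \<open>j\<close> by one, whereas adding \<open>j\<close> first leaves the position of
    \<open>i\<close> unchanged.\<close>
  have anti: "t j i \<oplus> t i j = \<zero>" if "i \<notin> J" "j \<notin> J" "i < j" for i j
    using that f[of "insert i (insert j J)"] J insert_commute[of i j J]
    by (simp add: t_def below_insert alt_sign_Suc alt_sign_minus r_neg)
      (simp add: alt_sign_commute[of _ "below J i"] r_neg)
  \<comment> \<open>The double sum is split by the order of the two vertices. Exchanging the
    summation order in one half matches the pair \<open>(j, i)\<close> with \<open>(i, j)\<close>;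
    no diagonal terms occur.\<close>
  define L where "L j i = (if i < j then t j i else \<zero>)" for j i
  define R where "R j i = (if j < i then t j i else \<zero>)" for j i
  have LR: "L j i \<in> carrier G" "R j i \<in> carrier G" for i j using t by (auto simp: L_def R_def)
  have "simplex_diff G m (simplex_diff G m f) J = (\<Oplus>j\<in>?W. \<Oplus>i\<in>{1..m} - insert j J. t j i)"
    unfolding simplex_diff_def t_def
    by (intro finsum_cong' alt_sign_finsum) (use f in \<open>auto intro!: finsum_closed\<close>)
  also have "\<dots> = (\<Oplus>j\<in>?W. \<Oplus>i\<in>?W. L j i \<oplus> R j i)"
  proof (rule finsum_cong')
    fix j assume "j \<in> ?W"
    show "(\<Oplus>i\<in>{1..m} - insert j J. t j i) = (\<Oplus>i\<in>?W. L j i \<oplus> R j i)"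
      by (rule add.finprod_mono_neutral_cong_left) (use t in \<open>auto simp: L_def R_def Pi_iff\<close>)
  qed (use LR in \<open>auto intro!: finsum_closed\<close>)
  also have "\<dots> = (\<Oplus>j\<in>?W. (\<Oplus>i\<in>?W. L j i) \<oplus> (\<Oplus>i\<in>?W. R j i))"
    by (intro finsum_cong' finsum_addf) (use LR in \<open>auto intro!: finsum_closed a_closed\<close>)
  also have "\<dots> = (\<Oplus>j\<in>?W. \<Oplus>i\<in>?W. L j i) \<oplus> (\<Oplus>j\<in>?W. \<Oplus>i\<in>?W. R j i)"
    by (intro finsum_addf) (use LR in \<open>auto intro!: finsum_closed\<close>)
  also have "(\<Oplus>j\<in>?W. \<Oplus>i\<in>?W. R j i) = (\<Oplus>j\<in>?W. \<Oplus>i\<in>?W. R i j)"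
    by (rule finsum_swap) (use LR in auto)
  also have "(\<Oplus>j\<in>?W. \<Oplus>i\<in>?W. L j i) \<oplus> (\<Oplus>j\<in>?W. \<Oplus>i\<in>?W. R i j) = (\<Oplus>j\<in>?W. (\<Oplus>i\<in>?W. L j i) \<oplus> (\<Oplus>i\<in>?W. R i j))"
    by (intro finsum_addf[symmetric]) (use LR in \<open>auto intro!: finsum_closed\<close>)
  also have "\<dots> = (\<Oplus>j\<in>?W. \<Oplus>i\<in>?W. L j i \<oplus> R i j)"
    by (intro finsum_cong' finsum_addf[symmetric]) (use LR in \<open>auto intro!: finsum_closed a_closed\<close>)
  also have "\<dots> = \<zero>"
    by (intro add.finprod_one_eqI) (auto simp: L_def R_def anti)
  finally show ?thesis .
qed

text \<open>
  The cone with the least vertex \<^term>\<open>a\<close> of the simplex on \<^term>\<open>A\<close> as apex is a contracting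
  homotopy; as \<^term>\<open>a\<close> is least, inserting it causes no sign.
\<close>

lemma simplex_diff_cone:
  assumes f: "\<And>J. f J \<in> carrier G" and A: "A \<subseteq> {1..m}" "a \<in> A" "\<And>j. j \<in> A \<Longrightarrow> a \<le> j"
    and supp: "\<And>J. J \<subseteq> {1..m} \<Longrightarrow> card J = q \<Longrightarrow> f J \<noteq> \<zero> \<Longrightarrow> J \<subseteq> A"
    and cycle: "\<And>J. J \<subseteq> {1..m} \<Longrightarrow> Suc (card J) = q \<Longrightarrow> simplex_diff G m f J = \<zero>"
    and J: "J \<subseteq> {1..m}" "card J = q"
  shows "simplex_diff G m (\<lambda>J. if a \<in> J then f (J - {a}) else \<zero>) J = f J"
proof -
  have fin: "finite J" using J finite_subset by blast
  have below_a: "alt_sign G (below J a) (f J') = f J'" if "J \<subseteq> J' \<or> J \<subseteq> insert a J'" "J' \<subseteq> {1..m}" "card J' = q" for J J'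
  proof (cases "f J' = \<zero>")
    case False
    then have "J \<subseteq> A" using supp[of J'] that A(2) by auto
    then have "{i \<in> J. i < a} = {}" using A(3) by (auto simp: not_less)
    then have "below J a = 0" unfolding below_def by (metis card.empty)
    then show ?thesis by (simp add: alt_sign_def)
  qed simp
  show ?thesis
  proof (cases "a \<in> J")
    case False
    have "simplex_diff G m (\<lambda>J. if a \<in> J then f (J - {a}) else \<zero>) J =
      (\<Oplus>j\<in>{1..m} - J. if j = a then alt_sign G (below J j) (f J) else \<zero>)"
      unfolding simplex_diff_def by (rule finsum_cong') (use False f in auto)
    also have "\<dots> = alt_sign G (below J a) (f J)"
      using False A f by (subst finsum_delta) auto
    also have "\<dots> = f J" using below_a J by blast
    finally show ?thesis .
  next
    case True
    \<comment> \<open>The cycle condition at \<open>J0\<close> isolates the term \<open>f J\<close>,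
      added by the vertex \<open>a\<close>. Its other terms are those of the boundary of the cone at
      \<open>J\<close>, with signs reversed because \<open>a\<close> precedes every contributing
      \<open>j\<close>.\<close>
    define J0 where "J0 = J - {a}"
    have J0: "J = insert a J0" "a \<notin> J0" "J0 \<subseteq> {1..m}" "finite J0" "Suc (card J0) = q"
      using True J card_Suc_Diff1[OF fin True] fin by (auto simp: J0_def)
    let ?s = "\<lambda>j. alt_sign G (below J0 j) (f (insert j J0))"
    let ?S = "\<Oplus>j\<in>{1..m} - J. ?s j"
    have S: "?S \<in> carrier G" using f by (intro finsum_closed) auto
    have W: "{1..m} - J0 = insert a ({1..m} - J)" using True J J0 by auto
    have "\<zero> = simplex_diff G m f J0" using cycle J0 by simp
    also have "\<dots> = ?s a \<oplus> ?S"
      unfolding simplex_diff_def W using True f by (subst finsum_insert) auto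
    also have "?s a = f J" using below_a[of J0 J] J J0(1) by (metis subset_insertI)
    finally have 1: "\<ominus> ?S = f J"
      using f S by (intro minus_equality) auto
    have "simplex_diff G m (\<lambda>J. if a \<in> J then f (J - {a}) else \<zero>) J = (\<Oplus>j\<in>{1..m} - J. \<ominus> ?s j)"
      unfolding simplex_diff_def
    proof (rule finsum_cong')
      fix j assume j: "j \<in> {1..m} - J"
      then have eq: "insert j J - {a} = insert j J0" using True J0 by auto
      have card: "insert j J0 \<subseteq> {1..m}" "card (insert j J0) = q" using j J0 by auto
      show "alt_sign G (below J j) (if a \<in> insert j J then f (insert j J - {a}) else \<zero>) = \<ominus> ?s j"
      proof (cases "f (insert j J0) = \<zero>")
        case T: True
        then show ?thesis using True alt_sign_Suc[of \<zero> 0] by (simp add: eq)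
      next
        case F: False
        then have "j \<in> A" using supp[OF card] by auto
        then have "a < j" using A(3)[of j] j True by (cases "a = j") auto
        then have "below J j = Suc (below J0 j)"
          using J0 by (simp add: below_insert)
        then show ?thesis using True f by (simp add: eq alt_sign_Suc)
      qed
    qed (use f in auto)
    also have "\<dots> = \<ominus> ?S"
      using alt_sign_finsum[of ?s "{1..m} - J" 1] f by (simp add: alt_sign_def Pi_iff)
    finally show ?thesis using 1 by simp
  qed
qed

end

section \<open>Connected components\<close>

lemma comparability_mono: "X \<subseteq> Y \<Longrightarrow> comparability X \<subseteq> comparability Y"
  by (auto simp: comparability_def)

lemma sym_comparability: "sym (comparability X)"
  by (auto simp: comparability_def sym_def)

lemma equiv_component:
  "equiv X {(x, y). x \<in> X \<and> y \<in> X \<and> (x, y) \<in> (comparability X)\<^sup>*}"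
proof (rule equivI)
  have "sym ((comparability X)\<^sup>*)" by (rule sym_rtrancl[OF sym_comparability])
  then show "sym {(x, y). x \<in> X \<and> y \<in> X \<and> (x, y) \<in> (comparability X)\<^sup>*}" by (auto simp: sym_def)
qed (auto simp: refl_on_def trans_def)

lemma pi0D:
  assumes "C \<in> pi0 X"
  shows "C \<noteq> {}" "C \<subseteq> X" "\<And>x y. x \<in> C \<Longrightarrow> y \<in> C \<Longrightarrow> (x, y) \<in> (comparability X)\<^sup>*"
    "\<And>x y. x \<in> C \<Longrightarrow> y \<in> X \<Longrightarrow> (x, y) \<in> (comparability X)\<^sup>* \<Longrightarrow> y \<in> C"
    "\<And>x y. x \<in> C \<Longrightarrow> y \<in> X \<Longrightarrow> x \<le> y \<or> y \<le> x \<Longrightarrow> y \<in> C"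
proof -
  let ?r = "{(x, y). x \<in> X \<and> y \<in> X \<and> (x, y) \<in> (comparability X)\<^sup>*}"
  have C: "C \<in> X // ?r" using assms by (simp add: pi0_def)
  show "C \<noteq> {}" "C \<subseteq> X"
    using in_quotient_imp_non_empty[OF equiv_component C] in_quotient_imp_subset[OF equiv_component C] .
  show "(x, y) \<in> (comparability X)\<^sup>*" if "x \<in> C" "y \<in> C" for x y
    using in_quotient_imp_in_rel[OF equiv_component C, of x y] that by simp
  show 1: "y \<in> C" if "x \<in> C" "y \<in> X" "(x, y) \<in> (comparability X)\<^sup>*" for x y
    using in_quotient_imp_closed[OF equiv_component C, of x y] that \<open>C \<subseteq> X\<close> by auto
  show "y \<in> C" if "x \<in> C" "y \<in> X" "x \<le> y \<or> y \<le> x" for x y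
    using 1[OF that(1,2)] that \<open>C \<subseteq> X\<close> by (auto simp: comparability_def)
qed

lemma pi0_eq:
  assumes "C \<in> pi0 X" "D \<in> pi0 X" "x \<in> C" "x \<in> D" shows "C = D"
  using quotient_disj[OF equiv_component] assms unfolding pi0_def by blast

lemma pi0_ex:
  assumes "x \<in> X" obtains C where "C \<in> pi0 X" "x \<in> C"
proof -
  let ?r = "{(x, y). x \<in> X \<and> y \<in> X \<and> (x, y) \<in> (comparability X)\<^sup>*}"
  have "?r `` {x} \<in> pi0 X" unfolding pi0_def by (rule quotientI[OF assms])
  moreover have "x \<in> ?r `` {x}" using assms by simp
  ultimately show ?thesis using that by blast
qed

lemma pi0_finite: "finite (pi0 (X :: 'p::{finite, order} set))"
  by (rule finite)

lemma pi0_connected: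
  assumes C: "C \<in> pi0 X" shows "poset_connected C"
  unfolding poset_connected_def
proof (intro ballI)
  fix x y assume x: "x \<in> C" and y: "y \<in> C"
  have "(x, y) \<in> (comparability X)\<^sup>*" using pi0D(3)[OF C x y] .
  then have "y \<in> C \<and> (x, y) \<in> (comparability C)\<^sup>*"
  proof (induction rule: rtrancl_induct)
    case (step y z)
    then have "z \<in> C" using pi0D(5)[OF C, of y z] by (auto simp: comparability_def)
    then have "(y, z) \<in> comparability C" using step by (auto simp: comparability_def)
    then show ?case using step \<open>z \<in> C\<close> by auto
  qed (use x in auto)
  then show "(x, y) \<in> (comparability C)\<^sup>*" by simp
qed

text \<open>Justifies the definite description: \<open>C\<close> is non-empty and its points stay
  connected in \<open>Y\<close>, so exactly one component contains it.\<close>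

lemma component_containing:
  assumes C: "C \<in> pi0 X" and XY: "X \<subseteq> Y"
  shows "component_containing Y C \<in> pi0 Y" "C \<subseteq> component_containing Y C"
    "\<And>D. D \<in> pi0 Y \<Longrightarrow> C \<subseteq> D \<Longrightarrow> component_containing Y C = D"
proof -
  obtain x where x: "x \<in> C" using pi0D(1)[OF C] by auto
  then obtain D where D: "D \<in> pi0 Y" "x \<in> D" using pi0D(2)[OF C] XY pi0_ex[of x Y] by blast
  have "y \<in> D" if y: "y \<in> C" for y
  proof (rule pi0D(4)[OF D(1) D(2)])
    show "y \<in> Y" using y pi0D(2)[OF C] XY by auto
    show "(x, y) \<in> (comparability Y)\<^sup>*"
      using pi0D(3)[OF C x y] rtrancl_mono[OF comparability_mono[OF XY]] by blast
  qed
  then have CD: "C \<subseteq> D" by blast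
  have "component_containing Y C = E" if "E \<in> pi0 Y" "C \<subseteq> E" for E
    unfolding component_containing_def
    by (rule the_equality) (use that x pi0_eq in blast)+
  then show "component_containing Y C \<in> pi0 Y" "C \<subseteq> component_containing Y C"
    "\<And>D. D \<in> pi0 Y \<Longrightarrow> C \<subseteq> D \<Longrightarrow> component_containing Y C = D"
    using D CD by auto
qed

lemma pi0_self:
  assumes "T \<in> poset_intervals" shows "pi0 T = {T}"
proof -
  have "C = T" if C: "C \<in> pi0 T" for C
  proof -
    obtain x where "x \<in> C" using pi0D(1)[OF C] by auto
    then show ?thesis
      using poset_connected_closed[of T C x] assms pi0D(2,5)[OF C] by (auto simp: poset_intervals_def)
  qed
  moreover obtain x where "x \<in> T" using assms by (auto simp: poset_intervals_def)
  then obtain C where "C \<in> pi0 T" by (rule pi0_ex)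
  ultimately show ?thesis by blast
qed

lemma relative_upset_convex:
  assumes "poset_convex T" "relative_upset X T" shows "poset_convex X"
  using assms unfolding poset_convex_def relative_upset_def by blast

lemma pi0_interval:
  assumes "poset_convex X" "C \<in> pi0 X" shows "C \<in> poset_intervals"
  unfolding poset_intervals_def
proof (intro CollectI conjI)
  show "poset_convex C"
    unfolding poset_convex_def
  proof (intro ballI allI impI)
    fix x y z assume "x \<in> C" "y \<in> C" "x \<le> z \<and> z \<le> y"
    then show "z \<in> C"
      using assms pi0D(2)[OF assms(2)] pi0D(5)[OF assms(2), of x z] unfolding poset_convex_def by blast
  qed
qed (use pi0D(1)[OF assms(2)] pi0_connected[OF assms(2)] in auto)

section \<open>Homomorphisms built from signs, sums and coordinates\<close>

lemma additive_uminus: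
  assumes "abelian_group M" "abelian_group N"
    and "\<And>x. x \<in> carrier M \<Longrightarrow> h x \<in> carrier N"
    and "\<And>x y. x \<in> carrier M \<Longrightarrow> y \<in> carrier M \<Longrightarrow> h (x \<oplus>\<^bsub>M\<^esub> y) = h x \<oplus>\<^bsub>N\<^esub> h y"
    and x: "x \<in> carrier M"
  shows "h (\<ominus>\<^bsub>M\<^esub> x) = \<ominus>\<^bsub>N\<^esub> h x"
proof -
  interpret M: abelian_group M by fact
  interpret N: abelian_group N by fact
  have "h \<zero>\<^bsub>M\<^esub> = \<zero>\<^bsub>N\<^esub>"
    using finsum_additive[where h = h and A = "{}" and f = "\<lambda>_. \<zero>\<^bsub>M\<^esub>", OF assms(1-4)] by simp
  then have "h (\<ominus>\<^bsub>M\<^esub> x) \<oplus>\<^bsub>N\<^esub> h x = \<zero>\<^bsub>N\<^esub>"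
    using assms(4)[of "\<ominus>\<^bsub>M\<^esub> x" x] x by (simp add: M.l_neg)
  then show ?thesis using assms(3) x N.minus_equality[of "h (\<ominus>\<^bsub>M\<^esub> x)" "h x"] by simp
qed

lemma lm_hom_alt_sign:
  assumes "left_module R N" "f \<in> lm_hom R M N"
  shows "(\<lambda>x. alt_sign N n (f x)) \<in> lm_hom R M N"
proof -
  interpret N: left_module R N by fact
  note f = lm_homD[OF assms(2)]
  show ?thesis
    by (rule lm_homI) (auto simp: alt_sign_def f N.M.minus_add N.smult_minus)
qed

lemma lm_hom_finsum_fun:
  assumes "left_module R N" "\<And>i. i \<in> I \<Longrightarrow> f i \<in> lm_hom R M N"
  shows "(\<lambda>x. \<Oplus>\<^bsub>N\<^esub>i\<in>I. f i x) \<in> lm_hom R M N"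
proof -
  interpret N: left_module R N by fact
  note f = lm_homD[OF assms(2)]
  show ?thesis
  proof (rule lm_homI)
    fix x assume x: "x \<in> carrier M"
    show "(\<Oplus>\<^bsub>N\<^esub>i\<in>I. f i x) \<in> carrier N" using f x by (intro N.M.finsum_closed) auto
    show "(\<Oplus>\<^bsub>N\<^esub>i\<in>I. f i (a \<odot>\<^bsub>M\<^esub> x)) = a \<odot>\<^bsub>N\<^esub> (\<Oplus>\<^bsub>N\<^esub>i\<in>I. f i x)" if a: "a \<in> carrier R" for a
    proof -
      have "a \<odot>\<^bsub>N\<^esub> (\<Oplus>\<^bsub>N\<^esub>i\<in>I. f i x) = (\<Oplus>\<^bsub>N\<^esub>i\<in>I. a \<odot>\<^bsub>N\<^esub> f i x)"
        by (rule finsum_additive[where h = "\<lambda>x. a \<odot>\<^bsub>N\<^esub> x"])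
          (use f x a N.M.abelian_group_axioms in \<open>auto simp: N.smult_r_distr\<close>)
      also have "\<dots> = (\<Oplus>\<^bsub>N\<^esub>i\<in>I. f i (a \<odot>\<^bsub>M\<^esub> x))"
        by (rule N.M.finsum_cong') (use f x a in auto)
      finally show ?thesis by simp
    qed
    fix y assume y: "y \<in> carrier M"
    have "(\<Oplus>\<^bsub>N\<^esub>i\<in>I. f i (x \<oplus>\<^bsub>M\<^esub> y)) = (\<Oplus>\<^bsub>N\<^esub>i\<in>I. f i x \<oplus>\<^bsub>N\<^esub> f i y)"
      by (rule N.M.finsum_cong') (use f x y in auto)
    also have "\<dots> = (\<Oplus>\<^bsub>N\<^esub>i\<in>I. f i x) \<oplus>\<^bsub>N\<^esub> (\<Oplus>\<^bsub>N\<^esub>i\<in>I. f i y)"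
      by (rule N.M.finsum_addf) (use f x y in auto)
    finally show "(\<Oplus>\<^bsub>N\<^esub>i\<in>I. f i (x \<oplus>\<^bsub>M\<^esub> y)) = (\<Oplus>\<^bsub>N\<^esub>i\<in>I. f i x) \<oplus>\<^bsub>N\<^esub> (\<Oplus>\<^bsub>N\<^esub>i\<in>I. f i y)" .
  qed
qed

lemma lm_dsum_coord_hom:
  assumes "i \<in> I" shows "(\<lambda>v. v i) \<in> lm_hom R (lm_dsum I M) (M i)"
  by (rule lm_homI) (use assms in auto)

section \<open>Exactness\<close>

locale upset_complex = interval_field K for K :: "'k ring" (structure) +
  fixes T :: "'p::{finite, order} set" and U :: "nat \<Rightarrow> 'p set" and m :: nat
  assumes T: "T \<in> poset_intervals"
    and U: "bij_betw U {1..m} (maximal_upset_intervals T)"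
begin

abbreviation "A \<equiv> (interval_alg K :: ('p, 'k) alg_elem ring)"
abbreviation "UJ \<equiv> upset_inter T U"
abbreviation "Q \<equiv> res_mod K T U m"
abbreviation "idx \<equiv> res_index T U m"
abbreviation "d \<equiv> res_diff K T U m"

definition "JJ q = {J. J \<subseteq> {1..m} \<and> card J = q}"

text \<open>
  The conditions in \<^const>\<open>hom_fun\<close> are local, so the summands of \<^term>\<open>Q q\<close> belonging to the
  components of \<^term>\<open>UJ J\<close> can be merged into a single function on \<^term>\<open>UJ J\<close>.
\<close>

definition phi :: "nat \<Rightarrow> (nat set \<times> 'p set \<Rightarrow> ('p, 'k) alg_elem) \<Rightarrow> nat set \<Rightarrow> 'p set \<Rightarrow> 'p \<Rightarrow> 'k" where
  "phi q y J R x = (if J \<in> JJ q then \<Oplus>C\<in>pi0 (UJ J). coef K (y (J, C)) R C x else \<zero>)"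

text \<open>For \<open>x\<close> in \<open>R \<inter> T\<close> this is its connected component
  there. For any other \<open>x\<close> it is the singleton of \<open>x\<close>, so \<open>x\<close>
  is always a member.\<close>

definition "comp_of R x = {y. (x, y) \<in> (comparability (R \<inter> T))\<^sup>*}"

text \<open>The vertex set of the simplex attached to the component. It depends on \<open>x\<close>
  only through \<open>comp_of R x\<close>.\<close>

definition "verts R x = {j \<in> {1..m}. comp_of R x \<subseteq> U j}"

lemma UD:
  assumes "j \<in> {1..m}"
  shows "U j \<in> upset_intervals T" "U j \<subseteq> T" "U j \<noteq> T"
  using bij_betwE[OF U] assms
  by (auto simp: maximal_upset_intervals_def upset_intervals_def relative_upset_def)

lemma proper_upset_sub:
  assumes "C \<in> upset_intervals T" "C \<noteq> T" shows "\<exists>j\<in>{1..m}. C \<subseteq> U j"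
proof -
  obtain V where V: "V \<in> upset_intervals T - {T}" "C \<subseteq> V"
    and max: "\<forall>W\<in>upset_intervals T - {T}. V \<subseteq> W \<longrightarrow> V = W"
    using finite_has_maximal2[of "upset_intervals T - {T}" C] assms by auto
  then have "V \<in> maximal_upset_intervals T" unfolding maximal_upset_intervals_def by blast
  then have "V \<in> U ` {1..m}" using U by (simp add: bij_betw_def)
  then show ?thesis using V by auto
qed

lemma UJ_iff:
  assumes "J \<subseteq> {1..m}" shows "x \<in> UJ J \<longleftrightarrow> x \<in> T \<and> (\<forall>j\<in>J. x \<in> U j)"
proof (cases "J = {}")
  case False
  then obtain j where "j \<in> J" "U j \<subseteq> T" using UD(2) assms by blast
  then show ?thesis by (auto simp: upset_inter_def)
qed (simp add: upset_inter_def)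

lemma UJ_upset:
  assumes "J \<subseteq> {1..m}" shows "relative_upset (UJ J) T"
  using assms UD(1) unfolding relative_upset_def upset_intervals_def
  by (auto simp: UJ_iff[OF assms]) (meson atLeastAtMost_iff subsetD)

lemma UJ_empty [simp]: "UJ {} = T"
  by (simp add: upset_inter_def)

lemma UJ_mono: "J' \<subseteq> J \<Longrightarrow> J \<subseteq> {1..m} \<Longrightarrow> UJ J \<subseteq> UJ J'"
proof -
  assume "J' \<subseteq> J" "J \<subseteq> {1..m}"
  moreover from this have "J' \<subseteq> {1..m}" by blast
  ultimately show ?thesis using UJ_iff[of J] UJ_iff[of J'] by blast
qed

lemma T_convex: "poset_convex T"
  using T by (simp add: poset_intervals_def)

lemma pi0_UJ:
  assumes "J \<subseteq> {1..m}" "C \<in> pi0 (UJ J)" shows "C \<in> poset_intervals"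
  by (rule pi0_interval[OF relative_upset_convex[OF T_convex UJ_upset[OF assms(1)]] assms(2)])

text \<open>A point of \<open>D\<close> above \<open>C\<close> lies in \<open>UJ J\<close>, which is
  an upset of \<open>T\<close>; being comparable with a point of \<open>C\<close>, it lies in the
  same component.\<close>

lemma pi0_upset_interval:
  assumes "J \<subseteq> {1..m}" "J' \<subseteq> J" "C \<in> pi0 (UJ J)" "D \<in> pi0 (UJ J')" "C \<subseteq> D"
  shows "C \<in> upset_intervals D"
proof -
  have "x \<in> C" if "c \<in> C" "x \<in> D" "c \<le> x" for c x
  proof -
    have "x \<in> T" using that(2) pi0D(2)[OF assms(4)] UJ_iff[of J' x] assms(1,2) by auto
    moreover have "c \<in> UJ J" using that(1) pi0D(2)[OF assms(3)] by auto
    ultimately have "x \<in> UJ J" using UJ_upset[OF assms(1)] that(3) unfolding relative_upset_def by blast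
    then show ?thesis using pi0D(5)[OF assms(3) that(1)] that(3) by blast
  qed
  then show ?thesis
    using pi0_UJ[OF assms(1,3)] assms(5) unfolding upset_intervals_def relative_upset_def by blast
qed

section \<open>The terms of the complex\<close>

lemma JJ_D: assumes "J \<in> JJ q" shows "J \<subseteq> {1..m}" "card J = q" "finite J"
  using assms finite_subset[of J "{1..m}"] by (auto simp: JJ_def)

lemma finite_JJ: "finite (JJ q)"
  by (rule finite_subset[of _ "Pow {1..m}"]) (auto simp: JJ_def)

lemma idx_Sigma: "idx q = Sigma (JJ q) (\<lambda>J. pi0 (UJ J))"
  by (auto simp: res_index_def JJ_def)

lemma idx_finite: "finite (idx q)"
  unfolding idx_Sigma by (intro finite_SigmaI finite_JJ pi0_finite)

lemma idx_interval: "i \<in> idx q \<Longrightarrow> snd i \<in> poset_intervals"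
  using pi0_UJ by (auto simp: idx_Sigma JJ_def)

lemma Q_eq: "Q q = lm_dsum (idx q) (\<lambda>i. proj_mod K (snd i))"
  by (simp add: res_mod_def split_def)

lemma incl_eq: "res_incl K T U m q = lm_incl (idx q) (\<lambda>i. proj_mod K (snd i))"
  by (simp add: res_incl_def split_def)

lemma ring_A: "ring A"
  by (rule ring_interval_alg)

lemma Q_module: "left_module A (Q q)"
  unfolding Q_eq by (intro left_module_dsum ring_A left_module_proj_mod idx_interval)

lemma Q_principal:
  "\<forall>i\<in>idx q. alg_idem K (snd i) \<in> carrier A \<and> alg_idem K (snd i) \<otimes>\<^bsub>A\<^esub> alg_idem K (snd i) = alg_idem K (snd i)"
  "\<forall>i\<in>idx q. proj_mod K (snd i) = lm_restrict (regular_lm A) {a \<otimes>\<^bsub>A\<^esub> alg_idem K (snd i) |a. a \<in> carrier A}"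
  using alg_idem[OF idx_interval] by (auto simp: proj_mod_def)

lemma Q_projective: "projective_lm tx ty A (Q q)"
  unfolding Q_eq by (rule ring.projective_dsum_principal[OF ring_A idx_finite Q_principal])

lemma Q_fin_gen: "lm_fin_gen A (Q q)"
  unfolding Q_eq by (rule ring.fin_gen_dsum_principal[OF ring_A idx_finite Q_principal])

section \<open>Elements of the complex as scalar families on the intersections\<close>

lemma Q_carrierD:
  assumes "y \<in> carrier (Q q)" "(J, C) \<in> idx q"
  shows "y (J, C) \<in> carrier (proj_mod K C)" "y (J, C) \<in> carrier A"
    "hom_fun K R C (coef K (y (J, C)) R C)"
proof -
  have "y (J, C) \<in> carrier (proj_mod K (snd (J, C)))" using assms unfolding Q_eq lm_dsum_simps by (rule PiE_mem)
  then show 1: "y (J, C) \<in> carrier (proj_mod K C)" by simp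
  have C: "C \<in> poset_intervals" using idx_interval[OF assms(2)] by simp
  show "y (J, C) \<in> carrier A" by (rule proj_carrierD[OF 1 C])
  then show "hom_fun K R C (coef K (y (J, C)) R C)" by (rule hom_fun_coef)
qed

lemma phi_comp:
  assumes y: "y \<in> carrier (Q q)" and J: "J \<in> JJ q" and C: "C \<in> pi0 (UJ J)" "x \<in> C"
  shows "phi q y J R x = coef K (y (J, C)) R C x"
proof -
  have cl: "coef K (y (J, D)) R D x \<in> carrier K" if "D \<in> pi0 (UJ J)" for D
    using Q_carrierD(3)[OF y, of J D R] that J by (auto simp: idx_Sigma hom_fun_def)
  have "(\<Oplus>D\<in>pi0 (UJ J). coef K (y (J, D)) R D x) =
    (\<Oplus>D\<in>pi0 (UJ J). if D = C then coef K (y (J, D)) R D x else \<zero>)"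
  proof (rule finsum_cong')
    fix D assume D: "D \<in> pi0 (UJ J)"
    show "coef K (y (J, D)) R D x = (if D = C then coef K (y (J, D)) R D x else \<zero>)"
    proof (cases "D = C")
      case False
      then have "x \<notin> D" using pi0_eq[OF D C(1) _ C(2)] by blast
      then show ?thesis using False by (simp add: coef_def)
    qed simp
  qed (use cl in auto)
  also have "\<dots> = coef K (y (J, C)) R C x" using C cl by (subst finsum_delta) auto
  finally show ?thesis using J by (simp add: phi_def)
qed

lemma phi_out:
  assumes "x \<notin> UJ J" shows "phi q y J R x = \<zero>"
proof -
  have "x \<notin> C" if "C \<in> pi0 (UJ J)" for C using pi0D(2)[OF that] assms by blast
  then show ?thesis
    unfolding phi_def by (auto intro!: add.finprod_one_eqI simp: coef_def)
qed

lemma phi_closed [simp]: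
  assumes "y \<in> carrier (Q q)" shows "phi q y J R x \<in> carrier K"
  using Q_carrierD(3)[OF assms, of J _ R]
  by (auto simp: phi_def idx_Sigma hom_fun_def intro!: finsum_closed)

text \<open>Comparable points of \<open>UJ J\<close> lie in one component, where the condition is
  that of a single summand. If the lower point is outside \<open>UJ J\<close>, its scalar is zero,
  and the condition for the component of the upper point makes that scalar zero too.\<close>

lemma phi_hom_fun:
  assumes y: "y \<in> carrier (Q q)" and J: "J \<in> JJ q"
  shows "hom_fun K R (UJ J) (phi q y J R)"
  unfolding hom_fun_def
proof (intro conjI allI impI)
  fix x assume x: "x \<notin> R \<inter> UJ J"
  show "phi q y J R x = \<zero>"
  proof (cases "x \<in> UJ J")
    case True
    then obtain C where C: "C \<in> pi0 (UJ J)" "x \<in> C" by (rule pi0_ex)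
    then show ?thesis unfolding phi_comp[OF y J C] using x True by (simp add: coef_def)
  qed (rule phi_out)
next
  fix x z assume xz: "x \<le> z \<and> x \<in> R \<and> z \<in> UJ J"
  then obtain C where C: "C \<in> pi0 (UJ J)" "z \<in> C" using pi0_ex by blast
  have h: "hom_fun K R C (coef K (y (J, C)) R C)"
    by (rule Q_carrierD(3)[OF y]) (use J C in \<open>auto simp: idx_Sigma\<close>)
  have eq: "coef K (y (J, C)) R C x = coef K (y (J, C)) R C z"
    using hom_funD(4)[OF h] xz C by blast
  show "phi q y J R x = phi q y J R z"
  proof (cases "x \<in> UJ J")
    case True
    then have "x \<in> C" using pi0D(5)[OF C] xz by blast
    then show ?thesis using eq phi_comp[OF y J C] phi_comp[OF y J C(1), of x R] by simp
  next
    case False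
    then have "x \<notin> C" using pi0D(2)[OF C(1)] by auto
    then show ?thesis using eq phi_comp[OF y J C] phi_out[OF False] by (simp add: coef_def)
  qed
qed (use y in simp)

lemma Q_eqI:
  assumes y: "y \<in> carrier (Q q)" and z: "z \<in> carrier (Q q)"
    and eq: "\<And>J R x. J \<in> JJ q \<Longrightarrow> phi q y J R x = phi q z J R x"
  shows "y = z"
proof (rule PiE_ext)
  show "y \<in> (\<Pi>\<^sub>E i\<in>idx q. carrier (proj_mod K (snd i)))" "z \<in> (\<Pi>\<^sub>E i\<in>idx q. carrier (proj_mod K (snd i)))"
    using y z by (simp_all add: Q_eq)
  fix i assume i: "i \<in> idx q"
  obtain J C where JC: "i = (J, C)" by (cases i)
  have J: "J \<in> JJ q" "C \<in> pi0 (UJ J)" using i by (auto simp: JC idx_Sigma)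
  have "coef K (y (J, C)) R C x = coef K (z (J, C)) R C x" for R x
  proof (cases "x \<in> C")
    case True
    then show ?thesis using eq[OF J(1)] phi_comp[OF y J True] phi_comp[OF z J True] by metis
  qed (simp add: coef_def)
  then show "y i = z i"
    unfolding JC using i idx_interval[OF i] Q_carrierD(1)[OF y] Q_carrierD(1)[OF z]
    by (intro proj_eqI[of C]) (auto simp: JC)
qed

text \<open>With \<open>Q_eqI\<close> this identifies \<open>Q q\<close> with its merged scalar
  families. It allows the contraction to be written as a formula in scalars, without reference to
  components of the intersections.\<close>

lemma Q_ex:
  assumes h: "\<And>J R. J \<in> JJ q \<Longrightarrow> R \<in> poset_intervals \<Longrightarrow> hom_fun K R (UJ J) (\<psi> J R)"
  obtains y where "y \<in> carrier (Q q)"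
    "\<And>J R x. J \<in> JJ q \<Longrightarrow> R \<in> poset_intervals \<Longrightarrow> phi q y J R x = \<psi> J R x"
proof -
  define c where "c J C R S x = (if R \<in> poset_intervals \<and> S = C \<and> x \<in> C then \<psi> J R x else \<zero>)" for J and C R S :: "'p set" and x
  have c: "matrix_fun K (c J C)" if JC: "(J, C) \<in> idx q" for J C
  proof -
    have J: "J \<in> JJ q" "C \<in> pi0 (UJ J)" using JC by (auto simp: idx_Sigma)
    have CI: "C \<in> poset_intervals" using idx_interval[OF JC] by simp
    have "hom_fun K R S (c J C R S)" for R S
    proof (cases "R \<in> poset_intervals \<and> S = C")
      case True
      note hh = hom_funD[OF h[OF J(1)], of R]
      show ?thesis
        unfolding hom_fun_def
      proof (intro conjI allI impI)
        fix x y assume xy: "x \<le> y \<and> x \<in> R \<and> y \<in> S"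
        then have y: "y \<in> UJ J" "y \<in> C" using True pi0D(2)[OF J(2)] by auto
        have e: "\<psi> J R x = \<psi> J R y" using hh(4)[of x y] True xy y by auto
        show "c J C R S x = c J C R S y"
        proof (cases "x \<in> C")
          case False
          \<comment> \<open>A point below \<open>y\<close> and outside the component of
            \<open>y\<close> cannot belong to \<open>UJ J\<close>, so cutting the family along
            components breaks no instance of the third clause.\<close>
          then have "x \<notin> UJ J" using pi0D(5)[OF J(2) y(2), of x] xy by auto
          then have "\<psi> J R x = \<zero>" using hh(3)[of x] True by auto
          then show ?thesis using e by (simp add: c_def)
        qed (use e y in \<open>simp add: c_def\<close>)
      qed (use True hh in \<open>auto simp: c_def\<close>)
    qed (auto simp: c_def hom_fun_def)
    then show ?thesis using CI by (auto simp: matrix_fun_def c_def)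
  qed
  define y where "y = (\<lambda>i\<in>idx q. alg_of K (c (fst i) (snd i)))"
  have cf: "coef K (y (J, C)) R S x = c J C R S x" if "(J, C) \<in> idx q" for J C R S x
    using that coef_alg_of[OF c[OF that]] by (simp add: y_def)
  have "y (J, C) \<in> carrier (proj_mod K C)" if "(J, C) \<in> idx q" for J C
    using idx_interval[OF that] that alg_of_closed[OF c[OF that]]
    by (simp add: proj_mod_carrier y_def coef_alg_of[OF c[OF that]]) (simp add: c_def)
  then have y: "y \<in> carrier (Q q)" by (auto simp: Q_eq y_def)
  moreover have "phi q y J R x = \<psi> J R x" if J: "J \<in> JJ q" and R: "R \<in> poset_intervals" for J R x
  proof (cases "x \<in> UJ J")
    case True
    then obtain C where C: "C \<in> pi0 (UJ J)" "x \<in> C" by (rule pi0_ex)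
    then have "(J, C) \<in> idx q" using J by (auto simp: idx_Sigma)
    then show ?thesis using phi_comp[OF y J C] R C(2) by (simp add: cf c_def)
  next
    case False
    then have "\<psi> J R x = \<zero>" using hom_funD(3)[OF h[OF J R], of x] by blast
    then show ?thesis using phi_out[OF False, of q y R] by simp
  qed
  ultimately show ?thesis using that by blast
qed

lemma phi_add:
  assumes y: "y \<in> carrier (Q q)" and z: "z \<in> carrier (Q q)"
  shows "phi q (y \<oplus>\<^bsub>Q q\<^esub> z) J R x = phi q y J R x \<oplus> phi q z J R x"
proof (cases "J \<in> JJ q")
  case True
  have i: "(J, C) \<in> idx q" if "C \<in> pi0 (UJ J)" for C using True that by (simp add: idx_Sigma)
  have "(\<Oplus>C\<in>pi0 (UJ J). coef K ((y \<oplus>\<^bsub>Q q\<^esub> z) (J, C)) R C x) =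
     (\<Oplus>C\<in>pi0 (UJ J). coef K (y (J, C)) R C x \<oplus> coef K (z (J, C)) R C x)"
    by (rule finsum_cong') (use i Q_carrierD(2)[OF y] Q_carrierD(2)[OF z] in \<open>auto simp: Q_eq coef_add\<close>)
  also have "\<dots> = phi q y J R x \<oplus> phi q z J R x"
  proof -
    have "coef K (y (J, C)) R C x \<in> carrier K" "coef K (z (J, C)) R C x \<in> carrier K" if "C \<in> pi0 (UJ J)" for C
      using Q_carrierD(2)[OF y i[OF that]] Q_carrierD(2)[OF z i[OF that]] by auto
    then show ?thesis using True unfolding phi_def by (simp add: finsum_addf Pi_iff)
  qed
  finally show ?thesis using True by (simp add: phi_def)
qed (simp add: phi_def)

lemma Q_group: "abelian_group (Q q)"
  using left_module.axioms(2)[OF Q_module] .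

lemma phi_finsum:
  assumes "f \<in> I \<rightarrow> carrier (Q q)"
  shows "phi q (finsum (Q q) f I) J R x = (\<Oplus>i\<in>I. phi q (f i) J R x)"
  by (rule finsum_additive[where h = "\<lambda>y. phi q y J R x", OF Q_group abelian_group_axioms _ _ assms])
    (simp_all add: phi_add)

lemma phi_alt_sign:
  assumes "y \<in> carrier (Q q)"
  shows "phi q (alt_sign (Q q) n y) J R x = alt_sign K n (phi q y J R x)"
  using additive_uminus[where h = "\<lambda>y. phi q y J R x", OF Q_group abelian_group_axioms _ _ assms]
  by (simp add: alt_sign_def phi_add)

lemma incl_hom: "(J, C) \<in> idx q \<Longrightarrow> res_incl K T U m q (J, C) \<in> lm_hom A (proj_mod K C) (Q q)"
  using lm_incl_hom[of A "idx q" "\<lambda>i. proj_mod K (snd i)" "(J, C)"] ring_A left_module_proj_mod idx_interval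
  unfolding Q_eq incl_eq by force

lemma phi_incl:
  assumes i: "(J', D) \<in> idx q" and p: "p \<in> carrier (proj_mod K D)" and J: "J \<in> JJ q"
  shows "phi q (res_incl K T U m q (J', D) p) J R x = (if J = J' then coef K p R D x else \<zero>)"
proof -
  have pA: "p \<in> carrier A" using p idx_interval[OF i] by (simp add: proj_carrierD)
  have "(\<Oplus>C\<in>pi0 (UJ J). coef K (res_incl K T U m q (J', D) p (J, C)) R C x) =
    (\<Oplus>C\<in>pi0 (UJ J). if C = D then if J = J' then coef K p R D x else \<zero> else \<zero>)"
    by (rule finsum_cong') (use J pA in \<open>auto simp: incl_eq lm_incl_def idx_Sigma\<close>)
  also have "\<dots> = (if J = J' then coef K p R D x else \<zero>)"
    using i pA J by (subst finsum_delta) (auto simp: idx_Sigma)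
  finally show ?thesis using J by (simp add: phi_def)
qed

section \<open>The differential in coordinates\<close>

definition face_map where
  "face_map q i r y = res_incl K T U m q (face (fst i) r, face_comp T U (fst i) (snd i) r)
     (proj_push K (snd i) (face_comp T U (fst i) (snd i) r) (interval_incl K (snd i) (face_comp T U (fst i) (snd i) r)) y)"

lemma face_sub:
  assumes "J \<in> JJ (Suc q)" "r < Suc q"
  shows "face J r \<in> JJ q" "face J r \<subseteq> J"
proof -
  have "sorted_list_of_set J ! r \<in> set (sorted_list_of_set J)"
    using JJ_D[OF assms(1)] assms(2) by (intro nth_mem) simp
  then have "sorted_list_of_set J ! r \<in> J" using JJ_D(3)[OF assms(1)] by simp
  then show "face J r \<in> JJ q" "face J r \<subseteq> J"
    using JJ_D[OF assms(1)] by (auto simp: face_def JJ_def)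
qed

lemma face_comp:
  assumes i: "(J, C) \<in> idx (Suc q)" and r: "r < Suc q"
  shows "(face J r, face_comp T U J C r) \<in> idx q" "C \<in> upset_intervals (face_comp T U J C r)"
    "face_comp T U J C r \<in> poset_intervals"
proof -
  have J: "J \<in> JJ (Suc q)" and C: "C \<in> pi0 (UJ J)" using i by (auto simp: idx_Sigma)
  note f = face_sub[OF J r]
  note cc = component_containing[OF C UJ_mono[OF f(2) JJ_D(1)[OF J]]]
  show 1: "(face J r, face_comp T U J C r) \<in> idx q"
    using f(1) cc(1) by (simp add: idx_Sigma face_comp_def)
  show "C \<in> upset_intervals (face_comp T U J C r)"
    unfolding face_comp_def by (rule pi0_upset_interval[OF JJ_D(1)[OF J] f(2) C cc(1,2)])
  show "face_comp T U J C r \<in> poset_intervals" using idx_interval[OF 1] by simp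
qed

lemma face_map_hom:
  assumes i: "i \<in> idx (Suc q)" and r: "r < Suc q"
  shows "face_map q i r \<in> lm_hom A (proj_mod K (snd i)) (Q q)"
proof -
  obtain J C where JC: "i = (J, C)" by (cases i)
  note f = face_comp[OF i[unfolded JC] r]
  have "face_map q i r = res_incl K T U m q (face J r, face_comp T U J C r) \<circ>
    proj_push K C (face_comp T U J C r) (interval_incl K C (face_comp T U J C r))"
    by (auto simp: face_map_def JC)
  then show ?thesis
    using lm_hom_compose[OF proj_push_hom[OF f(2,3)] incl_hom[OF f(1)]] by (simp add: JC)
qed

text \<open>Pushing along an inclusion keeps all scalars, and \<open>phi\<close> forgets the
  component to which a summand belongs. Only the index set changes.\<close>

lemma phi_face_map:
  assumes i: "(J, C) \<in> idx (Suc q)" and r: "r < Suc q" and J': "J' \<in> JJ q"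
    and p: "p \<in> carrier (proj_mod K C)"
  shows "phi q (face_map q (J, C) r p) J' R x = (if face J r = J' then coef K p R C x else \<zero>)"
proof -
  note f = face_comp[OF i r]
  have pA: "p \<in> carrier A" using p idx_interval[OF i] by (simp add: proj_carrierD)
  have "phi q (face_map q (J, C) r p) J' R x = (if J' = face J r then
    coef K (p \<otimes>\<^bsub>A\<^esub> incl_elem K C (face_comp T U J C r)) R (face_comp T U J C r) x else \<zero>)"
    using phi_incl[OF f(1) lm_homD(1)[OF proj_push_hom[OF f(2,3)] p] J']
    by (simp add: face_map_def proj_push_eq)
  also have "\<dots> = (if face J r = J' then coef K p R C x else \<zero>)"
    unfolding coef_mult_incl[OF pA f(2,3)] by (auto simp: coef_def)
  finally show ?thesis .
qed

lemma summand_eq: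
  assumes i: "i \<in> idx (Suc q)" and y: "y \<in> carrier (proj_mod K (snd i))"
  shows "res_diff_summand K T U m (Suc q) i y = (\<Oplus>\<^bsub>Q q\<^esub>r\<in>{..<Suc q}. alt_sign (Q q) r (face_map q i r y))"
proof -
  interpret Qq: abelian_group "Q q" by (rule Q_group)
  obtain J C where JC: "i = (J, C)" by (cases i)
  have cl: "face_map q i r y \<in> carrier (Q q)" if "r < Suc q" for r
    by (rule lm_homD(1)[OF face_map_hom[OF i that] y])
  have "(\<Oplus>\<^bsub>Q q\<^esub>r\<in>{..<Suc q}. [((-1) ^ r :: int)] \<cdot>\<^bsub>Q q\<^esub> face_map q i r y) =
    (\<Oplus>\<^bsub>Q q\<^esub>r\<in>{..<Suc q}. alt_sign (Q q) r (face_map q i r y))"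
    by (rule Qq.finsum_cong') (use cl in \<open>auto simp: Qq.add_pow_alt_sign\<close>)
  then show ?thesis by (simp add: res_diff_summand_def JC Let_def face_map_def)
qed

lemma d_eq:
  assumes y: "y \<in> carrier (Q (Suc q))"
  shows "d (Suc q) y = (\<Oplus>\<^bsub>Q q\<^esub>i\<in>idx (Suc q). \<Oplus>\<^bsub>Q q\<^esub>r\<in>{..<Suc q}. alt_sign (Q q) r (face_map q i r (y i)))"
proof -
  interpret Qq: abelian_group "Q q" by (rule Q_group)
  have yi: "y i \<in> carrier (proj_mod K (snd i))" if "i \<in> idx (Suc q)" for i
    using Q_carrierD(1)[OF y] that by (cases i) auto
  have cl: "face_map q i r (y i) \<in> carrier (Q q)" if "i \<in> idx (Suc q)" "r < Suc q" for i r
    by (rule lm_homD(1)[OF face_map_hom[OF that] yi[OF that(1)]])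
  show ?thesis
    unfolding res_diff_def diff_Suc_1
    by (rule Qq.finsum_cong') (use cl yi in \<open>auto simp: summand_eq intro!: Qq.finsum_closed\<close>)
qed

lemma d_hom: "d (Suc q) \<in> lm_hom A (Q (Suc q)) (Q q)"
proof -
  let ?d = "\<lambda>y. \<Oplus>\<^bsub>Q q\<^esub>i\<in>idx (Suc q). \<Oplus>\<^bsub>Q q\<^esub>r\<in>{..<Suc q}. alt_sign (Q q) r (face_map q i r (y i))"
  have "(\<lambda>y. alt_sign (Q q) r (face_map q i r (y i))) \<in> lm_hom A (Q (Suc q)) (Q q)"
    if i: "i \<in> idx (Suc q)" and r: "r < Suc q" for i r
  proof -
    have "(\<lambda>y. y i) \<in> lm_hom A (Q (Suc q)) (proj_mod K (snd i))"
      unfolding Q_eq by (rule lm_dsum_coord_hom[OF i])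
    from lm_hom_alt_sign[OF Q_module lm_hom_compose[OF this face_map_hom[OF i r]], of r]
    show ?thesis by (simp add: comp_def)
  qed
  then have "?d \<in> lm_hom A (Q (Suc q)) (Q q)"
    by (intro lm_hom_finsum_fun Q_module) auto
  note h = lm_homD[OF this]
  interpret S: left_module A "Q (Suc q)" by (rule Q_module)
  show ?thesis
    by (rule lm_homI) (use h in \<open>simp_all add: d_eq\<close>)
qed

text \<open>Since the face maps keep scalars, the sum over components can be pulled inside and
  merged into \<open>phi\<close>. What is left is a signed sum over pairs \<open>(J, r)\<close>
  whose face is \<open>J'\<close>, and such pairs correspond to the vertices that can be added to
  \<open>J'\<close>.\<close>

lemma phi_diff:
  assumes y: "y \<in> carrier (Q (Suc q))" and J': "J' \<in> JJ q"
  shows "phi q (d (Suc q) y) J' R x = simplex_diff K m (\<lambda>J. phi (Suc q) y J R x) J'"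
proof -
  interpret Qq: abelian_group "Q q" by (rule Q_group)
  note J'D = JJ_D[OF J']
  define cy where "cy J C = coef K (y (J, C)) R C x" for J C
  have yi: "y i \<in> carrier (proj_mod K (snd i))" if "i \<in> idx (Suc q)" for i
    using Q_carrierD(1)[OF y] that by (cases i) auto
  have cy: "cy J C \<in> carrier K" if "J \<in> JJ (Suc q)" "C \<in> pi0 (UJ J)" for J C
    using Q_carrierD(2)[OF y, of J C] that by (auto simp: idx_Sigma cy_def)
  have cl: "face_map q i r (y i) \<in> carrier (Q q)" if "i \<in> idx (Suc q)" "r < Suc q" for i r
    by (rule lm_homD(1)[OF face_map_hom[OF that] yi[OF that(1)]])
  \<comment> \<open>The contribution of the face in position \<open>r\<close>; it is additive in
    \<open>z\<close>, so it commutes with the sum over components.\<close>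
  define g where "g J r z = alt_sign K r (if face J r = J' then z else \<zero>)" for J r z
  have g: "g J r z \<in> carrier K" if "z \<in> carrier K" for J r z using that by (simp add: g_def)
  have "phi q (d (Suc q) y) J' R x =
    (\<Oplus>i\<in>idx (Suc q). phi q (\<Oplus>\<^bsub>Q q\<^esub>r\<in>{..<Suc q}. alt_sign (Q q) r (face_map q i r (y i))) J' R x)"
    unfolding d_eq[OF y] by (rule phi_finsum) (use cl in \<open>auto intro!: Qq.finsum_closed\<close>)
  also have "\<dots> = (\<Oplus>i\<in>idx (Suc q). \<Oplus>r\<in>{..<Suc q}. g (fst i) r (cy (fst i) (snd i)))"
  proof (rule finsum_cong')
    fix i assume i: "i \<in> idx (Suc q)"
    obtain J C where JC: "i = (J, C)" by (cases i)
    have "phi q (\<Oplus>\<^bsub>Q q\<^esub>r\<in>{..<Suc q}. alt_sign (Q q) r (face_map q i r (y i))) J' R x =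
      (\<Oplus>r\<in>{..<Suc q}. phi q (alt_sign (Q q) r (face_map q i r (y i))) J' R x)"
      by (rule phi_finsum) (use cl i in auto)
    also have "\<dots> = (\<Oplus>r\<in>{..<Suc q}. g J r (cy J C))"
    proof (rule finsum_cong')
      fix r assume r: "r \<in> {..<Suc q}"
      show "phi q (alt_sign (Q q) r (face_map q i r (y i))) J' R x = g J r (cy J C)"
        using phi_alt_sign[OF cl[OF i]] r phi_face_map[OF i[unfolded JC] _ J', of r "y i" R x] yi[OF i]
        by (auto simp: g_def cy_def JC)
    qed (use i JC in \<open>auto intro!: g cy simp: idx_Sigma\<close>)
    finally show "phi q (\<Oplus>\<^bsub>Q q\<^esub>r\<in>{..<Suc q}. alt_sign (Q q) r (face_map q i r (y i))) J' R x =
      (\<Oplus>r\<in>{..<Suc q}. g (fst i) r (cy (fst i) (snd i)))" by (simp add: JC)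
  qed (auto intro!: finsum_closed g cy simp: idx_Sigma)
  also have "\<dots> = (\<Oplus>J\<in>JJ (Suc q). \<Oplus>C\<in>pi0 (UJ J). \<Oplus>r\<in>{..<Suc q}. g J r (cy J C))"
    unfolding idx_Sigma
    by (subst finsum_Sigma) (auto intro!: finsum_closed g cy finite_JJ pi0_finite)
  also have "\<dots> = (\<Oplus>J\<in>JJ (Suc q). \<Oplus>r\<in>{..<Suc q}. g J r (phi (Suc q) y J R x))"
  proof (rule finsum_cong')
    fix J assume J: "J \<in> JJ (Suc q)"
    have "(\<Oplus>C\<in>pi0 (UJ J). \<Oplus>r\<in>{..<Suc q}. g J r (cy J C)) = (\<Oplus>r\<in>{..<Suc q}. \<Oplus>C\<in>pi0 (UJ J). g J r (cy J C))"
      by (rule finsum_swap) (use g cy J pi0_finite in auto)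
    also have "\<dots> = (\<Oplus>r\<in>{..<Suc q}. g J r (phi (Suc q) y J R x))"
    proof (rule finsum_cong')
      fix r assume "r \<in> {..<Suc q}"
      have "phi (Suc q) y J R x = (\<Oplus>C\<in>pi0 (UJ J). cy J C)" using J by (simp add: phi_def cy_def)
      then show "(\<Oplus>C\<in>pi0 (UJ J). g J r (cy J C)) = g J r (phi (Suc q) y J R x)"
        using alt_sign_finsum[of "cy J" "pi0 (UJ J)" r] cy[OF J]
        by (auto simp: g_def intro!: add.finprod_one_eqI)
    qed (use g y in auto)
    finally show "(\<Oplus>C\<in>pi0 (UJ J). \<Oplus>r\<in>{..<Suc q}. g J r (cy J C)) = (\<Oplus>r\<in>{..<Suc q}. g J r (phi (Suc q) y J R x))" .
  qed (use g y in \<open>auto intro!: finsum_closed\<close>)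
  \<comment> \<open>An index set that is not \<open>J'\<close> with one further vertex has no face
    equal to \<open>J'\<close>.\<close>
  also have "\<dots> = (\<Oplus>J\<in>(\<lambda>j. insert j J') ` ({1..m} - J'). \<Oplus>r\<in>{..<Suc q}. g J r (phi (Suc q) y J R x))"
  proof (rule add.finprod_mono_neutral_cong_right)
    show "(\<lambda>j. insert j J') ` ({1..m} - J') \<subseteq> JJ (Suc q)" using J'D by (auto simp: JJ_def)
    fix J assume J: "J \<in> JJ (Suc q) - (\<lambda>j. insert j J') ` ({1..m} - J')"
    have "g J r z = \<zero>" if "r < Suc q" for r z
    proof -
      have "face J r \<noteq> J'"
        using face_eq_iff[of J r J'] J JJ_D[of J "Suc q"] that by auto
      then show ?thesis by (simp add: g_def)
    qed
    then show "(\<Oplus>r\<in>{..<Suc q}. g J r (phi (Suc q) y J R x)) = \<zero>"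
      by (intro add.finprod_one_eqI) auto
  qed (use g y finite_JJ in \<open>auto intro!: finsum_closed\<close>)
  also have "\<dots> = (\<Oplus>j\<in>{1..m} - J'. \<Oplus>r\<in>{..<Suc q}. g (insert j J') r (phi (Suc q) y (insert j J') R x))"
    by (rule finsum_reindex) (use g y in \<open>auto intro!: finsum_closed simp: inj_on_def\<close>)
  also have "\<dots> = simplex_diff K m (\<lambda>J. phi (Suc q) y J R x) J'"
    unfolding simplex_diff_def
  proof (rule finsum_cong')
    fix j assume j: "j \<in> {1..m} - J'"
    let ?J = "insert j J'"
    have J: "finite ?J" "card ?J = Suc q" using j J'D by auto
    have le: "below J' j \<le> q" unfolding below_def J'D(2)[symmetric] by (rule card_mono) (use J'D in auto)
    have "(\<Oplus>r\<in>{..<Suc q}. g ?J r (phi (Suc q) y ?J R x)) =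
      (\<Oplus>r\<in>{..<Suc q}. if r = below J' j then alt_sign K r (phi (Suc q) y ?J R x) else \<zero>)"
    proof (rule finsum_cong')
      fix r assume r: "r \<in> {..<Suc q}"
      \<comment> \<open>The added vertex is determined by \<open>?J\<close> and \<open>J'\<close>,
        so exactly one position \<open>r\<close> contributes.\<close>
      have "face ?J r = J' \<longleftrightarrow> r = below J' j"
      proof -
        have "face ?J r = J' \<longleftrightarrow> (\<exists>i. i \<notin> J' \<and> ?J = insert i J' \<and> r = below J' i)"
          by (rule face_eq_iff) (use J r in auto)
        also have "\<dots> \<longleftrightarrow> r = below J' j" using j by (auto simp: insert_ident)
        finally show ?thesis .
      qed
      then show "g ?J r (phi (Suc q) y ?J R x) = (if r = below J' j then alt_sign K r (phi (Suc q) y ?J R x) else \<zero>)"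
        by (simp add: g_def)
    qed (use y in auto)
    also have "\<dots> = alt_sign K (below J' j) (phi (Suc q) y ?J R x)"
      using le y by (subst finsum_delta) auto
    finally show "(\<Oplus>r\<in>{..<Suc q}. g ?J r (phi (Suc q) y ?J R x)) =
      alt_sign K (below J' j) (phi (Suc q) y ?J R x)" .
  qed (use y in auto)
  finally show ?thesis .
qed

lemma d_closed: "y \<in> carrier (Q (Suc q)) \<Longrightarrow> d (Suc q) y \<in> carrier (Q q)"
  by (rule lm_homD(1)[OF d_hom])

lemma insert_JJ:
  assumes "J \<in> JJ q" "j \<in> {1..m} - J" shows "insert j J \<in> JJ (Suc q)"
  unfolding JJ_def using JJ_D[OF assms(1)] assms(2) by simp

lemma phi_zero [simp]: "phi q \<zero>\<^bsub>Q q\<^esub> J R x = \<zero>"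
proof -
  interpret Qq: abelian_group "Q q" by (rule Q_group)
  show ?thesis using phi_finsum[of "\<lambda>_. undefined" "{}" q J R x] by simp
qed

lemma d_d:
  assumes y: "y \<in> carrier (Q (Suc (Suc q)))"
  shows "d (Suc q) (d (Suc (Suc q)) y) = \<zero>\<^bsub>Q q\<^esub>"
proof (rule Q_eqI)
  interpret Qq: abelian_group "Q q" by (rule Q_group)
  show "d (Suc q) (d (Suc (Suc q)) y) \<in> carrier (Q q)" "\<zero>\<^bsub>Q q\<^esub> \<in> carrier (Q q)"
    using y by (auto intro!: d_closed)
  fix J R x assume J: "J \<in> JJ q"
  have "phi q (d (Suc q) (d (Suc (Suc q)) y)) J R x =
    simplex_diff K m (\<lambda>J. phi (Suc q) (d (Suc (Suc q)) y) J R x) J"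
    by (rule phi_diff[OF d_closed[OF y] J])
  also have "\<dots> = simplex_diff K m (simplex_diff K m (\<lambda>J. phi (Suc (Suc q)) y J R x)) J"
    unfolding simplex_diff_def[of K m _ J]
    by (rule finsum_cong')
      (use phi_diff[OF y insert_JJ[OF J]] y in \<open>auto intro!: alt_sign_closed simplex_diff_closed\<close>)
  also have "\<dots> = \<zero>" by (rule simplex_diff_diff) (use y JJ_D[OF J] in auto)
  finally show "phi q (d (Suc q) (d (Suc (Suc q)) y)) J R x = phi q \<zero>\<^bsub>Q q\<^esub> J R x" by simp
qed

text \<open>
  A morphism that is non-zero at \<^term>\<open>x\<close> is non-zero on the whole component of \<^term>\<open>x\<close> in
  \<^term>\<open>R \<inter> T\<close>, and this component is then an upset of \<^term>\<open>T\<close> and a downset of \<^term>\<open>R\<close>.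
  Hence the complex splits into one augmented simplex complex for each such component; its
  vertices are the maximal upset intervals containing the component.
\<close>

lemma comp_of_support:
  assumes h: "hom_fun K R (UJ J) \<phi>" and J: "J \<subseteq> {1..m}" and x: "\<phi> x \<noteq> \<zero>"
  shows "comp_of R x \<subseteq> UJ J" "comp_of R x \<in> upset_intervals T"
    "comp_of R x = T \<Longrightarrow> contains_as_downset R T"
proof -
  note hD = hom_funD[OF h]
  have UT: "UJ J \<subseteq> T" using UJ_iff[OF J] by auto
  have nz: "\<phi> y \<noteq> \<zero>" if "y \<in> comp_of R x" for y
  proof -
    have "(x, y) \<in> (comparability (R \<inter> T))\<^sup>*" using that by (simp add: comp_of_def)
    then show ?thesis
    proof (induction rule: rtrancl_induct)
      case (step y z)
      then have y: "y \<in> R" "y \<in> UJ J" using hD(2,3) by auto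
      have z: "z \<in> R" "z \<in> T" "y \<le> z \<or> z \<le> y" using step by (auto simp: comparability_def)
      show ?case
      proof (cases "y \<le> z")
        case True
        then have "z \<in> UJ J" using UJ_upset[OF J] y z unfolding relative_upset_def by blast
        then show ?thesis using hD(4)[of y z] True y step by auto
      next
        case False
        then show ?thesis using hD(4)[of z y] z y step by auto
      qed
    qed (rule x)
  qed
  then have mem: "y \<in> R" "y \<in> UJ J" "y \<in> T" if "y \<in> comp_of R x" for y using hD(2,3) that UT by blast+
  then show "comp_of R x \<subseteq> UJ J" by blast
  have xx: "x \<in> comp_of R x" by (simp add: comp_of_def)
  have step: "z \<in> comp_of R x" if "y \<in> comp_of R x" "z \<in> R \<inter> T" "y \<le> z \<or> z \<le> y" for y z
  proof -
    have "(y, z) \<in> comparability (R \<inter> T)" using that mem[OF that(1)] by (auto simp: comparability_def)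
    then show ?thesis using that(1) by (auto simp: comp_of_def)
  qed
  have up: "z \<in> comp_of R x" if "y \<in> comp_of R x" "z \<in> T" "y \<le> z" for y z
  proof -
    have "z \<in> UJ J" using UJ_upset[OF J] mem[OF that(1)] that unfolding relative_upset_def by blast
    then have "\<phi> z \<noteq> \<zero>" using hD(4)[of y z] nz[OF that(1)] mem[OF that(1)] that(3) by auto
    then show ?thesis using step[OF that(1), of z] hD(2)[of z] that by blast
  qed
  have down: "z \<in> comp_of R x" if "y \<in> comp_of R x" "z \<in> R" "z \<le> y" for y z
  proof -
    have "\<phi> z \<noteq> \<zero>" using hD(4)[of z y] nz[OF that(1)] mem[OF that(1)] that by auto
    then show ?thesis using step[OF that(1), of z] hD(3)[of z] UT that by blast
  qed
  have rel: "relative_upset (comp_of R x) T" using up mem unfolding relative_upset_def by blast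
  obtain C where C: "C \<in> pi0 (R \<inter> T)" "x \<in> C" using pi0_ex[of x "R \<inter> T"] mem[OF xx] by blast
  have "comp_of R x = C"
  proof safe
    fix y assume y: "y \<in> comp_of R x"
    then show "y \<in> C" using pi0D(4)[OF C, of y] mem[OF y] by (auto simp: comp_of_def)
  next
    fix y assume "y \<in> C"
    then show "y \<in> comp_of R x" using pi0D(3)[OF C(1) C(2)] by (simp add: comp_of_def)
  qed
  then have "poset_connected (comp_of R x)" using pi0_connected[OF C(1)] by simp
  then show "comp_of R x \<in> upset_intervals T"
    using rel relative_upset_convex[OF T_convex rel] xx
    by (auto simp: upset_intervals_def poset_intervals_def)
  show "contains_as_downset R T" if "comp_of R x = T"
    using that mem(1) down unfolding contains_as_downset_def by blast
qed

text \<open>The component of \<open>x\<close> lies in \<open>UJ J\<close>, hence in every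
  \<open>U j\<close> with \<open>j\<close> in \<open>J\<close>. If it is not \<open>T\<close>, it is
  a proper upset interval and lies in some maximal one; if it is \<open>T\<close>, then
  \<open>R\<close> contains \<open>T\<close> as a downset.\<close>

lemma phi_support:
  assumes y: "y \<in> carrier (Q q)" and nz: "phi q y J R x \<noteq> \<zero>"
  shows "J \<subseteq> verts R x" "x \<in> R \<inter> T" "verts R x \<noteq> {} \<or> contains_as_downset R T"
proof -
  have J: "J \<in> JJ q" using nz by (auto simp: phi_def split: if_splits)
  note h = phi_hom_fun[OF y J, of R] and JD = JJ_D[OF J]
  note c = comp_of_support[OF h JD(1) nz]
  show "J \<subseteq> verts R x" using c(1) JD(1) UJ_iff[OF JD(1)] by (auto simp: verts_def)
  show "x \<in> R \<inter> T" using hom_funD(2,3)[OF h nz] UJ_iff[OF JD(1)] by auto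
  show "verts R x \<noteq> {} \<or> contains_as_downset R T"
  proof (cases "comp_of R x = T")
    case False
    then obtain j where "j \<in> {1..m}" "comp_of R x \<subseteq> U j" using proper_upset_sub[OF c(2)] by blast
    then have "j \<in> verts R x" by (simp add: verts_def)
    then show ?thesis by blast
  qed (use c(3) in blast)
qed

section \<open>The contraction\<close>

lemma comp_of_eq:
  assumes "x \<in> R \<inter> T" "z \<in> R \<inter> T" "x \<le> z" shows "comp_of R x = comp_of R z"
proof -
  have "(x, z) \<in> comparability (R \<inter> T)" "(z, x) \<in> comparability (R \<inter> T)"
    using assms by (auto simp: comparability_def)
  then show ?thesis unfolding comp_of_def by (auto intro: converse_rtrancl_into_rtrancl)
qed

text \<open>All simplices are contracted at once, by a cone whose apex depends on \<open>R\<close>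
  and \<open>x\<close>. The last hypothesis excludes the empty simplex, the only one that is not
  contractible. It is kept abstract because it holds for different reasons in degree zero and in
  positive degrees.\<close>

lemma cycle_is_boundary:
  assumes y: "y \<in> carrier (Q q)"
    and cyc: "\<And>J R x. J \<subseteq> {1..m} \<Longrightarrow> Suc (card J) = q \<Longrightarrow> simplex_diff K m (\<lambda>J. phi q y J R x) J = \<zero>"
    and ne: "\<And>J R x. phi q y J R x \<noteq> \<zero> \<Longrightarrow> verts R x \<noteq> {}"
  shows "\<exists>z\<in>carrier (Q (Suc q)). d (Suc q) z = y"
proof -
  define a where "a R x = Min (verts R x)" for R x
  define \<psi> where "\<psi> J R x = (if a R x \<in> J then phi q y (J - {a R x}) R x else \<zero>)" for J R x
  have fin: "finite (verts R x)" for R x unfolding verts_def by simp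
  have a: "a R x \<in> verts R x" "\<And>j. j \<in> verts R x \<Longrightarrow> a R x \<le> j" if "verts R x \<noteq> {}" for R x
    using that fin by (auto simp: a_def)
  have hom: "hom_fun K R (UJ J) (\<psi> J R)" if J: "J \<in> JJ (Suc q)" for J R
    unfolding hom_fun_def
  proof (intro conjI allI impI)
    note JD = JJ_D[OF J]
    have J1: "J - {i} \<in> JJ q" "UJ J \<subseteq> UJ (J - {i})" if "i \<in> J" for i
      using that JD UJ_mono[of "J - {i}" J] by (auto simp: JJ_def)
    fix x
    show "\<psi> J R x \<in> carrier K" using y by (simp add: \<psi>_def)
    show "\<psi> J R x = \<zero>" if x: "x \<notin> R \<inter> UJ J"
    proof (rule ccontr)
      assume "\<psi> J R x \<noteq> \<zero>"
      \<comment> \<open>The apex is a vertex, and the support condition makes the remaining elements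
        of \<open>J\<close> vertices as well. So every \<open>U j\<close> with \<open>j\<close> in
        \<open>J\<close> contains the component of \<open>x\<close>, and \<open>x\<close> lies in
        \<open>UJ J\<close>.\<close>
      then have nz: "a R x \<in> J" "phi q y (J - {a R x}) R x \<noteq> \<zero>" by (auto simp: \<psi>_def split: if_splits)
      note s = phi_support[OF y nz(2)]
      have "J \<subseteq> verts R x" using s(1) a(1)[OF ne[OF nz(2)]] by auto
      moreover have "x \<in> comp_of R x" by (simp add: comp_of_def)
      ultimately have "x \<in> UJ J" using s(2) unfolding UJ_iff[OF JD(1)] verts_def by blast
      then show False using x s(2) by auto
    qed
    fix z assume xz: "x \<le> z \<and> x \<in> R \<and> z \<in> UJ J"
    then have zT: "z \<in> T" using UJ_iff[OF JD(1)] by auto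
    have eq: "phi q y (J - {i}) R x = phi q y (J - {i}) R z" if "i \<in> J" for i
      using hom_funD(4)[OF phi_hom_fun[OF y J1(1)[OF that]]] xz J1(2)[OF that] by blast
    show "\<psi> J R x = \<psi> J R z"
    proof (cases "x \<in> R \<inter> T \<and> z \<in> R \<inter> T")
      case True
      then have "a R x = a R z" using comp_of_eq[of x R z] xz by (simp add: a_def verts_def)
      then show ?thesis using eq by (simp add: \<psi>_def)
    next
      case False
      \<comment> \<open>Here the apices at \<open>x\<close> and \<open>z\<close> may differ. But one
        of the two scalars vanishes for each face, and equality along \<open>x \<le> z\<close> makes
        both vanish, so both cone values are zero.\<close>
      then have "phi q y (J - {i}) R x = \<zero> \<or> phi q y (J - {i}) R z = \<zero>" for i
        using phi_support(2)[OF y] by blast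
      then have "phi q y (J - {i}) R x = \<zero> \<and> phi q y (J - {i}) R z = \<zero>" if "i \<in> J" for i
        using eq[OF that] by metis
      then have "\<psi> J R x = \<zero>" "\<psi> J R z = \<zero>" by (auto simp: \<psi>_def)
      then show ?thesis by simp
    qed
  qed
  obtain z where z: "z \<in> carrier (Q (Suc q))"
    "\<And>J R x. J \<in> JJ (Suc q) \<Longrightarrow> R \<in> poset_intervals \<Longrightarrow> phi (Suc q) z J R x = \<psi> J R x"
    using Q_ex[of "Suc q" \<psi>] hom by blast
  have "d (Suc q) z = y"
  proof (rule Q_eqI[OF d_closed[OF z(1)] y])
    fix J R x assume J: "J \<in> JJ q"
    note JD = JJ_D[OF J]
    show "phi q (d (Suc q) z) J R x = phi q y J R x"
    proof (cases "R \<in> poset_intervals")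
      case False
      then have "phi q v J R x = \<zero>" for v by (auto simp: phi_def coef_def intro!: add.finprod_one_eqI)
      then show ?thesis by simp
    next
      case True
      have "phi q (d (Suc q) z) J R x = simplex_diff K m (\<lambda>J. phi (Suc q) z J R x) J"
        by (rule phi_diff[OF z(1) J])
      also have "\<dots> = simplex_diff K m (\<lambda>J. \<psi> J R x) J"
        unfolding simplex_diff_def
        by (rule finsum_cong') (use z(2)[OF insert_JJ[OF J] True] y in \<open>auto simp: \<psi>_def\<close>)
      also have "\<dots> = phi q y J R x"
      proof (cases "verts R x = {}")
        case False
        show ?thesis
          unfolding \<psi>_def
        proof (rule simplex_diff_cone[where A = "verts R x" and q = q])
          show "verts R x \<subseteq> {1..m}" by (auto simp: verts_def)
          show "J \<subseteq> verts R x" if "phi q y J R x \<noteq> \<zero>" for J by (rule phi_support(1)[OF y that])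
        qed (use y a[OF False] cyc JD in auto)
      next
        case True
        then have "phi q y J R x = \<zero>" for J using ne by blast
        then show ?thesis by (auto simp: \<psi>_def simplex_diff_def intro!: add.finprod_one_eqI)
      qed
      finally show ?thesis .
    qed
  qed
  then show ?thesis using z(1) by blast
qed

text \<open>In positive degree the index set of a non-zero scalar is non-empty and consists of
  vertices, so no empty simplex occurs.\<close>

lemma kernel_d:
  assumes y: "y \<in> carrier (Q (Suc q))" and dy: "d (Suc q) y = \<zero>\<^bsub>Q q\<^esub>"
  shows "\<exists>z\<in>carrier (Q (Suc (Suc q))). d (Suc (Suc q)) z = y"
proof (rule cycle_is_boundary[OF y])
  fix J R x
  show "simplex_diff K m (\<lambda>J. phi (Suc q) y J R x) J = \<zero>" if "J \<subseteq> {1..m}" "Suc (card J) = Suc q"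
    using phi_diff[OF y, of J R x] dy that by (simp add: JJ_def)
  show "verts R x \<noteq> {}" if nz: "phi (Suc q) y J R x \<noteq> \<zero>"
  proof -
    have "J \<in> JJ (Suc q)" using nz by (auto simp: phi_def split: if_splits)
    then show ?thesis using phi_support(1)[OF y nz] by (auto simp: JJ_def)
  qed
qed

section \<open>Degree zero and the standard module\<close>

lemma JJ_0: "JJ 0 = {{}}"
proof -
  have "J = {}" if "J \<in> JJ 0" for J using JJ_D[OF that] by simp
  then show ?thesis by (auto simp: JJ_def)
qed

lemma idx_0: "idx 0 = {({}, T)}"
  using pi0_self[OF T] by (auto simp: idx_Sigma JJ_0)

lemma coord_hom: "res_zero_coord T \<in> lm_hom A (Q 0) (proj_mod K T)"
  using lm_dsum_coord_hom[of "({}, T)" "idx 0" A "\<lambda>i. proj_mod K (snd i)"]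
  by (simp add: idx_0 Q_eq res_zero_coord_def[abs_def])

lemma coord_iso: "res_zero_coord T \<in> lm_iso A (Q 0) (proj_mod K T)"
proof -
  have "bij_betw (res_zero_coord T) (carrier (Q 0)) (carrier (proj_mod K T))"
  proof (rule bij_betwI[where g = "\<lambda>p. \<lambda>i\<in>{({}, T)}. p"])
    show "res_zero_coord T \<in> carrier (Q 0) \<rightarrow> carrier (proj_mod K T)"
      using lm_homD(1)[OF coord_hom] by auto
    show "(\<lambda>i\<in>{({}, T)}. res_zero_coord T y) = y" if "y \<in> carrier (Q 0)" for y
      using that by (auto simp: Q_eq idx_0 res_zero_coord_def PiE_iff intro!: extensionalityI[of _ "{({}, T)}"])
  qed (auto simp: Q_eq idx_0 res_zero_coord_def)
  then show ?thesis using coord_hom by (simp add: lm_iso_def)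
qed

lemma phi_0:
  assumes "y \<in> carrier (Q 0)" shows "phi 0 y {} R x = coef K (res_zero_coord T y) R T x"
  using Q_carrierD(2)[OF assms, of "{}" T] idx_0
  by (simp add: phi_def JJ_0 pi0_self[OF T] res_zero_coord_def)

text \<open>Where \<open>R\<close> does not contain \<open>T\<close> as a downset, the simplex of a
  non-zero scalar is non-empty and the cone applies. Where it does, \<open>T\<close> is a single
  component of \<open>R \<inter> T\<close> and lies in no \<open>U j\<close>, so boundaries vanish
  there.\<close>

lemma image_d1:
  assumes y: "y \<in> carrier (Q 0)"
  shows "res_zero_coord T y \<in> standard_sub K T \<longleftrightarrow> (\<exists>z\<in>carrier (Q 1). d 1 z = y)"
proof
  assume s: "res_zero_coord T y \<in> standard_sub K T"
  have "\<exists>z\<in>carrier (Q (Suc 0)). d (Suc 0) z = y"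
  proof (rule cycle_is_boundary[OF y])
    fix J R x assume nz: "phi 0 y J R x \<noteq> \<zero>"
    then have J: "J = {}" by (auto simp: phi_def JJ_0 split: if_splits)
    have "\<not> contains_as_downset R T"
      using s nz phi_0[OF y] unfolding J by (auto simp: standard_sub_def)
    then show "verts R x \<noteq> {}" using phi_support(3)[OF y nz] by blast
  qed simp
  then show "\<exists>z\<in>carrier (Q 1). d 1 z = y" by simp
next
  assume "\<exists>z\<in>carrier (Q 1). d 1 z = y"
  then obtain z where z: "z \<in> carrier (Q (Suc 0))" "d (Suc 0) z = y" by auto
  have "coef K (res_zero_coord T y) R T x = \<zero>" if R: "contains_as_downset R T" for R x
  proof -
    have TR: "R \<inter> T = T" using R by (auto simp: contains_as_downset_def)
    have "phi (Suc 0) z {j} R x = \<zero>" if "j \<in> {1..m}" for j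
    proof (rule ccontr)
      assume nz: "phi (Suc 0) z {j} R x \<noteq> \<zero>"
      note s = phi_support[OF z(1) nz]
      have "w \<in> comp_of R x" if "w \<in> T" for w
        using that s(2) T unfolding comp_of_def TR poset_intervals_def poset_connected_def by auto
      then have "T \<subseteq> U j" using s(1) by (auto simp: verts_def)
      then show False using UD(2,3)[OF that] by auto
    qed
    then have "simplex_diff K m (\<lambda>J. phi (Suc 0) z J R x) {} = \<zero>"
      by (auto simp: simplex_diff_def intro!: add.finprod_one_eqI)
    then show ?thesis using phi_diff[OF z(1), of "{}" R x] phi_0[OF y] z(2) by (simp add: JJ_0)
  qed
  then show "res_zero_coord T y \<in> standard_sub K T"
    using lm_homD(1)[OF coord_hom y] by (simp add: standard_sub_def)
qed

text \<open>Every component in degree one lies in some \<open>U j\<close>, hence is a proper upset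
  interval of \<open>T\<close>, and the first differential multiplies by its inclusion into
  \<open>T\<close>. So a submodule containing these inclusions contains all boundaries, and these
  make up \<open>standard_sub K T\<close> by \<open>image_d1\<close>.\<close>

lemma standard_kernel: "standard_kernel K T = standard_sub K T"
proof (rule standard_kernel_eq[OF T])
  fix N assume N: "submodule N A (proj_mod K T)"
    and gen: "\<And>C. C \<in> upset_intervals T - {T} \<Longrightarrow> incl_elem K C T \<in> N"
  note pm = left_module_proj_mod[OF T]
  interpret P: left_module A "proj_mod K T" by fact
  interpret Q0: left_module A "Q 0" by (rule Q_module)
  note N' = P.submoduleD[OF N]
  \<comment> \<open>\<open>N\<close> is pulled back to \<open>Q 0\<close>, where the sums defining
    the differential are formed.\<close>
  define N0 where "N0 = {v \<in> carrier (Q 0). res_zero_coord T v \<in> N}"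
  have N0: "submodule N0 A (Q 0)"
    unfolding N0_def by (rule lm_hom_vimage_submodule[OF Q_module pm coord_hom N])
  note N0' = Q0.submoduleD[OF N0]
  have face: "face_map 0 i r (y i) \<in> N0" if y: "y \<in> carrier (Q (Suc 0))" and i: "i \<in> idx (Suc 0)" and r: "r < Suc 0" for y i r
  proof -
    obtain J C where JC: "i = (J, C)" by (cases i)
    note f = face_comp[OF i[unfolded JC] r]
    have D: "face J r = {}" "face_comp T U J C r = T" using f(1) idx_0 by auto
    have JJ: "J \<in> JJ (Suc 0)" "C \<in> pi0 (UJ J)" using i by (auto simp: JC idx_Sigma)
    then obtain j where j: "J = {j}" "j \<in> {1..m}" by (auto simp: JJ_def card_Suc_eq)
    have "C \<subseteq> U j" using pi0D(2)[OF JJ(2)] j by (auto simp: upset_inter_def)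
    then have "C \<in> upset_intervals T - {T}" using f(2) D UD(2,3)[OF j(2)] by auto
    then have jN: "incl_elem K C T \<in> N" by (rule gen)
    have yA: "y (J, C) \<in> carrier A" by (rule Q_carrierD(2)[OF y i[unfolded JC]])
    have "res_zero_coord T (face_map 0 i r (y i)) = y (J, C) \<otimes>\<^bsub>A\<^esub> incl_elem K C T"
      by (simp add: face_map_def JC D incl_eq lm_incl_def idx_0 res_zero_coord_def proj_push_eq)
    also have "\<dots> \<in> N" using N'(4)[OF yA jN] by simp
    finally show ?thesis
      using lm_homD(1)[OF face_map_hom[OF i r]] Q_carrierD(1)[OF y i[unfolded JC]]
      by (simp add: N0_def JC)
  qed
  have alt: "alt_sign (Q 0) r v \<in> N0" if "v \<in> N0" for r v using N0'(5) that by (simp add: alt_sign_def)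
  show "standard_sub K T \<subseteq> N"
  proof
    fix s assume s: "s \<in> standard_sub K T"
    then have "s \<in> carrier (proj_mod K T)" by (simp add: standard_sub_def)
    then have "s \<in> res_zero_coord T ` carrier (Q 0)"
      using coord_iso by (simp add: lm_iso_def bij_betw_def)
    then obtain v where v: "v \<in> carrier (Q 0)" "s = res_zero_coord T v" by auto
    then obtain z where z: "z \<in> carrier (Q (Suc 0))" "d (Suc 0) z = v"
      using image_d1[OF v(1)] s by auto
    have "d (Suc 0) z \<in> N0"
      unfolding d_eq[OF z(1)]
      by (intro Q0.submodule_finsum[OF N0] Pi_I alt face z(1)) auto
    then show "s \<in> N" using v z by (simp add: N0_def)
  qed
qed

lemma exact:
  "exact_augmented A Q d (standard_proj K T \<circ> res_zero_coord T) (standard_mod K T)"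
proof -
  note pm = left_module_proj_mod[OF T] and sub = standard_sub_submodule[OF T]
  have eqs: "standard_proj K T = lm_quot_proj (proj_mod K T) (standard_sub K T)"
    "standard_mod K T = lm_quot (proj_mod K T) (standard_sub K T)"
    by (simp_all add: standard_proj_def standard_mod_def standard_kernel)
  note p = quot_proj_hom[OF pm sub] and lq = left_module_quot[OF pm sub]
  let ?p = "standard_proj K T \<circ> res_zero_coord T"
  have im: "res_zero_coord T ` carrier (Q 0) = carrier (proj_mod K T)"
    using coord_iso by (simp add: lm_iso_def bij_betw_def)
  have "?p \<in> lm_hom A (Q 0) (standard_mod K T)"
    unfolding eqs by (rule lm_hom_compose[OF coord_hom p(1)])
  moreover have "?p ` carrier (Q 0) = carrier (standard_mod K T)"
    unfolding eqs image_comp[symmetric] im by (rule p(2))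
  moreover have "d 1 ` carrier (Q 1) = a_kernel (Q 0) (standard_mod K T) ?p"
  proof -
    have "y \<in> d 1 ` carrier (Q 1) \<longleftrightarrow> y \<in> carrier (Q 0) \<and> ?p y = \<zero>\<^bsub>standard_mod K T\<^esub>" for y
    proof (cases "y \<in> carrier (Q 0)")
      case True
      have "?p y = \<zero>\<^bsub>standard_mod K T\<^esub> \<longleftrightarrow> res_zero_coord T y \<in> standard_sub K T"
        unfolding eqs using p(3)[OF lm_homD(1)[OF coord_hom True]] by simp
      then show ?thesis using image_d1[OF True] True by auto
    next
      case False
      then show ?thesis using d_closed[of _ 0] by auto
    qed
    then show ?thesis by (auto simp: a_kernel_def')
  qed
  moreover have "d (Suc (Suc q)) ` carrier (Q (Suc (Suc q))) = a_kernel (Q (Suc q)) (Q q) (d (Suc q))" for q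
    using d_d kernel_d d_closed by (fastforce simp: a_kernel_def')
  ultimately show ?thesis
    unfolding exact_augmented_def using Q_module d_hom lq by (simp add: eqs)
qed

lemma resolution:
  "projective_resolution tx ty A Q d (standard_proj K T \<circ> res_zero_coord T) (standard_mod K T)"
  using exact lm_fin_gen_image[of A "Q 0" "standard_mod K T" "standard_proj K T \<circ> res_zero_coord T"]
    Q_fin_gen Q_projective
  by (auto simp: projective_resolution_def exact_augmented_def)

end

theorem theorem1p2:
  fixes K :: "'k ring"
    and T :: "'p::{finite, order} set"
    and U :: "nat \<Rightarrow> 'p set"
    and m :: nat
  assumes "field K"
    and "poset_connected (UNIV :: 'p set)"
    and "T \<in> poset_intervals"
    and "bij_betw U {1..m} (maximal_upset_intervals T)"
  shows "res_zero_coord T \<in> lm_iso (interval_alg K) (res_mod K T U m 0) (proj_mod K T)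
    \<and> exact_augmented (interval_alg K) (res_mod K T U m) (res_diff K T U m)
        (standard_proj K T \<circ> res_zero_coord T) (standard_mod K T)
    \<and> projective_resolution TYPE('x) TYPE('y) (interval_alg K) (res_mod K T U m)
        (res_diff K T U m) (standard_proj K T \<circ> res_zero_coord T) (standard_mod K T)"
proof -
  interpret upset_complex K T U m
    using assms by (intro upset_complex.intro interval_field.intro upset_complex_axioms.intro)
  show ?thesis using coord_iso exact resolution by blast
qed

end
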